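(* Let $X$ be a compact metric space and let $\mathcal{S}$ be a subset of $\mathcal{P}(X)\times\mathcal{P}(X)$. The following are equivalent: (1) $\mathcal{S}$ is a transitive backward transfer set containing the diagonal $\{(\mu,\mu):\mu\in\mathcal{P}(X)\}$. (2) $\mathcal{S}=\{(\mu,\nu)\in\mathcal{P}(X)\times\mathcal{P}(X):\ \mu\prec_{\mathcal{A}}\nu\}$, where $\mathcal{A}$ is a balayage cone in $C(X)$. (3) $\mathcal{S}=\{(\mu,\nu)\in\mathcal{P}(X)\times\mathcal{P}(X):\ \nu\le T_\#\mu\}$, where $T:C(X)\to USC(X)$ is an idempotent positively $1$-homogenous backward Kantorovich operator such that $Tf\ge f$ for all $f\in C(X)$.
   Context: Notation. $\mathcal{M}(X)$: signed Radon measures; $\mathcal{P}(X)$: probability measures, with the weak$^*$ topology. $USC(X)$: bounded above, proper (finite somewhere), upper semi-continuous functions $X\to[-\infty,\infty)$. $\nu\le T_\#\mu$ means $\int_X g\,d\nu\le\int_X Tg\,d\mu$ for all $g\in C(X)$. $\mathcal{S}$ is transitive if $(\mu,\sigma)\in\mathcal{S}$ and $(\sigma,\nu)\in\mathcal{S}$ imply $(\mu,\nu)\in\mathcal{S}$. Backward linear transfer on $X\times X$: a functional $\mathcal{T}:\mathcal{M}(X)\times\mathcal{M}(X)\to\mathbb{R}\cup\{+\infty\}$ such that (i) it is proper, convex, bounded below and weak$^*$ lower semi-continuous; (ii) $D(\mathcal{T})=\{\mathcal{T}<+\infty\}\subset\mathcal{P}(X)\times\mathcal{P}(X)$; (iii)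 there is a map $T^-$ from $C(X)$ to the bounded above Borel functions on $X$ with $\sup_{\sigma\in\mathcal{P}(X)}\{\int g\,d\sigma-\mathcal{T}(\mu,\sigma)\}=\int_X T^-g\,d\mu$ for all $\mu\in\mathcal{P}(X)$, $g\in C(X)$. A set $\mathcal{S}$ is a backward transfer set if the functional equal to $0$ on $\mathcal{S}$ and $+\infty$ elsewhere is a backward linear transfer. Balayage cone in $C(X)$: a closed (under uniform convergence) convex cone $\mathcal{A}\subset C(X)$, stable under finite maxima and containing the non-negative constants. $\mu\prec_{\mathcal{A}}\nu$ means $\int_X\phi\,d\mu\le\int_X\phi\,d\nu$ for all $\phi\in\mathcal{A}$. Backward Kantorovich operator: a map $T:C(X)\to USC(X)$ that is monotone; satisfies $T(g+c)=Tg+c$ for $c\in\mathbb{R}$; is convex ($T(\lambda g_1+(1-\lambda)g_2)\le\lambda Tg_1+(1-\lambda)Tg_2$, $\lambda\in[0,1]$); and is lower semi-continuous ($g_n\to g$ uniformly implies $\liminf_nTg_n\ge Tg$ pointwise). Positively $1$-homogenous: $T(\lambda g)=\lambda Tg$ for $\lambda\ge0$. $T$ is extended to upper semi-continuous $g$ by $Tg(x)=\inf\{Th(x):h\in C(X),\ h\ge g\}$, and idempotent means $T(Tf)=Tf$ for all $f\in C(X)$. *)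

theory Defs
  imports "HOL-Probability.Probability"
begin

text \<open>
  The underlying space \<open>X\<close> is the universe of a type \<open>'a :: metric_space\<close> that is assumed to be
  compact. Then \<open>C(X)\<close> with the topology of uniform convergence is the type \<open>'a \<Rightarrow>\<^sub>C real\<close>, since
  every continuous function on \<open>X\<close> is bounded.
\<close>

section \<open>Measures\<close>

definition prob_measures :: "'a::metric_space measure set" where
  "prob_measures = {\<mu>. prob_space \<mu> \<and> sets \<mu> = sets borel}"

text \<open>
  Signed measures are real-valued, countably additive set functions on the Borel sets, with value 0
  on non-Borel sets, so that distinct set functions are distinct signed measures. No regularity
  condition is imposed: every finite Borel measure on a compact metric space is Radon.
\<close>

definition signed_measures :: "('a::metric_space set \<Rightarrow> real) set" where
  "signed_measures = {m. (\<forall>A. A \<notin> sets borel \<longrightarrow> m A = 0) \<and>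
     (\<forall>A :: nat \<Rightarrow> 'a set. range A \<subseteq> sets borel \<longrightarrow> disjoint_family A \<longrightarrow>
        (\<lambda>n. m (A n)) sums m (\<Union>n. A n))}"

text \<open>
  The upper variation of \<open>m\<close>, i.e. the positive part of its Jordan decomposition. The coercion
  \<open>ennreal\<close> sends negative numbers to 0, which is harmless because of \<open>B = {}\<close>.
\<close>

definition positive_variation :: "('a::metric_space set \<Rightarrow> real) \<Rightarrow> 'a measure" where
  "positive_variation m =
     measure_of UNIV (sets borel) (\<lambda>A. SUP B\<in>{B \<in> sets borel. B \<subseteq> A}. ennreal (m B))"

definition negative_variation :: "('a::metric_space set \<Rightarrow> real) \<Rightarrow> 'a measure" where
  "negative_variation m = positive_variation (\<lambda>A. - m A)"

definition signed_integral :: "('a::metric_space set \<Rightarrow> real) \<Rightarrow> ('a \<Rightarrow> real) \<Rightarrow> real" where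
  "signed_integral m g =
     (\<integral>x. g x \<partial>positive_variation m) - (\<integral>x. g x \<partial>negative_variation m)"

definition weak_star :: "('a::metric_space set \<Rightarrow> real) topology" where
  "weak_star = pullback_topology signed_measures
     (\<lambda>m g. signed_integral m (apply_bcontfun g)) (powertop_real UNIV)"

text \<open>
  A probability measure \<open>\<mu>\<close> is viewed as the signed measure \<open>measure \<mu>\<close> (which vanishes outside
  \<open>sets \<mu>\<close>); the following two lemmas confirm that this is compatible with integration.
\<close>

lemma measure_in_signed_measures:
  assumes "\<mu> \<in> prob_measures"
  shows "measure \<mu> \<in> signed_measures"
proof -
  interpret prob_space \<mu> using assms by (simp add: prob_measures_def)
  have s: "sets \<mu> = sets borel" using assms by (simp add: prob_measures_def)
  show ?thesis
    unfolding signed_measures_def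
    using finite_measure_UNION by (auto simp: s measure_notin_sets)
qed

lemma signed_integral_measure:
  assumes "\<mu> \<in> prob_measures"
  shows "signed_integral (measure \<mu>) g = (\<integral>x. g x \<partial>\<mu>)"
proof -
  interpret prob_space \<mu> using assms by (simp add: prob_measures_def)
  have s: "sets \<mu> = sets borel" using assms by (simp add: prob_measures_def)
  have sp: "space \<mu> = UNIV" using sets_eq_imp_space_eq[OF s] by simp
  have sa: "sigma_algebra (UNIV :: 'a set) (sets borel)"
    using sets.sigma_algebra_axioms[of "borel :: 'a measure"] by simp
  have sup: "(SUP B\<in>{B \<in> sets borel. B \<subseteq> A}. ennreal (measure \<mu> B)) = emeasure \<mu> A"
    if "A \<in> sets borel" for A
    by (rule antisym)
       (use that in \<open>auto intro!: SUP_least SUP_upper2[of A] emeasure_mono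
          simp: emeasure_eq_measure[symmetric] s\<close>)
  have "positive_variation (measure \<mu>) = measure_of UNIV (sets borel) (emeasure \<mu>)"
    unfolding positive_variation_def
    by (rule measure_of_eq) (use sup sigma_algebra.sigma_sets_eq[OF sa] in auto)
  also have "\<dots> = \<mu>"
    using measure_of_of_measure[of \<mu>] by (simp add: s sp)
  finally have pos: "positive_variation (measure \<mu>) = \<mu>" .
  have "negative_variation (measure \<mu>) = measure_of UNIV (sets borel) (\<lambda>_. 0)"
    unfolding negative_variation_def positive_variation_def
    by (rule measure_of_eq) (auto simp: ennreal_neg intro!: antisym SUP_least)
  also have "\<dots> = null_measure borel"
    using measure_of_of_measure[of "null_measure (borel :: 'a measure)"]
      measure_of_eq[of "sets borel" "UNIV :: 'a set" "\<lambda>_. 0" "emeasure (null_measure borel)"]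
    by simp
  finally show ?thesis
    by (simp add: signed_integral_def pos)
qed

text \<open>
  The integral, with values in \<open>[-\<infinity>, \<infinity>)\<close>, of a Borel function that is bounded above with respect to
  a finite measure. As \<open>e2ennreal\<close> sends negative numbers to 0, the two terms are the integrals of
  the positive and of the negative part; the first one is finite.
\<close>

definition ext_integral :: "'a measure \<Rightarrow> ('a \<Rightarrow> ereal) \<Rightarrow> ereal" where
  "ext_integral \<mu> f =
     enn2ereal (\<integral>\<^sup>+x. e2ennreal (f x) \<partial>\<mu>) - enn2ereal (\<integral>\<^sup>+x. e2ennreal (- f x) \<partial>\<mu>)"


section \<open>Backward linear transfers\<close>

definition bounded_above :: "('a \<Rightarrow> ereal) \<Rightarrow> bool" where
  "bounded_above f \<longleftrightarrow> (\<exists>b::real. \<forall>x. f x \<le> ereal b)"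

text \<open>
  Functionals on \<open>\<M>(X) \<times> \<M>(X)\<close> are total functions that are only ever inspected on
  \<open>signed_measures \<times> signed_measures\<close>. Their being bounded below excludes the value \<open>-\<infinity>\<close>.
\<close>

definition proper_functional :: "(('a::metric_space set \<Rightarrow> real) \<times> ('a set \<Rightarrow> real) \<Rightarrow> ereal) \<Rightarrow> bool" where
  "proper_functional F \<longleftrightarrow> (\<exists>p \<in> signed_measures \<times> signed_measures. F p < \<infinity>)"

definition bounded_below_functional :: "(('a::metric_space set \<Rightarrow> real) \<times> ('a set \<Rightarrow> real) \<Rightarrow> ereal) \<Rightarrow> bool" where
  "bounded_below_functional F \<longleftrightarrow>
     (\<exists>b::real. \<forall>p \<in> signed_measures \<times> signed_measures. ereal b \<le> F p)"

definition convex_functional :: "(('a::metric_space set \<Rightarrow> real) \<times> ('a set \<Rightarrow> real) \<Rightarrow> ereal) \<Rightarrow> bool" where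
  "convex_functional F \<longleftrightarrow>
     (\<forall>m\<in>signed_measures. \<forall>n\<in>signed_measures. \<forall>m'\<in>signed_measures. \<forall>n'\<in>signed_measures.
      \<forall>l\<in>{0..1::real}.
        F (\<lambda>A. l * m A + (1 - l) * m' A, \<lambda>A. l * n A + (1 - l) * n' A)
          \<le> ereal l * F (m, n) + ereal (1 - l) * F (m', n'))"

definition weak_star_lsc :: "(('a::metric_space set \<Rightarrow> real) \<times> ('a set \<Rightarrow> real) \<Rightarrow> ereal) \<Rightarrow> bool" where
  "weak_star_lsc F \<longleftrightarrow>
     (\<forall>c::real. closedin (prod_topology weak_star weak_star)
        {p \<in> signed_measures \<times> signed_measures. F p \<le> ereal c})"

definition backward_linear_transfer ::
    "(('a::metric_space set \<Rightarrow> real) \<times> ('a set \<Rightarrow> real) \<Rightarrow> ereal) \<Rightarrow> bool" where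
  "backward_linear_transfer F \<longleftrightarrow>
     proper_functional F \<and> convex_functional F \<and> bounded_below_functional F \<and> weak_star_lsc F \<and>
     {p \<in> signed_measures \<times> signed_measures. F p < \<infinity>}
       \<subseteq> (measure ` prob_measures) \<times> (measure ` prob_measures) \<and>
     (\<exists>U :: ('a \<Rightarrow>\<^sub>C real) \<Rightarrow> 'a \<Rightarrow> ereal.
        (\<forall>g. U g \<in> borel_measurable borel \<and> bounded_above (U g)) \<and>
        (\<forall>\<mu>\<in>prob_measures. \<forall>g.
           (SUP \<sigma>\<in>prob_measures. ereal (\<integral>x. apply_bcontfun g x \<partial>\<sigma>) - F (measure \<mu>, measure \<sigma>))
             = ext_integral \<mu> (U g)))"

definition transfer_indicator ::
    "('a measure \<times> 'a measure) set \<Rightarrow> ('a::metric_space set \<Rightarrow> real) \<times> ('a set \<Rightarrow> real) \<Rightarrow> ereal" where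
  "transfer_indicator S p = (if p \<in> map_prod measure measure ` S then 0 else \<infinity>)"

definition backward_transfer_set :: "('a::metric_space measure \<times> 'a measure) set \<Rightarrow> bool" where
  "backward_transfer_set S \<longleftrightarrow> backward_linear_transfer (transfer_indicator S)"


section \<open>Balayage cones\<close>

definition balayage_cone :: "('a::metric_space \<Rightarrow>\<^sub>C real) set \<Rightarrow> bool" where
  "balayage_cone A \<longleftrightarrow>
     closed A \<and> convex_cone A \<and>
     (\<forall>f\<in>A. \<forall>g\<in>A. \<exists>h\<in>A. \<forall>x. h x = max (f x) (g x)) \<and>
     (\<forall>c\<ge>0. const_bcontfun c \<in> A)"

definition balayage_le ::
    "('a::metric_space \<Rightarrow>\<^sub>C real) set \<Rightarrow> 'a measure \<Rightarrow> 'a measure \<Rightarrow> bool" where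
  "balayage_le A \<mu> \<nu> \<longleftrightarrow> (\<forall>\<phi>\<in>A. (\<integral>x. \<phi> x \<partial>\<mu>) \<le> (\<integral>x. \<phi> x \<partial>\<nu>))"


section \<open>Backward Kantorovich operators\<close>

definition USC :: "('a::metric_space \<Rightarrow> ereal) set" where
  "USC = {f. bounded_above f \<and> (\<exists>x. f x \<noteq> -\<infinity>) \<and> (\<forall>c::real. open {x. f x < ereal c})}"

definition backward_Kantorovich :: "(('a::metric_space \<Rightarrow>\<^sub>C real) \<Rightarrow> 'a \<Rightarrow> ereal) \<Rightarrow> bool" where
  "backward_Kantorovich T \<longleftrightarrow>
     (\<forall>g. T g \<in> USC) \<and>
     (\<forall>g h. (\<forall>x. apply_bcontfun g x \<le> apply_bcontfun h x) \<longrightarrow> (\<forall>x. T g x \<le> T h x)) \<and>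
     (\<forall>g c x. T (g + const_bcontfun c) x = T g x + ereal c) \<and>
     (\<forall>g h x. \<forall>l\<in>{0..1::real}.
        T (l *\<^sub>R g + (1 - l) *\<^sub>R h) x \<le> ereal l * T g x + ereal (1 - l) * T h x) \<and>
     (\<forall>gs g x. gs \<longlonglongrightarrow> g \<longrightarrow> T g x \<le> liminf (\<lambda>n. T (gs n) x))"

text \<open>In \<open>ereal\<close>, \<open>0 * (-\<infinity>) = 0\<close>; so \<open>l = 0\<close> says \<open>T 0 = 0\<close>.\<close>

definition positively_homogeneous :: "(('a::metric_space \<Rightarrow>\<^sub>C real) \<Rightarrow> 'a \<Rightarrow> ereal) \<Rightarrow> bool" where
  "positively_homogeneous T \<longleftrightarrow> (\<forall>g x. \<forall>l\<ge>0. T (l *\<^sub>R g) x = ereal l * T g x)"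

definition usc_extension ::
    "(('a::metric_space \<Rightarrow>\<^sub>C real) \<Rightarrow> 'a \<Rightarrow> ereal) \<Rightarrow> ('a \<Rightarrow> ereal) \<Rightarrow> 'a \<Rightarrow> ereal" where
  "usc_extension T g x = (INF h\<in>{h. \<forall>y. g y \<le> ereal (apply_bcontfun h y)}. T h x)"

definition idempotent_operator :: "(('a::metric_space \<Rightarrow>\<^sub>C real) \<Rightarrow> 'a \<Rightarrow> ereal) \<Rightarrow> bool" where
  "idempotent_operator T \<longleftrightarrow> (\<forall>f. usc_extension T (T f) = T f)"

text \<open>\<open>pushforward_le T \<mu> \<nu>\<close> is the relation \<open>\<nu> \<le> T\<^sub>#\<mu>\<close>.\<close>

definition pushforward_le ::
    "(('a::metric_space \<Rightarrow>\<^sub>C real) \<Rightarrow> 'a \<Rightarrow> ereal) \<Rightarrow> 'a measure \<Rightarrow> 'a measure \<Rightarrow> bool" where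
  "pushforward_le T \<mu> \<nu> \<longleftrightarrow> (\<forall>g. ereal (\<integral>x. apply_bcontfun g x \<partial>\<nu>) \<le> ext_integral \<mu> (T g))"

end

theory Submission
  imports Defs
begin

text \<open>
  All three conditions are compared with a fourth one: \<open>(\<mu>, \<nu>) \<in> S\<close> iff \<open>\<integral>g d\<nu> \<le> \<integral>t g d\<mu>\<close> for all \<open>g\<close>,
  where \<open>t\<close> is a real-valued sublinear idempotent operator with \<open>t g \<ge> g\<close>, called an idempotent
  envelope below.

  A balayage cone \<open>A\<close> gives \<open>t g = inf {\<psi> \<ge> g. - \<psi> \<in> A + \<real>}\<close>. Conversely \<open>t\<close> gives the cone of all \<open>\<phi>\<close> with
  \<open>t (- \<phi>) \<le> - \<phi>\<close>; the point is that it is rich enough to recover \<open>t\<close>. By idempotence every continuous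
  \<open>h > t g\<close> starts a chain \<open>h = k\<^sub>0 > t k\<^sub>1\<close>, \<open>k\<^sub>1 > t k\<^sub>2\<close>, and so on, of functions above \<open>t g\<close>. The
  average \<open>\<psi>\<close> of its first \<open>n\<close> members satisfies \<open>t \<psi> \<le> \<psi> + O(1/n)\<close>, and iterating this correction gives a
  uniformly convergent sequence whose limit is an exact continuous solution of \<open>t \<psi> \<le> \<psi>\<close> between \<open>g\<close>
  and \<open>h + \<epsilon>\<close>.

  A transfer set \<open>S\<close> gives \<open>t g x = sup {\<integral>g d\<sigma>. (\<delta>\<^sub>x, \<sigma>) \<in> S}\<close>. Weak* closedness and convexity of \<open>S\<close> allow
  one to separate a pair outside \<open>S\<close> from \<open>S\<close> by finitely many test functions. Probability measures are
  produced by the Mazur--Orlicz form of the Hahn--Banach theorem followed by Riesz representation, which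
  replaces weak* compactness in the proofs of semicontinuity, of idempotence (by transitivity), and of the
  attainment of the supremum in the definition of a transfer.
\<close>

section \<open>Sublinear functionals and the Mazur--Orlicz theorem\<close>

text \<open>An envelope \<open>t g\<close> is in general only upper semicontinuous, so
  \<open>t\<close> cannot be applied to it again. Idempotence is therefore used through continuous
  functions above \<open>t g\<close>, and strictly above it: a strict inequality between an upper
  semicontinuous and a continuous function defines an open set, and compactness then merges choices
  made at single points into one function.

  A second obstacle is that transfers are functionals on all pairs of signed measures.
  Semicontinuity of the indicator of \<open>S\<close> asks for closedness in that larger space, so
  being a probability measure must be expressed by weak-star closed conditions on integrals. The
  Jordan decomposition is developed for this purpose.

  Finally, the map that belongs to a transfer is only known to be Borel and bounded above. Dirac
  measures identify its values, and its semicontinuity has to be proved.\<close>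

definition sublinear :: "('v::real_vector \<Rightarrow> real) \<Rightarrow> bool" where
  "sublinear p \<longleftrightarrow> (\<forall>x y. p (x + y) \<le> p x + p y) \<and> (\<forall>c x. 0 \<le> c \<longrightarrow> p (c *\<^sub>R x) \<le> c * p x)"

lemma sublinearI:
  assumes "\<And>x y. p (x + y) \<le> p x + p y" "\<And>c x. 0 \<le> c \<Longrightarrow> p (c *\<^sub>R x) \<le> c * p x"
  shows "sublinear p"
  using assms by (simp add: sublinear_def)

lemma sublinear_add: "sublinear p \<Longrightarrow> p (x + y) \<le> p x + p y"
  by (simp add: sublinear_def)

lemma sublinear_scale_le: "sublinear p \<Longrightarrow> 0 \<le> c \<Longrightarrow> p (c *\<^sub>R x) \<le> c * p x"
  by (simp add: sublinear_def)

lemma sublinear_zero: "sublinear p \<Longrightarrow> p 0 = 0"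
  using sublinear_scale_le[of p 0 0] sublinear_add[of p 0 0] by simp

lemma sublinear_scale:
  assumes "sublinear p" "0 \<le> c"
  shows "p (c *\<^sub>R x) = c * p x"
proof (cases "c = 0")
  case False
  have "p ((1 / c) *\<^sub>R (c *\<^sub>R x)) \<le> (1 / c) * p (c *\<^sub>R x)"
    using assms by (intro sublinear_scale_le) auto
  then have "c * p x \<le> p (c *\<^sub>R x)"
    using False assms by (simp add: field_simps)
  then show ?thesis
    using sublinear_scale_le[OF assms, of x] by simp
qed (simp add: sublinear_zero[OF assms(1)])

lemma sublinear_minus: "sublinear p \<Longrightarrow> - p (- x) \<le> p x"
  using sublinear_add[of p x "- x"] by (simp add: sublinear_zero)

text \<open>Under the hypotheses below, this is the largest sublinear \<open>q\<close> below
  \<open>p\<close> with \<open>q (- h) \<le> - a\<close> on \<open>H\<close>, so that every linear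
  functional under it is at least \<open>a\<close> on \<open>H\<close>.\<close>

definition tilt :: "('v::real_vector \<Rightarrow> real) \<Rightarrow> 'v set \<Rightarrow> real \<Rightarrow> 'v \<Rightarrow> real" where
  "tilt p H a x = (INF (t, h) \<in> {0..} \<times> H. p (x + t *\<^sub>R h) - t * a)"

text \<open>The bound \<open>a \<le> p h\<close> keeps the infimum above \<open>- p (- x)\<close>.
  Convexity of \<open>H\<close> gives subadditivity, because
  \<open>t *\<^sub>R h + t' *\<^sub>R h'\<close> is \<open>t + t'\<close> times a single element of
  \<open>H\<close>.\<close>

lemma
  assumes p: "sublinear p" and H: "convex H" "H \<noteq> {}" "\<And>h. h \<in> H \<Longrightarrow> a \<le> p h"
  shows sublinear_tilt: "sublinear (tilt p H a)"
    and tilt_le: "t \<ge> 0 \<Longrightarrow> h \<in> H \<Longrightarrow> tilt p H a x \<le> p (x + t *\<^sub>R h) - t * a"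
proof -
  have lower: "- p (- x) \<le> p (x + t *\<^sub>R h) - t * a" if "t \<ge> 0" "h \<in> H" for t h x
  proof -
    have "t * a \<le> t * p h"
      using H(3) that by (intro mult_left_mono) auto
    also have "t * p h = p ((x + t *\<^sub>R h) + (- x))"
      using sublinear_scale[OF p that(1)] by simp
    also have "\<dots> \<le> p (x + t *\<^sub>R h) + p (- x)"
      by (rule sublinear_add[OF p])
    finally show ?thesis by simp
  qed
  have bdd: "bdd_below ((\<lambda>(t, h). p (x + t *\<^sub>R h) - t * a) ` ({0..} \<times> H))" for x
    by (rule bdd_belowI[of _ "- p (- x)"]) (use lower in auto)
  have upper: "tilt p H a x \<le> p (x + t *\<^sub>R h) - t * a" if "t \<ge> 0" "h \<in> H" for t h x
  proof -
    have "tilt p H a x \<le> (case (t, h) of (t, h) \<Rightarrow> p (x + t *\<^sub>R h) - t * a)"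
      unfolding tilt_def by (rule cINF_lower[OF bdd]) (use that in auto)
    then show ?thesis by simp
  qed
  then show "t \<ge> 0 \<Longrightarrow> h \<in> H \<Longrightarrow> tilt p H a x \<le> p (x + t *\<^sub>R h) - t * a" .
  have greatest: "b \<le> tilt p H a x" if "\<And>t h. t \<ge> 0 \<Longrightarrow> h \<in> H \<Longrightarrow> b \<le> p (x + t *\<^sub>R h) - t * a" for b x
    unfolding tilt_def by (rule cINF_greatest) (use that H(2) in auto)
  show "sublinear (tilt p H a)"
  proof (rule sublinearI)
    fix x y
    have *: "tilt p H a (x + y) \<le> (p (x + t *\<^sub>R h) - t * a) + (p (y + t' *\<^sub>R h') - t' * a)"
      if th: "t \<ge> 0" "h \<in> H" "t' \<ge> 0" "h' \<in> H" for t h t' h'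
    proof (cases "t + t' = 0")
      case True
      then have "t = 0" "t' = 0" using th by auto
      then show ?thesis
        using upper[of 0 h "x + y"] th sublinear_add[OF p, of x y] by simp
    next
      case False
      define k where "k = (t / (t + t')) *\<^sub>R h + (t' / (t + t')) *\<^sub>R h'"
      have "k \<in> H"
        unfolding k_def using th False
        by (intro convexD[OF H(1)]) (auto simp: add_divide_distrib[symmetric])
      moreover have k: "(t + t') *\<^sub>R k = t *\<^sub>R h + t' *\<^sub>R h'"
        using False by (simp add: k_def scaleR_add_right)
      ultimately have "tilt p H a (x + y) \<le> p (x + y + (t + t') *\<^sub>R k) - (t + t') * a"
        using th by (intro upper) auto
      also have "x + y + (t + t') *\<^sub>R k = (x + t *\<^sub>R h) + (y + t' *\<^sub>R h')"
        by (simp add: k)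
      also have "p \<dots> \<le> p (x + t *\<^sub>R h) + p (y + t' *\<^sub>R h')"
        by (rule sublinear_add[OF p])
      finally show ?thesis by (simp add: algebra_simps)
    qed
    have "tilt p H a (x + y) - (p (x + t *\<^sub>R h) - t * a) \<le> tilt p H a y" if "t \<ge> 0" "h \<in> H" for t h
      by (rule greatest) (use *[OF that] in \<open>simp add: algebra_simps\<close>)
    then have "tilt p H a (x + y) - tilt p H a y \<le> tilt p H a x"
      by (intro greatest) (force simp: algebra_simps)
    then show "tilt p H a (x + y) \<le> tilt p H a x + tilt p H a y" by simp
  next
    fix c :: real and x assume c: "0 \<le> c"
    obtain h where h: "h \<in> H" using H(2) by auto
    show "tilt p H a (c *\<^sub>R x) \<le> c * tilt p H a x"
    proof (cases "c = 0")
      case True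
      then show ?thesis using upper[of 0 h 0] h sublinear_zero[OF p] by simp
    next
      case False
      then have c0: "c > 0" using c by simp
      have "tilt p H a (c *\<^sub>R x) / c \<le> tilt p H a x"
      proof (rule greatest)
        fix t k assume tk: "t \<ge> (0::real)" "k \<in> H"
        have "tilt p H a (c *\<^sub>R x) \<le> p (c *\<^sub>R x + (c * t) *\<^sub>R k) - c * t * a"
          using tk c by (intro upper) auto
        also have "c *\<^sub>R x + (c * t) *\<^sub>R k = c *\<^sub>R (x + t *\<^sub>R k)"
          by (simp add: scaleR_add_right)
        finally show "tilt p H a (c *\<^sub>R x) / c \<le> p (x + t *\<^sub>R k) - t * a"
          using c0 sublinear_scale[OF p c, of "x + t *\<^sub>R k"] by (simp add: field_simps)
      qed
      then show ?thesis using c0 by (simp add: field_simps)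
    qed
  qed
qed

text \<open>Tilting along the single vector \<open>y\<close> at level \<open>q y\<close> gives a
  sublinear functional below \<open>q\<close>, hence \<open>q\<close> itself by minimality. Taking
  \<open>t = 1\<close> in the tilt then yields superadditivity.\<close>

lemma linear_if_minimal_sublinear:
  assumes q: "sublinear q" and minimal: "\<And>q'. sublinear q' \<Longrightarrow> (\<And>x. q' x \<le> q x) \<Longrightarrow> q' = q"
  shows "linear q"
proof -
  have add: "q (x + y) = q x + q y" for x y
  proof -
    have s: "sublinear (tilt q {y} (q y))"
      by (rule sublinear_tilt[OF q]) auto
    have u: "tilt q {y} (q y) z \<le> q (z + t *\<^sub>R y) - t * q y" if "t \<ge> 0" for t z
      by (rule tilt_le[OF q]) (use that in auto)
    have "tilt q {y} (q y) = q"
      using u[of 0] by (intro minimal s) auto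
    then have "q x \<le> q (x + y) - q y"
      using u[of 1 x] by simp
    then show ?thesis using sublinear_add[OF q, of x y] by simp
  qed
  have neg: "q (- x) = - q x" for x
    using add[of x "- x"] sublinear_zero[OF q] by simp
  have "q (c *\<^sub>R x) = c * q x" for c x
    using sublinear_scale[OF q, of c x] sublinear_scale[OF q, of "- c" x] neg[of "c *\<^sub>R x"]
    by (cases "c \<ge> 0") auto
  then show ?thesis using add by (intro linearI) auto
qed

text \<open>Zorn's lemma is applied to sublinear functionals ordered downwards, not to partial
  linear functionals. Infima of chains are finite because every member is at least
  \<open>- p (- x)\<close> at \<open>x\<close>.\<close>

lemma Hahn_Banach_sublinear:
  fixes p :: "'v::real_vector \<Rightarrow> real"
  assumes p: "sublinear p"
  obtains L where "linear L" "\<And>x. L x \<le> p x"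
proof -
  define Q where "Q = {q. sublinear q \<and> (\<forall>x. q x \<le> p x)}"
  define P where "P = (\<lambda>q q' :: 'v \<Rightarrow> real. \<forall>x. q' x \<le> q x)"
  have "\<exists>m\<in>Q. \<forall>a\<in>Q. P m a \<longrightarrow> a = m"
  proof (rule predicate_Zorn)
    show "partial_order_on Q (relation_of P (Q :: ('v \<Rightarrow> real) set))"
      by (rule partial_order_on_relation_ofI) (auto simp: P_def fun_eq_iff intro: order.trans antisym)
    fix C assume C: "C \<in> Chains (relation_of P Q)"
    have CQ: "C \<subseteq> Q" and total: "\<And>q q'. q \<in> C \<Longrightarrow> q' \<in> C \<Longrightarrow> P q q' \<or> P q' q"
      using C by (auto simp: Chains_def relation_of_def)
    show "\<exists>u\<in>Q. \<forall>q\<in>C. P q u"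
    proof (cases "C = {}")
      case True
      then show ?thesis using p by (auto simp: Q_def)
    next
      case False
      define u where "u x = (INF q\<in>C. q x)" for x
      have sub: "sublinear q" "q x \<le> p x" if "q \<in> C" for q x
        using that CQ by (auto simp: Q_def)
      have bdd: "bdd_below ((\<lambda>q. q x) ` C)" for x
      proof (rule bdd_belowI[of _ "- p (- x)"])
        fix r assume "r \<in> (\<lambda>q. q x) ` C"
        then obtain q where q: "q \<in> C" "r = q x" by auto
        show "- p (- x) \<le> r"
          using sublinear_minus[OF sub(1)[OF q(1)], of x] sub(2)[OF q(1), of "- x"] q(2) by simp
      qed
      have lower: "u x \<le> q x" if "q \<in> C" for q x
        unfolding u_def by (rule cINF_lower[OF bdd that])
      have greatest: "b \<le> u x" if "\<And>q. q \<in> C \<Longrightarrow> b \<le> q x" for b x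
        unfolding u_def by (rule cINF_greatest[OF False]) (use that in auto)
      have "sublinear u"
      proof (rule sublinearI)
        fix x y
        have *: "u (x + y) \<le> q x + q' y" if q: "q \<in> C" "q' \<in> C" for q q'
        proof -
          have "u (x + y) \<le> q x + q y" "u (x + y) \<le> q' x + q' y"
            using lower[OF q(1), of "x + y"] lower[OF q(2), of "x + y"]
              sublinear_add[OF sub(1)[OF q(1)], of x y] sublinear_add[OF sub(1)[OF q(2)], of x y]
            by auto
          \<comment> \<open>Members of a chain are comparable, so the smaller one can serve both
            arguments.\<close>
          moreover have "q' x \<le> q x \<or> q y \<le> q' y"
            using total[OF q] by (auto simp: P_def)
          ultimately show ?thesis by auto
        qed
        have "u (x + y) - q x \<le> u y" if "q \<in> C" for q
          by (rule greatest) (use *[OF that] in \<open>simp add: algebra_simps\<close>)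
        then have "u (x + y) - u y \<le> u x"
          by (intro greatest) (force simp: algebra_simps)
        then show "u (x + y) \<le> u x + u y" by simp
      next
        fix c :: real and x assume c: "0 \<le> c"
        show "u (c *\<^sub>R x) \<le> c * u x"
        proof (cases "c = 0")
          case True
          obtain q where "q \<in> C" using False by auto
          then show ?thesis using True lower[of q 0] sublinear_zero[OF sub(1)[of q]] by auto
        next
          case False
          then have c0: "c > 0" using c by simp
          have "u (c *\<^sub>R x) / c \<le> u x"
          proof (rule greatest)
            fix q assume q: "q \<in> C"
            have "u (c *\<^sub>R x) \<le> c * q x"
              using lower[OF q, of "c *\<^sub>R x"] sublinear_scale[OF sub(1)[OF q] c, of x] by simp
            then show "u (c *\<^sub>R x) / c \<le> q x" using c0 by (simp add: field_simps)
          qed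
          then show ?thesis using c0 by (simp add: field_simps)
        qed
      qed
      moreover have "u x \<le> p x" for x
      proof -
        obtain q where "q \<in> C" using False by auto
        then show ?thesis using lower[of q x] sub(2)[of q x] by simp
      qed
      ultimately have "u \<in> Q" by (simp add: Q_def)
      then show ?thesis using lower by (auto simp: P_def)
    qed
  qed
  then obtain m where m: "sublinear m" "\<And>x. m x \<le> p x"
    and min: "\<And>q. q \<in> Q \<Longrightarrow> P m q \<Longrightarrow> q = m"
    by (auto simp: Q_def)
  have "linear m"
  proof (rule linear_if_minimal_sublinear[OF m(1)])
    fix q' assume "sublinear q'" "\<And>x. q' x \<le> m x"
    then show "q' = m" using m(2) by (intro min) (auto simp: Q_def P_def intro: order.trans)
  qed
  then show thesis using m(2) that by blast
qed

theorem Mazur_Orlicz: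
  assumes p: "sublinear p" and H: "convex H" "H \<noteq> {}" "\<And>h. h \<in> H \<Longrightarrow> a \<le> p h"
  obtains L where "linear L" "\<And>x. L x \<le> p x" "\<And>h. h \<in> H \<Longrightarrow> a \<le> L h"
proof -
  obtain L where L: "linear L" "\<And>x. L x \<le> tilt p H a x"
    using Hahn_Banach_sublinear[OF sublinear_tilt[OF p H]] by blast
  note upper = tilt_le[OF p H]
  obtain h0 where "h0 \<in> H" using H(2) by auto
  then have "L x \<le> p x" for x
    using upper[of 0 h0 x] L(2)[of x] by simp
  moreover have "a \<le> L h" if "h \<in> H" for h
    using upper[of 1 h "- h"] that L(2)[of "- h"] sublinear_zero[OF p] linear_neg[OF L(1), of h] by simp
  ultimately show thesis using that L(1) by blast
qed

section \<open>Riesz representation on a compact metric space\<close>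

context
  fixes dummy :: "'a::metric_space itself"
  assumes compact_UNIV: "compact (UNIV :: 'a set)"
begin

text \<open>The common core of the Dini-type arguments below: directedness absorbs the finitely many
  indices of a subcover into one.\<close>

lemma compact_directed_cover:
  assumes "\<Phi> \<noteq> {}" and op: "\<And>\<phi>. \<phi> \<in> \<Phi> \<Longrightarrow> open {x :: 'a. P \<phi> x}"
    and cover: "\<And>x. \<exists>\<phi>\<in>\<Phi>. P \<phi> x"
    and directed: "\<And>\<phi> \<psi>. \<phi> \<in> \<Phi> \<Longrightarrow> \<psi> \<in> \<Phi> \<Longrightarrow> \<exists>\<theta>\<in>\<Phi>. \<forall>x. P \<phi> x \<or> P \<psi> x \<longrightarrow> P \<theta> x"
  obtains \<phi> where "\<phi> \<in> \<Phi>" "\<And>x. P \<phi> x"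
proof -
  have sub: "UNIV \<subseteq> (\<Union>\<phi>\<in>\<Phi>. {x. P \<phi> x})"
  proof
    fix x
    obtain \<phi> where "\<phi> \<in> \<Phi>" "P \<phi> x" using cover[of x] by (elim bexE)
    then show "x \<in> (\<Union>\<phi>\<in>\<Phi>. {x. P \<phi> x})" by (intro UN_I CollectI)
  qed
  obtain D where D: "D \<subseteq> \<Phi>" "finite D" "UNIV \<subseteq> (\<Union>\<phi>\<in>D. {x. P \<phi> x})"
    by (rule compactE_image[OF compact_UNIV op sub])
  have "\<exists>\<theta>\<in>\<Phi>. \<forall>\<phi>\<in>D. \<forall>x. P \<phi> x \<longrightarrow> P \<theta> x"
    using D(2,1)
  proof induction
    case empty
    then show ?case using \<open>\<Phi> \<noteq> {}\<close> by auto
  next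
    case (insert \<psi> D)
    then obtain \<theta> where \<theta>: "\<theta> \<in> \<Phi>" "\<forall>\<phi>\<in>D. \<forall>x. P \<phi> x \<longrightarrow> P \<theta> x" by auto
    obtain \<theta>' where "\<theta>' \<in> \<Phi>" "\<forall>x. P \<theta> x \<or> P \<psi> x \<longrightarrow> P \<theta>' x"
      using directed[OF \<theta>(1), of \<psi>] insert.prems by auto
    then show ?case using \<theta> by (intro bexI[of _ \<theta>']) auto
  qed
  then obtain \<theta> where "\<theta> \<in> \<Phi>" "\<And>\<phi> x. \<phi> \<in> D \<Longrightarrow> P \<phi> x \<Longrightarrow> P \<theta> x" by auto
  moreover have "\<exists>\<phi>\<in>D. P \<phi> x" for x using D(3) by auto
  ultimately show thesis using that by blast
qed

lemma apply_Bcontfun: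
  fixes f :: "'a \<Rightarrow> real"
  assumes "continuous_on UNIV f"
  shows "apply_bcontfun (Bcontfun f) = f"
proof -
  have "bounded (range f)"
    using compact_continuous_image[OF assms compact_UNIV] by (rule compact_imp_bounded)
  then show ?thesis
    using assms by (intro Bcontfun_inverse) (simp add: bcontfun_def)
qed

end

lemma open_positivity_set:
  fixes U :: "'a::metric_space set"
  assumes "open U"
  obtains d :: "'a \<Rightarrow> real" where "continuous_on UNIV d" "\<And>x. 0 \<le> d x" "\<And>x. d x > 0 \<longleftrightarrow> x \<in> U"
proof (cases "U = UNIV")
  \<comment> \<open>\<open>infdist x {}\<close> is 0 by convention, so the distance to the
    complement fails exactly here.\<close>
  case True
  show thesis by (rule that[of "\<lambda>_. 1"]) (use True in auto)
next
  case False
  then have "x \<in> - U \<longleftrightarrow> infdist x (- U) = 0" for x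
    using assms by (intro in_closed_iff_infdist_zero) auto
  then have "0 < infdist x (- U) \<longleftrightarrow> x \<in> U" for x
    using infdist_nonneg[of x "- U"] by (metis ComplD ComplI less_le)
  then show thesis
    by (intro that[of "\<lambda>x. infdist x (- U)"]) (auto intro: continuous_intros infdist_nonneg)
qed

text \<open>The number \<open>y\<close> is cut into horizontal slices of height one. The companion
  count of integers below \<open>y\<close> overshoots by at most 1, an error that disappears when
  \<open>le_integral_unit\<close> rescales by \<open>n\<close>.\<close>

lemma sum_clamp: "0 \<le> y \<Longrightarrow> (\<Sum>k<n. max 0 (min 1 (y - real k))) = min y (real n)"
  by (induction n) auto

lemma sum_indicator_le: "0 \<le> y \<Longrightarrow> (\<Sum>k<n. of_bool (real k < y)) \<le> min (y + 1) (real n)"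
  by (induction n) auto

lemma integrable_bcontfun:
  fixes f :: "'a::metric_space \<Rightarrow>\<^sub>C real"
  assumes "finite_measure M" "sets M = sets borel"
  shows "integrable M f"
proof -
  interpret finite_measure M by fact
  have [measurable]: "apply_bcontfun f \<in> borel_measurable M"
    using borel_measurable_continuous_onI[of f] measurable_cong_sets[OF assms(2) refl, of borel] by auto
  show ?thesis
    by (rule integrable_const_bound[of _ "norm f"]) (use norm_bounded[of f] in auto)
qed

section \<open>The outer measure of a normalized positive linear functional\<close>

locale positive_functional =
  fixes L :: "('a::metric_space \<Rightarrow>\<^sub>C real) \<Rightarrow> real"
  assumes compact_space: "compact (UNIV :: 'a set)"
    and lin: "linear L"
    and nonneg: "\<And>f. (\<And>x. 0 \<le> apply_bcontfun f x) \<Longrightarrow> 0 \<le> L f"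
    and normalized: "L (const_bcontfun 1) = 1"
begin

lemma mono: "(\<And>x. apply_bcontfun f x \<le> apply_bcontfun g x) \<Longrightarrow> L f \<le> L g"
  using nonneg[of "g - f"] linear_diff[OF lin, of g f] by simp

lemma const: "L (const_bcontfun c) = c"
proof -
  have "const_bcontfun c = c *\<^sub>R (const_bcontfun 1 :: 'a \<Rightarrow>\<^sub>C real)"
    by (rule bcontfun_eqI) simp
  then show ?thesis using linear_scale[OF lin, of c] normalized by simp
qed

text \<open>Test functions lie below \<open>indicator U\<close>; their supports may leave
  \<open>U\<close>. The price is a slack \<open>e\<close> in the proofs below.\<close>

definition content :: "'a set \<Rightarrow> ennreal" where
  "content U = (SUP f\<in>{f :: 'a \<Rightarrow>\<^sub>C real. \<forall>x. 0 \<le> f x \<and> f x \<le> indicator U x}. ennreal (L f))"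

lemma content_upper: "(\<And>x. 0 \<le> apply_bcontfun f x) \<Longrightarrow> (\<And>x. f x \<le> indicator U x) \<Longrightarrow> ennreal (L f) \<le> content U"
  unfolding content_def by (intro SUP_upper) auto

lemma content_mono: "U \<subseteq> V \<Longrightarrow> content U \<le> content V"
  unfolding content_def
proof (rule SUP_subset_mono)
  assume "U \<subseteq> V"
  then have "indicator U x \<le> (indicator V x :: real)" for x
    by (simp add: indicator_def subset_iff)
  then show "{f :: 'a \<Rightarrow>\<^sub>C real. \<forall>x. 0 \<le> f x \<and> f x \<le> indicator U x}
      \<subseteq> {f :: 'a \<Rightarrow>\<^sub>C real. \<forall>x. 0 \<le> f x \<and> f x \<le> indicator V x}"
    using order.trans by blast
qed simp

lemma content_empty: "content {} = 0"
proof -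
  have "ennreal (L f) = 0" if "\<forall>x. 0 \<le> f x \<and> f x \<le> indicator {} x" for f :: "'a \<Rightarrow>\<^sub>C real"
  proof -
    have "f = 0" using that by (intro bcontfun_eqI) (auto intro: antisym)
    then show ?thesis using linear_0[OF lin] by simp
  qed
  then show ?thesis
    unfolding content_def by (intro antisym SUP_least) auto
qed

lemma content_UNIV: "content UNIV = 1"
proof (rule antisym)
  show "content UNIV \<le> 1"
    unfolding content_def
  proof (rule SUP_least)
    fix f :: "'a \<Rightarrow>\<^sub>C real" assume "f \<in> {f :: 'a \<Rightarrow>\<^sub>C real. \<forall>x. 0 \<le> f x \<and> f x \<le> indicator UNIV x}"
    then have "L f \<le> L (const_bcontfun 1)" by (intro mono) auto
    then show "ennreal (L f) \<le> 1" using normalized by (simp add: ennreal_le_1)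
  qed
  show "1 \<le> content UNIV"
    using content_upper[of "const_bcontfun 1" UNIV] normalized by simp
qed

text \<open>A test function \<open>f\<close> of the union is dominated, up to \<open>e\<close>, by
  finitely many truncations of \<open>f\<close> by multiples of \<open>d i\<close>, each of which is
  a test function of \<open>U i\<close>. Compactness provides one multiple for all points.\<close>

lemma content_countably_subadditive:
  assumes U: "\<And>n::nat. open (U n)"
  shows "content (\<Union>n. U n) \<le> (\<Sum>n. content (U n))"
  unfolding content_def[of "\<Union>n. U n"]
proof (rule SUP_least)
  fix f :: "'a \<Rightarrow>\<^sub>C real" assume "f \<in> {f :: 'a \<Rightarrow>\<^sub>C real. \<forall>x. 0 \<le> f x \<and> f x \<le> indicator (\<Union>n. U n) x}"
  then have f: "\<And>x. 0 \<le> f x" "\<And>x. f x \<le> indicator (\<Union>n. U n) x" by auto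
  have "\<forall>n. \<exists>d :: 'a \<Rightarrow> real. continuous_on UNIV d \<and> (\<forall>x. 0 \<le> d x) \<and> (\<forall>x. d x > 0 \<longleftrightarrow> x \<in> U n)"
    using open_positivity_set[OF U] by metis
  then obtain d :: "nat \<Rightarrow> 'a \<Rightarrow> real" where
    d: "\<And>n. continuous_on UNIV (d n)" "\<And>n x. 0 \<le> d n x" "\<And>n x. d n x > 0 \<longleftrightarrow> x \<in> U n"
    by metis
  show "ennreal (L f) \<le> (\<Sum>n. content (U n))"
  proof (rule ennreal_le_epsilon)
    fix e :: real assume e: "e > 0"
    \<comment> \<open>\<open>n\<close> is both the number of sets and the slope, so the family
      increases in one parameter. Where \<open>f\<close> vanishes, the slack \<open>e\<close> alone
      suffices.\<close>
    define P where "P n x \<longleftrightarrow> f x < e + (\<Sum>i<n. min (f x) (real n * d i x))" for n x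
    have P_mono: "P m x" if "P n x" "n \<le> m" for n m x
    proof -
      have "(\<Sum>i<n. min (f x) (real n * d i x)) \<le> (\<Sum>i<n. min (f x) (real m * d i x))"
        using that d(2) by (intro sum_mono min.mono mult_right_mono) auto
      also have "\<dots> \<le> (\<Sum>i<m. min (f x) (real m * d i x))"
        using that d(2) f(1) by (intro sum_mono2) auto
      finally show ?thesis using that unfolding P_def by simp
    qed
    obtain n where n: "\<And>x. P n x"
    proof (rule compact_directed_cover[OF compact_space, of UNIV P])
      show "open {x. P n x}" for n
        unfolding P_def by (intro open_Collect_less continuous_intros d(1)) auto
      show "\<exists>n\<in>UNIV. P n x" for x
      proof (cases "f x = 0")
        case True
        then show ?thesis using e by (intro bexI[of _ 0]) (auto simp: P_def)
      next
        case False
        then have "f x > 0" using f(1)[of x] by simp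
        then have "indicator (\<Union>n. U n) x > (0::real)" using f(2)[of x] by simp
        then obtain i where i: "d i x > 0" using d(3) by (auto simp: indicator_def split: if_splits)
        obtain n where n: "real n \<ge> f x / d i x" "n > i"
        proof -
          obtain m where "real m \<ge> f x / d i x" using real_arch_simple by blast
          then show ?thesis by (intro that[of "max m (Suc i)"]) auto
        qed
        have "f x = min (f x) (real n * d i x)"
          using n(1) i by (simp add: field_simps)
        also have "\<dots> \<le> (\<Sum>i<n. min (f x) (real n * d i x))"
          using n(2) f(1) d(2) by (intro member_le_sum) auto
        finally show ?thesis using e by (intro bexI[of _ n]) (auto simp: P_def)
      qed
      show "\<exists>\<theta>\<in>UNIV. \<forall>x. P n x \<or> P m x \<longrightarrow> P \<theta> x" for n m
        by (rule bexI[of _ "max n m"]) (auto intro: P_mono)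
    qed auto
    define g where "g i = Bcontfun (\<lambda>x. min (f x) (real n * d i x))" for i
    have g: "g i x = min (f x) (real n * d i x)" for i x
      unfolding g_def by (subst apply_Bcontfun[OF compact_space]) (intro continuous_intros d(1), auto)+
    have f1: "f x \<le> 1" for x
      using order.trans[OF f(2) indicator_le_1] .
    have g01: "0 \<le> g i x" "g i x \<le> indicator (U i) x" for i x
      using f(1)[of x] f1[of x] d(2)[of i x] d(3)[of i x]
      by (auto simp: g indicator_def min_le_iff_disj split: if_splits)
    have "L f \<le> L (const_bcontfun e + (\<Sum>i<n. g i))"
    proof (rule mono)
      fix x
      have "apply_bcontfun (\<Sum>i<n. g i) x = (\<Sum>i<n. g i x)"
        by (induction n) auto
      then show "f x \<le> (const_bcontfun e + (\<Sum>i<n. g i)) x"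
        using n[of x] by (simp add: P_def g)
    qed
    also have "\<dots> = e + (\<Sum>i<n. L (g i))"
      by (simp add: linear_add[OF lin] linear_sum[OF lin] const)
    finally have "ennreal (L f) \<le> ennreal e + (\<Sum>i<n. ennreal (L (g i)))"
      using e g01(1) nonneg by (simp add: sum_ennreal sum_nonneg flip: ennreal_plus)
    also have "(\<Sum>i<n. ennreal (L (g i))) \<le> (\<Sum>i<n. content (U i))"
      by (intro sum_mono content_upper g01)
    also have "\<dots> \<le> (\<Sum>i. content (U i))"
      by (rule sum_le_suminf) auto
    finally show "ennreal (L f) \<le> (\<Sum>i. content (U i)) + ennreal e"
      by (simp add: add.commute)
  qed
qed

definition outer :: "'a set \<Rightarrow> ennreal" where
  "outer A = (INF U\<in>{U. open U \<and> A \<subseteq> U}. content U)"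

lemma outer_le: "open U \<Longrightarrow> A \<subseteq> U \<Longrightarrow> outer A \<le> content U"
  unfolding outer_def by (rule INF_lower) auto

lemma outer_open: "open U \<Longrightarrow> outer U = content U"
  by (intro antisym outer_le) (auto simp: outer_def intro!: INF_greatest content_mono)

lemma outer_mono: "A \<subseteq> B \<Longrightarrow> outer A \<le> outer B"
  unfolding outer_def by (rule INF_superset_mono) auto

lemma outer_le_1: "outer A \<le> 1"
  using outer_le[of UNIV A] content_UNIV by simp

lemma outer_measure_space_outer: "outer_measure_space UNIV outer"
  unfolding outer_measure_space_def
proof (intro conjI)
  show "positive UNIV outer"
    by (simp add: positive_def outer_open content_empty)
  show "increasing UNIV outer"
    by (simp add: increasing_def outer_mono)
  show "countably_subadditive UNIV outer"
    unfolding countably_subadditive_def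
  proof (intro allI impI)
    fix A :: "nat \<Rightarrow> 'a set"
    show "outer (\<Union>i. A i) \<le> (\<Sum>i. outer (A i))"
    proof (rule ennreal_le_epsilon)
      fix e :: real assume e: "e > 0"
      have "\<exists>U. open U \<and> A n \<subseteq> U \<and> content U \<le> outer (A n) + ennreal (e * (1/2) ^ Suc n)" for n
      proof -
        have "outer (A n) < outer (A n) + ennreal (e * (1/2) ^ Suc n)"
        proof (cases "outer (A n)")
          case (real r)
          then show ?thesis using e by (simp add: ennreal_less_iff flip: ennreal_plus)
        next
          case top
          then show ?thesis using outer_le_1[of "A n"] by (simp add: top_unique)
        qed
        then show ?thesis
          unfolding outer_def[of "A n"] INF_less_iff by (auto simp: outer_def intro: less_imp_le)
      qed
      then obtain U where U: "\<And>n. open (U n)" "\<And>n. A n \<subseteq> U n"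
        "\<And>n. content (U n) \<le> outer (A n) + ennreal (e * (1/2) ^ Suc n)"
        by metis
      have "outer (\<Union>i. A i) \<le> content (\<Union>n. U n)"
        using U by (intro outer_le) auto
      also have "\<dots> \<le> (\<Sum>n. content (U n))"
        by (rule content_countably_subadditive[OF U(1)])
      also have "\<dots> \<le> (\<Sum>n. outer (A n) + ennreal (e * (1/2) ^ Suc n))"
        by (intro suminf_le U) auto
      also have "\<dots> = (\<Sum>n. outer (A n)) + (\<Sum>n. ennreal (e * (1/2) ^ Suc n))"
        by (rule suminf_add[symmetric]) auto
      also have "(\<Sum>n. ennreal (e * (1/2) ^ Suc n)) = ennreal e"
        using e sums_mult[OF power_half_series, of e] by (intro suminf_ennreal_eq) auto
      finally show "outer (\<Union>i. A i) \<le> (\<Sum>i. outer (A i)) + ennreal e" .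
    qed
  qed
qed

lemma open_in_lambda_system:
  assumes U: "open U"
  shows "U \<in> lambda_system UNIV UNIV outer"
proof -
  have "outer (U \<inter> Z) + outer (- U \<inter> Z) = outer Z" for Z
  proof (rule antisym)
    have "outer Z = outer ((U \<inter> Z) \<union> (- U \<inter> Z))"
      by (rule arg_cong[of _ _ outer]) auto
    also have "\<dots> \<le> outer (U \<inter> Z) + outer (- U \<inter> Z)"
    proof -
      interpret U: sigma_algebra UNIV "UNIV :: 'a set set"
        using sigma_algebra_Pow[of UNIV] by simp
      have "subadditive UNIV outer"
        using outer_measure_space_outer
        by (intro U.countably_subadditive_subadditive) (simp_all add: outer_measure_space_def)
      then show ?thesis unfolding subadditive_def by auto
    qed
    finally show "outer Z \<le> outer (U \<inter> Z) + outer (- U \<inter> Z)" .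
    show "outer (U \<inter> Z) + outer (- U \<inter> Z) \<le> outer Z"
      unfolding outer_def[of Z]
    proof (rule INF_greatest)
      fix V assume "V \<in> {V. open V \<and> Z \<subseteq> V}"
      then have V: "open V" "Z \<subseteq> V" by auto
      have main: "ennreal (L f) + outer (- U \<inter> Z) \<le> content V"
        if f: "\<And>x. 0 \<le> f x" "\<And>x. f x \<le> indicator (U \<inter> V) x" for f :: "'a \<Rightarrow>\<^sub>C real"
      proof (rule ennreal_le_epsilon)
        fix e :: real assume e: "e > 0"
        \<comment> \<open>For a test function \<open>g\<close> of \<open>W\<close>, the function
          \<open>max 0 (f - e) + g\<close> is a test function of \<open>V\<close>: on
          \<open>W\<close> the first summand vanishes, off \<open>W\<close> the second one
          does.\<close>
        define W where "W = V \<inter> {x. f x < e}"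
        have "open W"
          unfolding W_def using V by (intro open_Int open_Collect_less continuous_intros) auto
        moreover have "- U \<inter> Z \<subseteq> W"
        proof
          fix x assume x: "x \<in> - U \<inter> Z"
          then have "f x \<le> 0" using f(2)[of x] by (simp add: indicator_def)
          then show "x \<in> W" using x V(2) e by (auto simp: W_def)
        qed
        ultimately have "outer (- U \<inter> Z) \<le> content W"
          by (rule outer_le)
        then have "ennreal (L f) + outer (- U \<inter> Z) \<le> ennreal (L f) + content W"
          by (rule add_left_mono)
        also have "\<dots> = (SUP g\<in>{g :: 'a \<Rightarrow>\<^sub>C real. \<forall>x. 0 \<le> g x \<and> g x \<le> indicator W x}. ennreal (L f) + ennreal (L g))"
        proof -
          have "{g :: 'a \<Rightarrow>\<^sub>C real. \<forall>x. 0 \<le> g x \<and> g x \<le> indicator W x} \<noteq> {}"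
            by (auto intro!: exI[of _ 0])
          then show ?thesis
            unfolding content_def by (subst ennreal_SUP_add_right) auto
        qed
        also have "\<dots> \<le> content V + ennreal e"
        proof (rule SUP_least)
          fix g :: "'a \<Rightarrow>\<^sub>C real" assume "g \<in> {g :: 'a \<Rightarrow>\<^sub>C real. \<forall>x. 0 \<le> g x \<and> g x \<le> indicator W x}"
          then have g: "\<And>x. 0 \<le> g x" "\<And>x. g x \<le> indicator W x" by auto
          define k where "k = Bcontfun (\<lambda>x. max 0 (f x - e) + g x)"
          have k: "k x = max 0 (f x - e) + g x" for x
            unfolding k_def by (subst apply_Bcontfun[OF compact_space]) (intro continuous_intros, auto)+
          have "k x \<le> indicator V x" for x
          proof (cases "x \<in> W")
            case True
            then show ?thesis using g(2)[of x] by (auto simp: k W_def)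
          next
            case False
            then have "g x = 0" using g[of x] by simp
            moreover have "indicator (U \<inter> V) x \<le> (indicator V x :: real)"
              by (simp add: indicator_def)
            then have "f x \<le> indicator V x"
              using f(2)[of x] by linarith
            ultimately show ?thesis using f(1)[of x] e by (simp add: k)
          qed
          then have "ennreal (L k) \<le> content V"
            using g(1) by (intro content_upper) (auto simp: k)
          moreover have "L f + L g \<le> L k + e"
          proof -
            have "L (f + g) \<le> L (k + const_bcontfun e)"
              by (rule mono) (auto simp: k)
            then show ?thesis by (simp add: linear_add[OF lin] const)
          qed
          moreover have "0 \<le> L f" "0 \<le> L g" "0 \<le> L k"
            using f(1) g(1) by (auto intro!: nonneg simp: k)
          ultimately show "ennreal (L f) + ennreal (L g) \<le> content V + ennreal e"
            using e by (metis add_right_mono ennreal_leI ennreal_plus less_imp_le order.trans)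
        qed
        finally show "ennreal (L f) + outer (- U \<inter> Z) \<le> content V + ennreal e" .
      qed
      have "outer (U \<inter> Z) + outer (- U \<inter> Z) \<le> content (U \<inter> V) + outer (- U \<inter> Z)"
        using U V by (intro add_right_mono outer_le) auto
      also have "\<dots> = (SUP f\<in>{f :: 'a \<Rightarrow>\<^sub>C real. \<forall>x. 0 \<le> f x \<and> f x \<le> indicator (U \<inter> V) x}. ennreal (L f) + outer (- U \<inter> Z))"
      proof -
        have "{g :: 'a \<Rightarrow>\<^sub>C real. \<forall>x. 0 \<le> g x \<and> g x \<le> indicator (U \<inter> V) x} \<noteq> {}"
          by (auto intro!: exI[of _ 0])
        then show ?thesis
          unfolding content_def by (subst ennreal_SUP_add_left) auto
      qed
      also have "\<dots> \<le> content V"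
        using main by (intro SUP_least) auto
      finally show "outer (U \<inter> Z) + outer (- U \<inter> Z) \<le> content V" .
    qed
  qed
  then show ?thesis
    by (simp add: lambda_system_def Compl_eq_Diff_UNIV)
qed

definition riesz_measure :: "'a measure" where
  "riesz_measure = measure_of UNIV (sets borel) outer"

lemma sets_riesz_measure: "sets riesz_measure = sets borel"
  using sets.sigma_sets_eq[of "borel :: 'a measure"]
  by (simp add: riesz_measure_def)

lemma emeasure_riesz_measure:
  assumes "A \<in> sets borel"
  shows "emeasure riesz_measure A = outer A"
proof -
  interpret U: sigma_algebra UNIV "UNIV :: 'a set set"
    using sigma_algebra_Pow[of UNIV] by simp
  have ms: "measure_space UNIV (lambda_system UNIV UNIV outer) outer"
    by (rule U.caratheodory_lemma[OF outer_measure_space_outer])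
  then have sa: "sigma_algebra UNIV (lambda_system UNIV UNIV outer)"
    by (simp add: measure_space_def)
  have sub: "sets borel \<subseteq> lambda_system UNIV UNIV outer"
    using sigma_algebra.sigma_sets_subset[OF sa, of "{S. open S}"] open_in_lambda_system
    by (auto simp: borel_def)
  have "countably_additive (sets borel) outer"
    using ms sub unfolding measure_space_def countably_additive_def by blast
  moreover have "positive (sets borel) outer"
    using outer_measure_space_outer by (simp add: outer_measure_space_def positive_def)
  moreover have "sigma_algebra UNIV (sets (borel :: 'a measure))"
    using sets.sigma_algebra_axioms[of "borel :: 'a measure"] by simp
  ultimately show ?thesis
    unfolding riesz_measure_def using assms by (intro emeasure_measure_of_sigma)
qed

lemma riesz_measure_prob: "riesz_measure \<in> prob_measures"
proof -
  have "prob_space riesz_measure"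
    by (rule prob_spaceI)
      (simp add: sets_eq_imp_space_eq[OF sets_riesz_measure] emeasure_riesz_measure outer_open content_UNIV)
  then show ?thesis by (simp add: prob_measures_def sets_riesz_measure)
qed

text \<open>\<open>n * f\<close> is sliced at the integer levels. The \<open>L\<close>-value of a
  slice is at most the measure of the open set where the slice is positive, and these measures add
  up to at most \<open>n\<close> times the integral plus 1. Letting \<open>n\<close> grow gives the
  bound; \<open>eq_integral\<close> gets the reverse inequality from \<open>- f\<close>.\<close>

lemma le_integral_unit:
  fixes f :: "'a \<Rightarrow>\<^sub>C real"
  assumes f: "\<And>x. 0 \<le> f x" "\<And>x. f x \<le> 1"
  shows "L f \<le> (\<integral>x. f x \<partial>riesz_measure)"
proof -
  interpret prob_space riesz_measure
    using riesz_measure_prob by (simp add: prob_measures_def)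
  have [measurable]: "apply_bcontfun f \<in> borel_measurable riesz_measure"
    using integrable_bcontfun[of riesz_measure f] finite_measure_axioms sets_riesz_measure by auto
  have "real n * L f \<le> real n * (\<integral>x. f x \<partial>riesz_measure) + 1" for n
  proof -
    define g where "g k = Bcontfun (\<lambda>x. max 0 (min 1 (real n * f x - real k)))" for k
    have g: "g k x = max 0 (min 1 (real n * f x - real k))" for k x
      unfolding g_def by (subst apply_Bcontfun[OF compact_space]) (intro continuous_intros, auto)+
    define V where "V k = {x. real k < real n * f x}" for k
    have V: "open (V k)" for k
      unfolding V_def by (intro open_Collect_less continuous_intros) auto
    have "L (g k) \<le> measure riesz_measure (V k)" for k
    proof -
      have "ennreal (L (g k)) \<le> content (V k)"
        by (rule content_upper) (auto simp: g V_def indicator_def)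
      also have "\<dots> = emeasure riesz_measure (V k)"
        using V by (simp add: emeasure_riesz_measure outer_open)
      finally show ?thesis by (simp add: emeasure_eq_measure)
    qed
    then have "(\<Sum>k<n. L (g k)) \<le> (\<Sum>k<n. measure riesz_measure (V k))"
      by (rule sum_mono)
    also have "\<dots> = (\<integral>x. (\<Sum>k<n. indicator (V k) x) \<partial>riesz_measure)"
      using V by (subst Bochner_Integration.integral_sum)
        (auto simp: sets_riesz_measure integrable_indicator_iff less_top[symmetric] emeasure_eq_measure)
    also have "\<dots> \<le> (\<integral>x. real n * f x + 1 \<partial>riesz_measure)"
    proof (rule integral_mono)
      show "integrable riesz_measure (\<lambda>x. \<Sum>k<n. indicator (V k) x :: real)"
        using V by (intro Bochner_Integration.integrable_sum)
          (auto simp: sets_riesz_measure integrable_indicator_iff less_top[symmetric] emeasure_eq_measure)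
      show "integrable riesz_measure (\<lambda>x. real n * f x + 1)"
        using integrable_bcontfun[OF finite_measure_axioms sets_riesz_measure] by auto
      fix x
      have "(\<Sum>k<n. indicator (V k) x :: real) = (\<Sum>k<n. of_bool (real k < real n * f x))"
        by (intro sum.cong) (auto simp: V_def indicator_def)
      also have "\<dots> \<le> real n * f x + 1"
        using sum_indicator_le[of "real n * f x" n] f by simp
      finally show "(\<Sum>k<n. indicator (V k) x) \<le> real n * f x + 1" .
    qed
    also have "\<dots> = real n * (\<integral>x. f x \<partial>riesz_measure) + 1"
      using integrable_bcontfun[OF finite_measure_axioms sets_riesz_measure, of f] by (simp add: prob_space)
    also have "(\<Sum>k<n. L (g k)) = L (real n *\<^sub>R f)"
    proof -
      have "apply_bcontfun (\<Sum>k<m. g k) x = (\<Sum>k<m. g k x)" for m x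
        by (induction m) auto
      then have "(\<Sum>k<n. g k) = real n *\<^sub>R f"
        using f by (intro bcontfun_eqI) (simp add: g sum_clamp mult_left_le)
      then show ?thesis by (simp flip: linear_sum[OF lin])
    qed
    finally show ?thesis by (simp add: linear_scale[OF lin])
  qed
  then have *: "real n * (L f - (\<integral>x. f x \<partial>riesz_measure)) \<le> 1" for n
    by (simp add: algebra_simps)
  show ?thesis
  proof (rule ccontr)
    assume "\<not> ?thesis"
    then obtain n where "real n * (L f - (\<integral>x. f x \<partial>riesz_measure)) > 1"
      using ex_less_of_nat_mult[of "L f - (\<integral>x. f x \<partial>riesz_measure)" 1] by auto
    then show False using *[of n] by simp
  qed
qed

lemma le_integral: "L f \<le> (\<integral>x. f x \<partial>riesz_measure)"
proof -
  interpret prob_space riesz_measure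
    using riesz_measure_prob by (simp add: prob_measures_def)
  note int = integrable_bcontfun[OF finite_measure_axioms sets_riesz_measure]
  \<comment> \<open>Adding 1 keeps \<open>m\<close> positive for \<open>f = 0\<close>;
    \<open>g\<close> below is the affine image of \<open>f\<close> with values between 0 and
    1.\<close>
  define m where "m = norm f + 1"
  have m: "m > 0" using norm_ge_zero[of f] unfolding m_def by linarith
  define g where "g = (1 / (2 * m)) *\<^sub>R (f + const_bcontfun m)"
  have "\<bar>f x\<bar> \<le> m" for x
    using norm_bounded[of f x] by (simp add: m_def)
  then have "L g \<le> (\<integral>x. g x \<partial>riesz_measure)"
    using m by (intro le_integral_unit) (auto simp: g_def field_simps abs_le_iff, smt (verit))
  also have "\<dots> = (1 / (2 * m)) * ((\<integral>x. f x \<partial>riesz_measure) + m)"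
    using int[of f] by (simp add: g_def prob_space)
  also have "L g = (1 / (2 * m)) * (L f + m)"
    by (simp add: g_def linear_scale[OF lin] linear_add[OF lin] const)
  finally show ?thesis using m by (simp add: field_simps)
qed

theorem eq_integral: "L f = (\<integral>x. f x \<partial>riesz_measure)"
  using le_integral[of f] le_integral[of "- f"] by (simp add: linear_neg[OF lin])

end

section \<open>Upper semicontinuous functions and envelope operators\<close>

definition usc :: "('a::topological_space \<Rightarrow> real) \<Rightarrow> bool" where
  "usc f \<longleftrightarrow> (\<forall>c. open {x. f x < c})"

lemma usc_measurable: "usc f \<Longrightarrow> sets M = sets borel \<Longrightarrow> f \<in> borel_measurable M"
  by (subst measurable_cong_sets[OF _ refl, of M borel])
    (auto simp: usc_def intro!: borel_measurableI_less)

lemma prob_measuresD: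
  assumes "\<mu> \<in> prob_measures"
  shows "prob_space \<mu>" "finite_measure \<mu>" "sets \<mu> = sets borel" "space \<mu> = UNIV"
proof -
  show "prob_space \<mu>" and s: "sets \<mu> = sets borel"
    using assms by (auto simp: prob_measures_def)
  then show "finite_measure \<mu>" by (intro prob_space.finite_measure)
  show "space \<mu> = UNIV" using sets_eq_imp_space_eq[OF s] by simp
qed

lemma integrable_prob_bcontfun: "\<mu> \<in> prob_measures \<Longrightarrow> integrable \<mu> (apply_bcontfun f)"
  for f :: "'a::metric_space \<Rightarrow>\<^sub>C real"
  by (intro integrable_bcontfun prob_measuresD)

lemma integral_prob_const: "\<mu> \<in> prob_measures \<Longrightarrow> (\<integral>x. c \<partial>\<mu>) = (c :: real)"
  using prob_space.prob_space[of \<mu>] by (simp add: prob_measuresD)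

lemma integrable_usc:
  assumes "usc f" "\<And>x. \<bar>f x\<bar> \<le> B" "\<mu> \<in> prob_measures"
  shows "integrable \<mu> f"
proof -
  interpret prob_space \<mu> by (rule prob_measuresD[OF assms(3)])
  show ?thesis
    by (rule integrable_const_bound[of _ B])
      (use assms usc_measurable[OF assms(1) prob_measuresD(3)[OF assms(3)]] in auto)
qed

lemma integral_le_const:
  fixes f :: "'a::metric_space \<Rightarrow>\<^sub>C real"
  assumes "\<mu> \<in> prob_measures" "\<And>x. apply_bcontfun f x \<le> c"
  shows "(\<integral>x. f x \<partial>\<mu>) \<le> c"
proof -
  have "(\<integral>x. f x \<partial>\<mu>) \<le> (\<integral>x. c \<partial>\<mu>)"
    using assms by (intro integral_mono integrable_prob_bcontfun finite_measure.integrable_const prob_measuresD) auto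
  then show ?thesis by (simp only: integral_prob_const[OF assms(1)])
qed

context
  fixes dummy :: "'a::metric_space itself"
  assumes compact_UNIV: "compact (UNIV :: 'a set)"
begin

text \<open>\<open>h n\<close> is the sup-convolution of \<open>f\<close> with
  \<open>n * dist\<close>: Lipschitz, bounded by \<open>B\<close>, and convergent to
  \<open>f\<close> by semicontinuity, so that dominated convergence applies. Adding
  \<open>e / 2\<close> makes the majorant strict, as compactness arguments require.\<close>

lemma usc_integral_approx:
  fixes f :: "'a \<Rightarrow> real"
  assumes usc: "usc f" and B: "\<And>x. \<bar>f x\<bar> \<le> B" and \<mu>: "\<mu> \<in> prob_measures" and e: "e > 0"
  obtains h :: "'a \<Rightarrow>\<^sub>C real" where "\<And>x. f x < h x" "(\<integral>x. h x \<partial>\<mu>) < (\<integral>x. f x \<partial>\<mu>) + e"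
proof -
  interpret prob_space \<mu> by (rule prob_measuresD[OF \<mu>])
  define h where "h n x = (SUP y. f y - real n * dist x y)" for n x
  have upper: "f y - real n * dist x y \<le> B" for n x y
    using B[of y] by (smt (verit) mult_nonneg_nonneg of_nat_0_le_iff zero_le_dist)
  have bdd: "bdd_above (range (\<lambda>y. f y - real n * dist x y))" for n x
    by (rule bdd_aboveI[of _ B]) (use upper in auto)
  have h_ge: "f y - real n * dist x y \<le> h n x" for n x y
    unfolding h_def by (rule cSUP_upper[OF _ bdd]) simp
  have h_le: "h n x \<le> c" if "\<And>y. f y - real n * dist x y \<le> c" for n x c
    unfolding h_def by (rule cSUP_least) (use that in auto)
  have "f x \<le> h n x" for n x
    using h_ge[of x n x] by simp
  have h_bound: "\<bar>h n x\<bar> \<le> B" for n x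
    using h_le[of n x B] upper \<open>f x \<le> h n x\<close> B[of x] by fastforce
  have lip: "h n x \<le> h n x' + real n * dist x x'" for n x x'
  proof (rule h_le)
    fix y
    have "real n * dist x' y \<le> real n * (dist x x' + dist x y)"
      by (intro mult_left_mono) (auto intro: dist_triangle3)
    then show "f y - real n * dist x y \<le> h n x' + real n * dist x x'"
      using h_ge[of y n x'] by (simp add: algebra_simps)
  qed
  have "(real n)-lipschitz_on UNIV (h n)" for n
  proof (rule lipschitz_onI)
    show "dist (h n x) (h n y) \<le> real n * dist x y" for x y
      using lip[of n x y] lip[of n y x] by (simp add: dist_real_def abs_le_iff dist_commute)
  qed simp
  then have cont: "continuous_on UNIV (h n)" for n
    by (rule lipschitz_on_continuous_on)
  have lim: "(\<lambda>n. h n x) \<longlonglongrightarrow> f x" for x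
  proof (rule tendstoI)
    fix d :: real assume d: "d > 0"
    have "open {y. f y < f x + d / 2}" using usc by (simp add: usc_def)
    then obtain r where r: "r > 0" "\<And>y. dist x y < r \<Longrightarrow> f y < f x + d / 2"
      using d unfolding open_dist by (force simp: dist_commute)
    \<comment> \<open>Beyond distance \<open>r\<close> the penalty outweighs \<open>2 * B\<close>,
      the largest possible oscillation of \<open>f\<close>.\<close>
    obtain N where N: "2 * B \<le> real N * r"
      using r(1) by (metis ex_less_of_nat_mult less_imp_le)
    have "dist (h n x) (f x) < d" if "n \<ge> N" for n
    proof -
      have "h n x \<le> f x + d / 2"
      proof (rule h_le)
        fix y
        show "f y - real n * dist x y \<le> f x + d / 2"
        proof (cases "dist x y < r")
          case True
          then show ?thesis using r(2)[of y] by (smt (verit) mult_nonneg_nonneg of_nat_0_le_iff zero_le_dist)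
        next
          case False
          then have "real N * r \<le> real n * dist x y"
            using that r(1) by (intro mult_mono) auto
          then show ?thesis using N B[of x] B[of y] d by (simp add: abs_le_iff)
        qed
      qed
      then show ?thesis using \<open>f x \<le> h n x\<close> d by (simp add: dist_real_def)
    qed
    then show "\<forall>\<^sub>F n in sequentially. dist (h n x) (f x) < d"
      by (auto simp: eventually_sequentially)
  qed
  have meas: "f \<in> borel_measurable \<mu>"
    by (rule usc_measurable[OF usc prob_measuresD(3)[OF \<mu>]])
  have meas_h: "h n \<in> borel_measurable \<mu>" for n
    using borel_measurable_continuous_onI[OF cont] measurable_cong_sets[OF prob_measuresD(3)[OF \<mu>] refl, of borel]
    by auto
  have "(\<lambda>n. \<integral>x. h n x \<partial>\<mu>) \<longlonglongrightarrow> (\<integral>x. f x \<partial>\<mu>)"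
    by (rule integral_dominated_convergence[where w = "\<lambda>_. B"])
      (use meas meas_h lim h_bound in auto)
  then have "\<forall>\<^sub>F n in sequentially. (\<integral>x. h n x \<partial>\<mu>) < (\<integral>x. f x \<partial>\<mu>) + e / 2"
    using e by (intro order_tendstoD) auto
  then obtain n where n: "(\<integral>x. h n x \<partial>\<mu>) < (\<integral>x. f x \<partial>\<mu>) + e / 2"
    by (auto simp: eventually_sequentially)
  define k where "k = Bcontfun (h n) + const_bcontfun (e / 2)"
  have k: "k x = h n x + e / 2" for x
    by (simp add: k_def apply_Bcontfun[OF compact_UNIV cont])
  have "integrable \<mu> (h n)"
    using integrable_prob_bcontfun[OF \<mu>, of "Bcontfun (h n)"] by (simp add: apply_Bcontfun[OF compact_UNIV cont])
  then have "(\<integral>x. k x \<partial>\<mu>) = (\<integral>x. h n x \<partial>\<mu>) + e / 2"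
    by (simp add: k prob_space)
  moreover have "f x < k x" for x
    using \<open>f x \<le> h n x\<close> e by (simp add: k)
  ultimately show thesis using n by (intro that[of k]) auto
qed

text \<open>Dini's theorem for a directed family whose infimum is at most \<open>f\<close>: a
  continuous \<open>h\<close> slightly above \<open>f\<close> has nearly the same integral, and some
  member of the family lies below \<open>h\<close> everywhere.\<close>

lemma directed_integral_approx:
  fixes f :: "'a \<Rightarrow> real" and \<Phi> :: "('a \<Rightarrow>\<^sub>C real) set"
  assumes usc: "usc f" and B: "\<And>x. \<bar>f x\<bar> \<le> B" and \<mu>: "\<mu> \<in> prob_measures" and e: "e > 0"
    and inf: "\<And>x c. f x < c \<Longrightarrow> \<exists>\<phi>\<in>\<Phi>. \<phi> x < c"
    and directed: "\<And>\<phi> \<psi>. \<phi> \<in> \<Phi> \<Longrightarrow> \<psi> \<in> \<Phi> \<Longrightarrow> \<exists>\<theta>\<in>\<Phi>. \<forall>x. \<theta> x \<le> \<phi> x \<and> \<theta> x \<le> \<psi> x"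
  obtains \<phi> where "\<phi> \<in> \<Phi>" "(\<integral>x. \<phi> x \<partial>\<mu>) < (\<integral>x. f x \<partial>\<mu>) + e"
proof -
  obtain h :: "'a \<Rightarrow>\<^sub>C real" where h: "\<And>x. f x < h x" "(\<integral>x. h x \<partial>\<mu>) < (\<integral>x. f x \<partial>\<mu>) + e"
    using usc_integral_approx[OF usc B \<mu> e] by blast
  obtain \<phi> where \<phi>: "\<phi> \<in> \<Phi>" "\<And>x. \<phi> x < h x"
  proof (rule compact_directed_cover[OF compact_UNIV, of \<Phi> "\<lambda>\<phi> x. \<phi> x < h x"])
    show "\<Phi> \<noteq> {}" using inf[OF h(1)] by auto
    show "open {x. \<phi> x < h x}" for \<phi> :: "'a \<Rightarrow>\<^sub>C real"
      by (intro open_Collect_less) auto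
    show "\<exists>\<phi>\<in>\<Phi>. \<phi> x < h x" for x
      by (rule inf[OF h(1)])
    show "\<exists>\<theta>\<in>\<Phi>. \<forall>x. \<phi> x < h x \<or> \<psi> x < h x \<longrightarrow> \<theta> x < h x" if "\<phi> \<in> \<Phi>" "\<psi> \<in> \<Phi>" for \<phi> \<psi>
      using directed[OF that] by (meson le_less_trans)
  qed blast
  then have "(\<integral>x. \<phi> x \<partial>\<mu>) \<le> (\<integral>x. h x \<partial>\<mu>)"
    using \<mu> by (intro integral_mono integrable_prob_bcontfun) (auto intro: less_imp_le)
  then show thesis using that[OF \<phi>(1)] h(2) by linarith
qed

text \<open>The hypothesis \<open>le\<close> contains positivity (take \<open>- f\<close> and
  \<open>c = 0\<close>) as well as normalization (take the constants 1 and -1).\<close>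

lemma Riesz_prob_measure:
  fixes L :: "('a \<Rightarrow>\<^sub>C real) \<Rightarrow> real"
  assumes L: "linear L" and le: "\<And>(f :: 'a \<Rightarrow>\<^sub>C real) c. (\<And>x. apply_bcontfun f x \<le> c) \<Longrightarrow> L f \<le> c"
  obtains \<sigma> where "\<sigma> \<in> prob_measures" "\<And>f. L f = (\<integral>x. f x \<partial>\<sigma>)"
proof -
  interpret positive_functional L
  proof (rule positive_functional.intro)
    show "compact (UNIV :: 'a set)" by (rule compact_UNIV)
    show "linear L" by (rule L)
    show "0 \<le> L f" if "\<And>x. 0 \<le> f x" for f :: "'a \<Rightarrow>\<^sub>C real"
      using le[of "- f" 0] that linear_neg[OF L, of f] by simp
    have "L (const_bcontfun 1) \<le> 1" "L (- const_bcontfun 1) \<le> - 1"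
      by (rule le, simp)+
    then show "L (const_bcontfun 1) = 1"
      using linear_neg[OF L] by simp
  qed
  show thesis by (rule that[OF riesz_measure_prob eq_integral])
qed

text \<open>\<open>p\<close> bounds the measure from above and \<open>H\<close> from below. A
  singleton \<open>H\<close> serves for attainment and semicontinuity, the set of all continuous
  majorants of an envelope for idempotence.\<close>

lemma prob_measure_between:
  fixes p :: "('a \<Rightarrow>\<^sub>C real) \<Rightarrow> real"
  assumes p: "sublinear p" "\<And>(f :: 'a \<Rightarrow>\<^sub>C real) c. (\<And>x. apply_bcontfun f x \<le> c) \<Longrightarrow> p f \<le> c"
    and H: "convex H" "H \<noteq> {}" "\<And>h. h \<in> H \<Longrightarrow> a \<le> p h"
  obtains \<sigma> where "\<sigma> \<in> prob_measures" "\<And>f. (\<integral>x. apply_bcontfun f x \<partial>\<sigma>) \<le> p f" "\<And>h. h \<in> H \<Longrightarrow> a \<le> (\<integral>x. apply_bcontfun h x \<partial>\<sigma>)"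
proof -
  obtain L where L: "linear L" "\<And>f. L f \<le> p f" "\<And>h. h \<in> H \<Longrightarrow> a \<le> L h"
    using Mazur_Orlicz[OF p(1) H] by blast
  obtain \<sigma> where "\<sigma> \<in> prob_measures" "\<And>f. L f = (\<integral>x. f x \<partial>\<sigma>)"
    using Riesz_prob_measure[OF L(1)] p(2) L(2) by (metis order.trans)
  then show thesis using that L by metis
qed

end

section \<open>Sublinear upper semicontinuous operators above the identity\<close>

locale envelope_operator =
  fixes t :: "('a::metric_space \<Rightarrow>\<^sub>C real) \<Rightarrow> 'a \<Rightarrow> real"
  assumes compact_space: "compact (UNIV :: 'a set)"
    and add_le: "t (f + g) x \<le> t f x + t g x"
    and scale: "0 \<le> c \<Longrightarrow> t (c *\<^sub>R f) x = c * t f x"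
    and mono: "(\<And>x. apply_bcontfun f x \<le> apply_bcontfun g x) \<Longrightarrow> t f x \<le> t g x"
    and const: "t (const_bcontfun c) x = c"
    and extensive: "apply_bcontfun f x \<le> t f x"
    and usc: "usc (t f)"
begin

lemma le_const: "(\<And>x. apply_bcontfun f x \<le> c) \<Longrightarrow> t f x \<le> c"
  using mono[of f "const_bcontfun c" x] const by simp

lemma bound: "\<bar>t f x\<bar> \<le> norm f"
proof -
  have "\<bar>f x\<bar> \<le> norm f" for x using norm_bounded[of f x] by simp
  then show ?thesis using le_const[of f "norm f" x] extensive[of f x] by (smt (verit))
qed

lemma nonexpansive: "t f x \<le> t g x + norm (f - g)"
  using add_le[of g "f - g" x] bound[of "f - g" x] by simp

lemma add_const: "t (f + const_bcontfun c) x = t f x + c"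
proof -
  have eq: "f + const_bcontfun c + const_bcontfun (- c) = f"
    by (rule bcontfun_eqI) simp
  have "t f x \<le> t (f + const_bcontfun c) x + t (const_bcontfun (- c)) x"
    using add_le[of "f + const_bcontfun c" "const_bcontfun (- c)" x] by (simp only: eq)
  then show ?thesis
    using add_le[of f "const_bcontfun c" x] const by simp
qed

lemma sum_le: "t (\<Sum>i<n. f i) x \<le> (\<Sum>i<n. t (f i) x)" for f :: "nat \<Rightarrow> 'a \<Rightarrow>\<^sub>C real"
proof (induction n)
  case 0
  then show ?case using const[of 0 x] by simp
next
  case (Suc n)
  then show ?case using add_le[of "\<Sum>i<n. f i" "f n" x] by simp
qed

lemma integrable: "\<mu> \<in> prob_measures \<Longrightarrow> integrable \<mu> (t f)"
  by (rule integrable_usc[OF usc bound])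

lemma sublinear_integral:
  assumes "\<mu> \<in> prob_measures"
  shows "sublinear (\<lambda>f. \<integral>x. t f x \<partial>\<mu>)"
proof (rule sublinearI)
  show "(\<integral>x. t (f + g) x \<partial>\<mu>) \<le> (\<integral>x. t f x \<partial>\<mu>) + (\<integral>x. t g x \<partial>\<mu>)" for f g
    unfolding Bochner_Integration.integral_add[OF integrable[OF assms] integrable[OF assms], symmetric]
    using integrable[OF assms] add_le by (intro integral_mono) auto
qed (simp add: scale)

lemma integral_image_le_const:
  assumes "\<mu> \<in> prob_measures" "\<And>x. apply_bcontfun f x \<le> c"
  shows "(\<integral>x. t f x \<partial>\<mu>) \<le> c"
proof -
  have "(\<integral>x. t f x \<partial>\<mu>) \<le> (\<integral>x. c \<partial>\<mu>)"
    using assms by (intro integral_mono integrable le_const finite_measure.integrable_const prob_measuresD) auto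
  then show ?thesis by (simp only: integral_prob_const[OF assms(1)])
qed

text \<open>The singleton \<open>{g}\<close> forces equality at \<open>g\<close>, so that the dual
  formula for the integral of \<open>t g\<close> has a maximizer.\<close>

lemma attained:
  assumes \<mu>: "\<mu> \<in> prob_measures"
  obtains \<sigma> where "\<sigma> \<in> prob_measures" "\<And>f. (\<integral>x. apply_bcontfun f x \<partial>\<sigma>) \<le> (\<integral>x. t f x \<partial>\<mu>)"
    "(\<integral>x. t g x \<partial>\<mu>) \<le> (\<integral>x. apply_bcontfun g x \<partial>\<sigma>)"
  using prob_measure_between[OF compact_space sublinear_integral[OF \<mu>] integral_image_le_const[OF \<mu>],
      of "{g}" "\<integral>x. t g x \<partial>\<mu>"]
  by auto

end

section \<open>Idempotent envelope operators\<close>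

text \<open>Completeness is what makes the summable corrections in \<open>fixed_between\<close>
  converge.\<close>

instance bcontfun :: (metric_space, banach) banach ..

text \<open>\<open>idem\<close> says that the infimum defining the extension of \<open>t\<close> at
  the function \<open>t f\<close> is at most \<open>t f\<close>.\<close>

locale idempotent_envelope = envelope_operator t
  for t :: "('a::metric_space \<Rightarrow>\<^sub>C real) \<Rightarrow> 'a \<Rightarrow> real" +
  assumes idem: "0 < e \<Longrightarrow> \<exists>h. (\<forall>y. t f y \<le> apply_bcontfun h y) \<and> t h x < t f x + e"
begin

text \<open>At a single point \<open>idem\<close> supplies \<open>k\<close>; half of the gap between
  \<open>t g\<close> and \<open>h\<close> is spent on lifting \<open>k\<close> strictly above
  \<open>t g\<close>. Minima preserve both inequalities, so compactness yields one \<open>k\<close>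
  for all points.\<close>

lemma interpolate:
  assumes h: "\<And>x. t g x < apply_bcontfun h x"
  obtains k where "\<And>x. t g x < apply_bcontfun k x" "\<And>x. t k x < apply_bcontfun h x"
proof -
  have min: "Bcontfun (\<lambda>y. min (k y) (l y)) x = min (k x) (l x)" for k l :: "'a \<Rightarrow>\<^sub>C real" and x
    by (subst apply_Bcontfun[OF compact_space]) (auto intro!: continuous_intros)
  have ex: "\<exists>k\<in>{k. \<forall>x. t g x < apply_bcontfun k x}. t k x < h x" for x
  proof -
    define e where "e = (h x - t g x) / 2"
    have e: "e > 0" using h[of x] by (simp add: e_def)
    then obtain k where k: "\<And>y. t g y \<le> apply_bcontfun k y" "t k x < t g x + e"
      using idem by blast
    have "t (k + const_bcontfun e) x < h x"
      using k(2) by (simp add: add_const e_def field_simps)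
    moreover have "t g y < (k + const_bcontfun e) y" for y
      using k(1)[of y] e by simp
    ultimately show ?thesis by blast
  qed
  obtain k where "k \<in> {k. \<forall>x. t g x < apply_bcontfun k x}" "\<And>x. t k x < h x"
  proof (rule compact_directed_cover[OF compact_space, of "{k. \<forall>x. t g x < apply_bcontfun k x}"
        "\<lambda>k x. t k x < h x"])
    show "{k. \<forall>x. t g x < apply_bcontfun k x} \<noteq> {}" using ex by blast
    show "open {x. t k x < h x}" for k
    proof -
      \<comment> \<open>Semicontinuity speaks of constant levels only, so a constant is inserted
        between \<open>t k\<close> and \<open>h\<close>.\<close>
      have "{x. t k x < h x} = (\<Union>c. {x. t k x < c} \<inter> {x. c < h x})"
        using dense by (auto intro: order.strict_trans)
      moreover have "open {x. c < h x}" for c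
        by (intro open_Collect_less) auto
      ultimately show ?thesis
        using usc[of k] by (simp only:) (intro open_UN ballI open_Int, auto simp: usc_def)
    qed
    show "\<exists>k\<in>{k. \<forall>x. t g x < apply_bcontfun k x}. t k x < h x" for x
      by (rule ex)
    fix k l assume kl: "k \<in> {k. \<forall>x. t g x < apply_bcontfun k x}" "l \<in> {k. \<forall>x. t g x < apply_bcontfun k x}"
    define m where "m = Bcontfun (\<lambda>y. min (k y) (l y))"
    have "t m x \<le> t k x" "t m x \<le> t l x" for x
      by (auto intro!: mono simp: m_def min)
    then show "\<exists>m\<in>{k. \<forall>x. t g x < apply_bcontfun k x}. \<forall>x. t k x < h x \<or> t l x < h x \<longrightarrow> t m x < h x"
      using kl by (intro bexI[of _ m]) (auto simp: m_def min intro: le_less_trans)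
  qed blast
  then show thesis using that by blast
qed

text \<open>
  Averaging a chain \<open>h = k\<^sub>0 > t k\<^sub>1\<close>, \<open>k\<^sub>1 > t k\<^sub>2\<close>, and so on, above \<open>t g\<close> makes the defect \<open>t \<psi> - \<psi>\<close> telescope.
\<close>

lemma almost_fixed_between:
  assumes h: "\<And>x. t g x < apply_bcontfun h x" and \<delta>: "0 < \<delta>"
  obtains \<psi> where "\<And>x. apply_bcontfun g x \<le> apply_bcontfun \<psi> x" "\<And>x. apply_bcontfun \<psi> x \<le> apply_bcontfun h x"
    "\<And>x. t \<psi> x \<le> apply_bcontfun \<psi> x + \<delta>"
proof -
  have "\<exists>k. \<forall>n. ((\<forall>x. t g x < apply_bcontfun (k n) x) \<and> (n = 0 \<longrightarrow> k n = h)) \<and>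
      (\<forall>x. t (k (Suc n)) x < apply_bcontfun (k n) x)"
  proof (rule dependent_nat_choice)
    show "\<exists>k. (\<forall>x. t g x < apply_bcontfun k x) \<and> ((0::nat) = 0 \<longrightarrow> k = h)" using h by blast
    show "\<exists>l. ((\<forall>x. t g x < apply_bcontfun l x) \<and> (Suc n = 0 \<longrightarrow> l = h)) \<and> (\<forall>x. t l x < apply_bcontfun k x)"
      if "(\<forall>x. t g x < apply_bcontfun k x) \<and> (n = 0 \<longrightarrow> k = h)" for k n
      using interpolate[of g k] that by (metis nat.simps(3))
  qed
  then obtain k where k: "\<And>n x. t g x < apply_bcontfun (k n) x" "k 0 = h"
    "\<And>n x. t (k (Suc n)) x < apply_bcontfun (k n) x"
    by blast
  \<comment> \<open>The telescoped error is \<open>k 0 - k n\<close>, at most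
    \<open>norm (h - g)\<close>; divided by \<open>n\<close> it must not exceed
    \<open>\<delta>\<close>.\<close>
  obtain n where n: "norm (h - g) \<le> real n * \<delta>" "n > 0"
  proof -
    obtain m where "norm (h - g) < real m * \<delta>" using ex_less_of_nat_mult[OF \<delta>] by blast
    then have "norm (h - g) \<le> real (Suc m) * \<delta>" using \<delta> by (simp add: field_simps)
    then show ?thesis using that by blast
  qed
  have app: "apply_bcontfun (\<Sum>i<m. f i) x = (\<Sum>i<m. f i x)" for f :: "nat \<Rightarrow> 'a \<Rightarrow>\<^sub>C real" and m x
    by (induction m) auto
  define \<psi> where "\<psi> = (1 / real n) *\<^sub>R (\<Sum>i<n. k (Suc i))"
  have \<psi>: "\<psi> x = (1 / real n) * (\<Sum>i<n. k (Suc i) x)" for x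
    by (simp add: \<psi>_def app)
  have k_le: "k i x \<le> h x" for i x
  proof (induction i)
    case (Suc i)
    then show ?case using extensive[of "k (Suc i)" x] k(3)[of i x] by simp
  qed (simp add: k(2))
  have k_ge: "g x \<le> k i x" for i x
    using extensive[of g x] k(1)[of x i] by simp
  show thesis
  proof (rule that)
    fix x
    have "real n * g x \<le> (\<Sum>i<n. k (Suc i) x)"
      using sum_bounded_below[of "{..<n}" "g x" "\<lambda>i. k (Suc i) x"] k_ge by simp
    then show "g x \<le> \<psi> x" using n(2) by (simp add: \<psi> field_simps)
    have "(\<Sum>i<n. k (Suc i) x) \<le> real n * h x"
      using sum_bounded_above[of "{..<n}" "\<lambda>i. k (Suc i) x" "h x"] k_le by simp
    then show "\<psi> x \<le> h x" using n(2) by (simp add: \<psi> field_simps)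
    have "real n * t \<psi> x = t (\<Sum>i<n. k (Suc i)) x"
      using n(2) by (simp add: \<psi>_def scale)
    also have "\<dots> \<le> (\<Sum>i<n. t (k (Suc i)) x)" by (rule sum_le)
    also have "\<dots> \<le> (\<Sum>i<n. k i x)" by (intro sum_mono less_imp_le k(3))
    also have "\<dots> = (\<Sum>i<n. k (Suc i) x) + (k 0 x - k n x)"
      using sum_lessThan_telescope'[of "\<lambda>i. k i x" n] by (simp add: sum_subtractf)
    also have "(\<Sum>i<n. k (Suc i) x) = real n * \<psi> x" using n(2) by (simp add: \<psi>)
    also have "k 0 x - k n x \<le> norm (h - g)"
      using norm_bounded[of "h - g" x] k_ge[of x n] by (simp add: k(2))
    also have "\<dots> \<le> real n * \<delta>" by (rule n(1))
    finally have "real n * t \<psi> x \<le> real n * (\<psi> x + \<delta>)" by (simp add: algebra_simps)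
    then show "t \<psi> x \<le> \<psi> x + \<delta>" using n(2) by simp
  qed
qed

text \<open>A function with defect \<open>d n\<close> has its image strictly below
  \<open>\<psi> + 2 * d n\<close>. So the averaging lemma applies again, with \<open>\<psi>\<close>
  as lower bound and a halved defect. The functions increase by summable steps, and
  \<open>nonexpansive\<close> carries the inequality to the limit.\<close>

lemma fixed_between:
  assumes h: "\<And>x. t g x < apply_bcontfun h x" and e: "0 < e"
  obtains \<psi> where "\<And>x. apply_bcontfun g x \<le> apply_bcontfun \<psi> x" "\<And>x. apply_bcontfun \<psi> x \<le> apply_bcontfun h x + e"
    "\<And>x. t \<psi> x \<le> apply_bcontfun \<psi> x"
proof -
  \<comment> \<open>The steps \<open>2 * d n\<close> add up to exactly \<open>e\<close>; the factor
    2 gives the strict room above the defect. In \<open>I\<close>, the clause for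
    \<open>n = 0\<close> carries the initial bounds through the dependent choice.\<close>
  define d where "d n = e / 2 * (1 / 2) ^ Suc n" for n
  have d: "d n > 0" for n using e by (simp add: d_def)
  define I where "I n \<psi> \<longleftrightarrow> (\<forall>x. t \<psi> x \<le> apply_bcontfun \<psi> x + d n) \<and>
      (n = 0 \<longrightarrow> (\<forall>x. apply_bcontfun g x \<le> apply_bcontfun \<psi> x \<and> apply_bcontfun \<psi> x \<le> apply_bcontfun h x))" for n \<psi>
  have "\<exists>\<psi>. \<forall>n. I n (\<psi> n) \<and> (\<forall>x. apply_bcontfun (\<psi> n) x \<le> apply_bcontfun (\<psi> (Suc n)) x \<and>
      apply_bcontfun (\<psi> (Suc n)) x \<le> apply_bcontfun (\<psi> n) x + 2 * d n)"
  proof (rule dependent_nat_choice)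
    show "\<exists>\<psi>. I 0 \<psi>"
      using almost_fixed_between[OF h d[of 0]] unfolding I_def by metis
    fix \<psi> n assume "I n \<psi>"
    then have "t \<psi> x < apply_bcontfun (\<psi> + const_bcontfun (2 * d n)) x" for x
      using d[of n] unfolding I_def by (auto intro: le_less_trans)
    from almost_fixed_between[OF this d[of "Suc n"]]
    obtain \<theta> where "\<And>x. \<psi> x \<le> apply_bcontfun \<theta> x" "\<And>x. \<theta> x \<le> (\<psi> + const_bcontfun (2 * d n)) x"
      "\<And>x. t \<theta> x \<le> \<theta> x + d (Suc n)" by metis
    then show "\<exists>\<theta>. I (Suc n) \<theta> \<and> (\<forall>x. apply_bcontfun \<psi> x \<le> apply_bcontfun \<theta> x \<and>
        apply_bcontfun \<theta> x \<le> apply_bcontfun \<psi> x + 2 * d n)"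
      by (intro exI[of _ \<theta>]) (auto simp: I_def)
  qed
  then obtain \<psi> :: "nat \<Rightarrow> 'a \<Rightarrow>\<^sub>C real" where I: "\<And>n. I n (\<psi> n)"
    and step: "\<And>n x. \<psi> n x \<le> \<psi> (Suc n) x" "\<And>n x. \<psi> (Suc n) x \<le> \<psi> n x + 2 * d n"
    by blast
  have lower: "g x \<le> \<psi> n x" for n x
  proof (induction n)
    case 0
    then show ?case using I[of 0] by (simp add: I_def)
  next
    case (Suc n)
    then show ?case using step(1)[of n x] by simp
  qed
  have upper: "\<psi> n x \<le> h x + e * (1 - (1 / 2) ^ n)" for n x
  proof (induction n)
    case 0
    then show ?case using I[of 0] by (simp add: I_def)
  next
    case (Suc n)
    then show ?case using step(2)[of n x] by (simp add: d_def field_simps)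
  qed
  have "summable (\<lambda>n. \<psi> (Suc n) - \<psi> n)"
  proof (rule summable_comparison_test')
    show "summable (\<lambda>n. e / 2 * (1 / 2) ^ n)"
      by (intro summable_mult summable_geometric) simp
    show "norm (\<psi> (Suc n) - \<psi> n) \<le> e / 2 * (1 / 2) ^ n" for n
    proof (rule norm_bound)
      have "2 * d n = e / 2 * (1 / 2) ^ n" by (simp add: d_def)
      then show "norm ((\<psi> (Suc n) - \<psi> n) x) \<le> e / 2 * (1 / 2) ^ n" for x
        using step[where n = n and x = x] by (simp only: minus_bcontfun.rep_eq real_norm_def abs_le_iff) linarith
    qed
  qed
  then obtain s where "(\<lambda>n. \<Sum>i<n. \<psi> (Suc i) - \<psi> i) \<longlonglongrightarrow> s"
    by (auto simp: summable_def sums_def)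
  then have "(\<lambda>n. \<psi> 0 + (\<psi> n - \<psi> 0)) \<longlonglongrightarrow> \<psi> 0 + s"
    by (intro tendsto_add) (auto simp: sum_lessThan_telescope)
  then have lim: "\<psi> \<longlonglongrightarrow> \<psi> 0 + s" by simp
  define \<theta> where "\<theta> = \<psi> 0 + s"
  have lim_x: "(\<lambda>n. \<psi> n x) \<longlonglongrightarrow> \<theta> x" for x
    using tendsto_uniform_limitI[OF tendsto_bcontfun_uniform_limit[OF lim]] by (simp add: \<theta>_def)
  show thesis
  proof (rule that)
    fix x
    show "g x \<le> \<theta> x"
      by (rule LIMSEQ_le_const[OF lim_x]) (use lower in auto)
    have "h x + e * (1 - (1 / 2) ^ n) \<le> h x + e" for n
      using e by (simp add: field_simps)
    then show "\<theta> x \<le> h x + e"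
      using upper by (intro LIMSEQ_le_const2[OF lim_x]) (meson order.trans)
    have "(\<lambda>n. norm (\<theta> - \<psi> n)) \<longlonglongrightarrow> 0"
      using tendsto_diff[OF tendsto_const lim, of \<theta>] by (intro tendsto_norm_zero) (simp add: \<theta>_def)
    moreover have "d \<longlonglongrightarrow> 0"
      unfolding d_def by (intro tendsto_mult_right_zero LIMSEQ_Suc LIMSEQ_power_zero) simp
    ultimately have "(\<lambda>n. \<psi> n x + d n + norm (\<theta> - \<psi> n)) \<longlonglongrightarrow> \<theta> x + 0 + 0"
      by (intro tendsto_add lim_x)
    moreover have "t \<theta> x \<le> \<psi> n x + d n + norm (\<theta> - \<psi> n)" for n
      using nonexpansive[of \<theta> x "\<psi> n"] I[of n] unfolding I_def by (smt (verit))
    ultimately show "t \<theta> x \<le> \<theta> x"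
      by (auto intro: LIMSEQ_le_const)
  qed
qed

text \<open>By \<open>extensive\<close>, these are the negatives of the continuous fixed points of
  \<open>t\<close>. Fixed points are stable under minima, by monotonicity, whereas a balayage cone
  is stable under maxima; hence the sign.\<close>

definition invariant_cone :: "('a \<Rightarrow>\<^sub>C real) set" where
  "invariant_cone = {\<phi>. \<forall>x. t (- \<phi>) x \<le> - \<phi> x}"

lemma balayage_cone_invariant_cone: "balayage_cone invariant_cone"
  unfolding balayage_cone_def
proof (intro conjI)
  show "closed invariant_cone"
    unfolding closed_sequential_limits
  proof (intro allI impI)
    fix \<phi> l assume *: "(\<forall>n. \<phi> n \<in> invariant_cone) \<and> \<phi> \<longlonglongrightarrow> l"
    show "l \<in> invariant_cone"
      unfolding invariant_cone_def
    proof safe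
      fix x
      have "(\<lambda>n. norm (\<phi> n - l)) \<longlonglongrightarrow> 0"
        using * by (intro tendsto_norm_zero) (simp add: LIM_zero)
      moreover have "(\<lambda>n. \<phi> n x) \<longlonglongrightarrow> l x"
        using tendsto_uniform_limitI[OF tendsto_bcontfun_uniform_limit] * by blast
      ultimately have "(\<lambda>n. - \<phi> n x + norm (\<phi> n - l)) \<longlonglongrightarrow> - l x + 0"
        by (intro tendsto_intros)
      moreover have "t (- l) x \<le> - \<phi> n x + norm (\<phi> n - l)" for n
        using nonexpansive[of "- l" x "- \<phi> n"] * by (simp add: invariant_cone_def) (smt (verit))
      ultimately show "t (- l) x \<le> - l x"
        by (auto intro: LIMSEQ_le_const)
    qed
  qed
  show "convex_cone invariant_cone"
    unfolding convex_cone_iff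
  proof (intro conjI ballI allI impI)
    show "0 \<in> invariant_cone" using const[of 0] by (simp add: invariant_cone_def)
    fix \<phi> \<psi> assume "\<phi> \<in> invariant_cone" "\<psi> \<in> invariant_cone"
    then have "t (- \<phi> + - \<psi>) x \<le> - \<phi> x + - \<psi> x" for x
      using add_le[of "- \<phi>" "- \<psi>" x] by (simp add: invariant_cone_def) (smt (verit))
    then show "\<phi> + \<psi> \<in> invariant_cone" by (simp add: invariant_cone_def)
  next
    fix \<phi> and c :: real assume "\<phi> \<in> invariant_cone" "0 \<le> c"
    then have "t (c *\<^sub>R - \<phi>) x \<le> c * (- \<phi> x)" for x
      unfolding scale[OF \<open>0 \<le> c\<close>] by (intro mult_left_mono) (simp_all add: invariant_cone_def)
    then show "c *\<^sub>R \<phi> \<in> invariant_cone" by (simp add: invariant_cone_def)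
  qed
  show "\<forall>f\<in>invariant_cone. \<forall>g\<in>invariant_cone. \<exists>h\<in>invariant_cone. \<forall>x. h x = max (f x) (g x)"
  proof (intro ballI)
    fix f g assume fg: "f \<in> invariant_cone" "g \<in> invariant_cone"
    define h where "h = Bcontfun (\<lambda>x. max (f x) (g x))"
    have h: "h x = max (f x) (g x)" for x
      unfolding h_def by (subst apply_Bcontfun[OF compact_space]) (auto intro!: continuous_intros)
    have "t (- h) x \<le> t (- f) x" "t (- h) x \<le> t (- g) x" for x
      by (auto intro!: mono simp: h)
    then have "t (- h) x \<le> - h x" for x
      using fg by (simp add: invariant_cone_def h) (smt (verit))
    then show "\<exists>h\<in>invariant_cone. \<forall>x. h x = max (f x) (g x)"
      using h by (intro bexI[of _ h]) (auto simp: invariant_cone_def)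
  qed
  show "\<forall>c\<ge>0. const_bcontfun c \<in> invariant_cone"
  proof (intro allI impI)
    fix c :: real
    have "- const_bcontfun c = (const_bcontfun (- c) :: 'a \<Rightarrow>\<^sub>C real)" by (rule bcontfun_eqI) simp
    then show "const_bcontfun c \<in> invariant_cone" by (simp add: invariant_cone_def const)
  qed
qed

text \<open>For the direction from the cone, a fixed \<open>\<psi>\<close> is placed between
  \<open>g\<close> and a continuous \<open>h\<close> whose integral is close to that of
  \<open>t g\<close>. The order gives \<open>\<integral>g d\<nu> \<le> \<integral>\<psi> d\<nu>
  \<le> \<integral>\<psi> d\<mu>\<close>; half of \<open>e\<close> pays for \<open>h\<close>, half
  for \<open>\<psi>\<close>.\<close>

lemma balayage_le_invariant_cone:
  assumes P: "\<mu> \<in> prob_measures" "\<nu> \<in> prob_measures"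
  shows "balayage_le invariant_cone \<mu> \<nu> \<longleftrightarrow> (\<forall>g. (\<integral>x. apply_bcontfun g x \<partial>\<nu>) \<le> (\<integral>x. t g x \<partial>\<mu>))"
proof
  assume le: "\<forall>g. (\<integral>x. apply_bcontfun g x \<partial>\<nu>) \<le> (\<integral>x. t g x \<partial>\<mu>)"
  show "balayage_le invariant_cone \<mu> \<nu>"
    unfolding balayage_le_def
  proof
    fix \<phi> assume \<phi>: "\<phi> \<in> invariant_cone"
    have "(\<integral>x. (- \<phi>) x \<partial>\<nu>) \<le> (\<integral>x. t (- \<phi>) x \<partial>\<mu>)" using le by blast
    also have "\<dots> \<le> (\<integral>x. (- \<phi>) x \<partial>\<mu>)"
      using \<phi> P by (intro integral_mono integrable integrable_prob_bcontfun) (auto simp: invariant_cone_def)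
    finally show "(\<integral>x. \<phi> x \<partial>\<mu>) \<le> (\<integral>x. \<phi> x \<partial>\<nu>)" by simp
  qed
next
  assume le: "balayage_le invariant_cone \<mu> \<nu>"
  show "\<forall>g. (\<integral>x. apply_bcontfun g x \<partial>\<nu>) \<le> (\<integral>x. t g x \<partial>\<mu>)"
  proof
    fix g
    show "(\<integral>x. apply_bcontfun g x \<partial>\<nu>) \<le> (\<integral>x. t g x \<partial>\<mu>)"
    proof (rule field_le_epsilon)
      fix e :: real assume e: "0 < e"
      then have e2: "0 < e / 2" by simp
      obtain h :: "'a \<Rightarrow>\<^sub>C real" where h: "\<And>x. t g x < h x" "(\<integral>x. h x \<partial>\<mu>) < (\<integral>x. t g x \<partial>\<mu>) + e / 2"
        using usc_integral_approx[OF compact_space usc bound P(1) e2] by blast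
      obtain \<psi> where \<psi>: "\<And>x. apply_bcontfun g x \<le> apply_bcontfun \<psi> x"
        "\<And>x. apply_bcontfun \<psi> x \<le> apply_bcontfun h x + e / 2" "\<And>x. t \<psi> x \<le> apply_bcontfun \<psi> x"
        using fixed_between[OF h(1) e2] by blast
      have "- \<psi> \<in> invariant_cone" using \<psi>(3) by (simp add: invariant_cone_def)
      then have "(\<integral>x. (- \<psi>) x \<partial>\<mu>) \<le> (\<integral>x. (- \<psi>) x \<partial>\<nu>)"
        using le unfolding balayage_le_def by blast
      then have "(\<integral>x. \<psi> x \<partial>\<nu>) \<le> (\<integral>x. \<psi> x \<partial>\<mu>)" by simp
      moreover have "(\<integral>x. g x \<partial>\<nu>) \<le> (\<integral>x. \<psi> x \<partial>\<nu>)"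
        using \<psi>(1) P by (intro integral_mono integrable_prob_bcontfun)
      moreover have "(\<integral>x. \<psi> x \<partial>\<mu>) \<le> (\<integral>x. (h + const_bcontfun (e / 2)) x \<partial>\<mu>)"
        using \<psi>(2) P by (intro integral_mono integrable_prob_bcontfun) auto
      moreover have "(\<integral>x. (h + const_bcontfun (e / 2)) x \<partial>\<mu>) = (\<integral>x. h x \<partial>\<mu>) + e / 2"
        using integrable_prob_bcontfun[OF P(1), of h] integral_prob_const[OF P(1)]
          finite_measure.integrable_const[OF prob_measuresD(2)[OF P(1)], of "e / 2"]
        by (simp del: integral_const)
      ultimately show "(\<integral>x. apply_bcontfun g x \<partial>\<nu>) \<le> (\<integral>x. t g x \<partial>\<mu>) + e"
        using h(2) by linarith
    qed
  qed
qed

end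

section \<open>Kantorovich operators and balayage cones\<close>

lemma ext_integral_ereal:
  assumes "integrable \<mu> f"
  shows "ext_integral \<mu> (\<lambda>x. ereal (f x)) = ereal (\<integral>x. f x \<partial>\<mu>)"
proof -
  have "(\<integral>\<^sup>+x. ennreal (f x) \<partial>\<mu>) < \<infinity>" "(\<integral>\<^sup>+x. ennreal (- f x) \<partial>\<mu>) < \<infinity>"
    using assms real_integrable_def[of \<mu> f] by (auto simp: less_top)
  then obtain r s where rs: "0 \<le> r" "0 \<le> s" "(\<integral>\<^sup>+x. ennreal (f x) \<partial>\<mu>) = ennreal r"
    "(\<integral>\<^sup>+x. ennreal (- f x) \<partial>\<mu>) = ennreal s"
    by (metis ennreal_cases infinity_ennreal_def less_irrefl)
  then have "(\<integral>x. f x \<partial>\<mu>) = r - s"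
    using real_lebesgue_integral_def[OF assms] by simp
  then show ?thesis
    using rs by (simp add: ext_integral_def e2ennreal_ereal)
qed

lemma (in envelope_operator) pushforward_le_iff:
  assumes "\<mu> \<in> prob_measures"
  shows "pushforward_le (\<lambda>f x. ereal (t f x)) \<mu> \<nu> \<longleftrightarrow>
    (\<forall>g. (\<integral>x. apply_bcontfun g x \<partial>\<nu>) \<le> (\<integral>x. t g x \<partial>\<mu>))"
  by (simp add: pushforward_le_def ext_integral_ereal[OF integrable[OF assms]])

lemma (in envelope_operator) backward_Kantorovich: "backward_Kantorovich (\<lambda>f x. ereal (t f x))"
  unfolding backward_Kantorovich_def
proof (intro conjI allI impI ballI)
  fix g
  show "(\<lambda>x. ereal (t g x)) \<in> USC"
    using bound[of g] usc[of g]
    by (auto simp: USC_def usc_def bounded_above_def abs_le_iff)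
next
  fix g h x and l :: real assume l: "l \<in> {0..1}"
  have "t (l *\<^sub>R g + (1 - l) *\<^sub>R h) x \<le> l * t g x + (1 - l) * t h x"
    using add_le[of "l *\<^sub>R g" "(1 - l) *\<^sub>R h" x] l by (simp add: scale)
  then show "ereal (t (l *\<^sub>R g + (1 - l) *\<^sub>R h) x) \<le> ereal l * ereal (t g x) + ereal (1 - l) * ereal (t h x)"
    by simp
next
  fix gs :: "nat \<Rightarrow> 'a \<Rightarrow>\<^sub>C real" and g x assume gs: "gs \<longlonglongrightarrow> g"
  have "(\<lambda>n. norm (gs n - g)) \<longlonglongrightarrow> 0"
    using gs by (intro tendsto_norm_zero) (simp add: LIM_zero)
  moreover have "\<bar>t (gs n) x - t g x\<bar> \<le> norm (gs n - g)" for n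
    using nonexpansive[of "gs n" x g] nonexpansive[of g x "gs n"] by (simp add: abs_le_iff norm_minus_commute)
  ultimately have "(\<lambda>n. t (gs n) x - t g x) \<longlonglongrightarrow> 0"
    using Lim_null_comparison[of "\<lambda>n. t (gs n) x - t g x" "\<lambda>n. norm (gs n - g)" sequentially] by simp
  then have "(\<lambda>n. t (gs n) x) \<longlonglongrightarrow> t g x"
    by (rule LIM_zero_cancel)
  then have "(\<lambda>n. ereal (t (gs n) x)) \<longlonglongrightarrow> ereal (t g x)"
    by simp
  then show "ereal (t g x) \<le> liminf (\<lambda>n. ereal (t (gs n) x))"
    using lim_imp_Liminf[OF trivial_limit_sequentially] by (metis order.refl)
qed (auto intro: mono simp: add_const)

text \<open>The values are finite because \<open>USC\<close> bounds \<open>T f\<close> above and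
  \<open>ext\<close> bounds it below. Subadditivity is convexity at the midpoint combined with
  homogeneity, which also yields \<open>T 0 = 0\<close>.\<close>

lemma Kantorovich_envelope:
  fixes T :: "('a::metric_space \<Rightarrow>\<^sub>C real) \<Rightarrow> 'a \<Rightarrow> ereal"
  assumes compact: "compact (UNIV :: 'a set)"
    and K: "backward_Kantorovich T" and hom: "positively_homogeneous T"
    and ext: "\<And>f x. ereal (apply_bcontfun f x) \<le> T f x"
  obtains t where "envelope_operator t" "T = (\<lambda>f x. ereal (t f x))"
proof -
  have "\<bar>T f x\<bar> \<noteq> \<infinity>" for f x
  proof -
    have "bounded_above (T f)"
      using K unfolding backward_Kantorovich_def USC_def by blast
    then obtain b :: real where "T f x \<le> ereal b"
      unfolding bounded_above_def by blast
    then show ?thesis using ext[of f x] by (cases "T f x") auto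
  qed
  define t where "t f x = real_of_ereal (T f x)" for f x
  have T: "T f x = ereal (t f x)" for f x
    using \<open>\<bar>T f x\<bar> \<noteq> \<infinity>\<close> by (simp add: t_def ereal_real)
  have scale: "t (c *\<^sub>R f) x = c * t f x" if "0 \<le> c" for c f x
    using hom that by (auto simp: positively_homogeneous_def T)
  have convex: "t (l *\<^sub>R g + (1 - l) *\<^sub>R h) x \<le> l * t g x + (1 - l) * t h x" if "l \<in> {0..1}" for l g h x
    using K that by (auto simp: backward_Kantorovich_def T)
  have "envelope_operator t"
  proof (rule envelope_operator.intro[OF compact])
    show "t (f + g) x \<le> t f x + t g x" for f g x
    proof -
      have "t (f + g) x = 2 * t ((1 / 2) *\<^sub>R f + (1 - 1 / 2) *\<^sub>R g) x"
        by (subst scale[symmetric]) (simp_all add: scaleR_add_right)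
      then show ?thesis using convex[of "1 / 2" f g x] by simp
    qed
    show "t (c *\<^sub>R f) x = c * t f x" if "0 \<le> c" for c f x
      by (rule scale[OF that])
    show "t f x \<le> t g x" if "\<And>x. apply_bcontfun f x \<le> apply_bcontfun g x" for f g x
      using K that by (auto simp: backward_Kantorovich_def T)
    show "t (const_bcontfun c) x = c" for c x
    proof -
      have "T (0 + const_bcontfun c) x = T 0 x + ereal c"
        using K unfolding backward_Kantorovich_def by blast
      then show ?thesis using scale[of 0 0 x] by (simp add: T)
    qed
    show "apply_bcontfun f x \<le> t f x" for f x
      using ext[of f x] by (simp add: T)
    show "usc (t f)" for f
      using K by (auto simp: backward_Kantorovich_def USC_def T usc_def)
  qed
  then show thesis using T by (intro that) auto
qed

text \<open>One half of idempotence is automatic: a continuous majorant of \<open>t f\<close> also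
  majorizes \<open>f\<close>, so its image is at least \<open>t f\<close>. The other half is
  \<open>idem\<close>.\<close>

lemma (in envelope_operator) idempotent_iff:
  "idempotent_operator (\<lambda>f x. ereal (t f x)) \<longleftrightarrow> idempotent_envelope t"
proof
  assume idem: "idempotent_operator (\<lambda>f x. ereal (t f x))"
  show "idempotent_envelope t"
  proof
    fix e :: real and f x assume "0 < e"
    have "usc_extension (\<lambda>f x. ereal (t f x)) (\<lambda>x. ereal (t f x)) = (\<lambda>x. ereal (t f x))"
      using idem by (simp add: idempotent_operator_def)
    then have "usc_extension (\<lambda>f x. ereal (t f x)) (\<lambda>x. ereal (t f x)) x < ereal (t f x + e)"
      using \<open>0 < e\<close> by simp
    then show "\<exists>h. (\<forall>y. t f y \<le> apply_bcontfun h y) \<and> t h x < t f x + e"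
      unfolding usc_extension_def INF_less_iff by auto
  qed
next
  assume "idempotent_envelope t"
  then interpret idempotent_envelope t .
  have "usc_extension (\<lambda>f x. ereal (t f x)) (\<lambda>x. ereal (t f x)) x = ereal (t f x)" for f x
  proof (rule antisym)
    show "usc_extension (\<lambda>f x. ereal (t f x)) (\<lambda>x. ereal (t f x)) x \<le> ereal (t f x)"
    proof (rule ereal_le_epsilon2)
      fix e :: real assume "0 < e"
      then obtain h where "\<And>y. t f y \<le> apply_bcontfun h y" "t h x < t f x + e"
        using idem by blast
      then show "usc_extension (\<lambda>f x. ereal (t f x)) (\<lambda>x. ereal (t f x)) x \<le> ereal (t f x) + ereal e"
        unfolding usc_extension_def by (intro INF_lower2[of h]) auto
    qed
    show "ereal (t f x) \<le> usc_extension (\<lambda>f x. ereal (t f x)) (\<lambda>x. ereal (t f x)) x"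
      unfolding usc_extension_def
    proof (rule INF_greatest)
      fix h assume "h \<in> {h. \<forall>y. ereal (t f y) \<le> ereal (apply_bcontfun h y)}"
      then have "f y \<le> h y" for y using extensive[of f y] by (auto intro: order.trans)
      then show "ereal (t f x) \<le> ereal (t h x)" by (simp add: mono)
    qed
  qed
  then show "idempotent_operator (\<lambda>f x. ereal (t f x))"
    by (auto simp: idempotent_operator_def)
qed

lemma Kantorovich_iff_envelope:
  fixes S :: "('a::metric_space measure \<times> 'a measure) set"
  assumes compact: "compact (UNIV :: 'a set)"
  shows "(\<exists>T. backward_Kantorovich T \<and> idempotent_operator T \<and> positively_homogeneous T \<and>
            (\<forall>f x. ereal (apply_bcontfun f x) \<le> T f x) \<and>
            S = {(\<mu>, \<nu>) \<in> prob_measures \<times> prob_measures. pushforward_le T \<mu> \<nu>})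
     \<longleftrightarrow> (\<exists>t. idempotent_envelope t \<and>
            S = {(\<mu>, \<nu>) \<in> prob_measures \<times> prob_measures. \<forall>g. (\<integral>x. apply_bcontfun g x \<partial>\<nu>) \<le> (\<integral>x. t g x \<partial>\<mu>)})"
    (is "?K \<longleftrightarrow> ?E")
proof
  assume ?K
  then obtain T where T: "backward_Kantorovich T" "idempotent_operator T" "positively_homogeneous T"
    "\<And>f x. ereal (apply_bcontfun f x) \<le> T f x"
    "S = {(\<mu>, \<nu>) \<in> prob_measures \<times> prob_measures. pushforward_le T \<mu> \<nu>}"
    by blast
  obtain t where t: "envelope_operator t" "T = (\<lambda>f x. ereal (t f x))"
    using Kantorovich_envelope[OF compact T(1,3,4)] by blast
  interpret envelope_operator t by fact
  show ?E
    using T(2,5) pushforward_le_iff by (intro exI[of _ t]) (auto simp: t(2) idempotent_iff)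
next
  assume ?E
  then obtain t where t: "idempotent_envelope t"
    "S = {(\<mu>, \<nu>) \<in> prob_measures \<times> prob_measures. \<forall>g. (\<integral>x. apply_bcontfun g x \<partial>\<nu>) \<le> (\<integral>x. t g x \<partial>\<mu>)}"
    by blast
  interpret idempotent_envelope t by fact
  show ?K
    using t backward_Kantorovich pushforward_le_iff
    by (intro exI[of _ "\<lambda>f x. ereal (t f x)"])
      (auto simp: idempotent_iff positively_homogeneous_def scale extensive)
qed

section \<open>The envelope defined by a balayage cone\<close>

locale balayage =
  fixes A :: "('a::metric_space \<Rightarrow>\<^sub>C real) set"
  assumes compact_space: "compact (UNIV :: 'a set)"
    and cone: "balayage_cone A"
begin

lemma cone_add: "f \<in> A \<Longrightarrow> g \<in> A \<Longrightarrow> f + g \<in> A"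
  and cone_scale: "0 \<le> c \<Longrightarrow> f \<in> A \<Longrightarrow> c *\<^sub>R f \<in> A"
  and cone_const: "0 \<le> c \<Longrightarrow> const_bcontfun c \<in> A"
  using cone convex_cone_add convex_cone_scaleR by (auto simp: balayage_cone_def)

text \<open>
  Only the non-negative constants are assumed to belong to \<open>A\<close>; the set of majorants is built from the cone
  \<open>A + \<real>\<close> instead, which defines the same order on probability measures.
\<close>

definition majorants :: "('a \<Rightarrow>\<^sub>C real) \<Rightarrow> ('a \<Rightarrow>\<^sub>C real) set" where
  "majorants g = {\<psi>. (\<forall>x. g x \<le> apply_bcontfun \<psi> x) \<and> (\<exists>c. const_bcontfun c - \<psi> \<in> A)}"

definition envelope :: "('a \<Rightarrow>\<^sub>C real) \<Rightarrow> 'a \<Rightarrow> real" where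
  "envelope g x = (INF \<psi>\<in>majorants g. apply_bcontfun \<psi> x)"

lemma majorants_ge: "\<psi> \<in> majorants g \<Longrightarrow> g x \<le> apply_bcontfun \<psi> x"
  by (simp add: majorants_def)

lemma const_majorant: "(\<And>x. apply_bcontfun g x \<le> c) \<Longrightarrow> const_bcontfun c \<in> majorants g"
  using cone_const[of 0] by (auto simp: majorants_def intro!: exI[of _ c])

lemma majorants_nonempty: "majorants g \<noteq> {}"
proof -
  have "g x \<le> norm g" for x using norm_bounded[of g x] by simp
  then show ?thesis using const_majorant by blast
qed

lemma majorants_add:
  assumes "\<psi> \<in> majorants f" "\<theta> \<in> majorants g"
  shows "\<psi> + \<theta> \<in> majorants (f + g)"
proof -
  obtain c d where "const_bcontfun c - \<psi> \<in> A" "const_bcontfun d - \<theta> \<in> A"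
    using assms by (auto simp: majorants_def)
  then have "(const_bcontfun c - \<psi>) + (const_bcontfun d - \<theta>) \<in> A" by (rule cone_add)
  also have "(const_bcontfun c - \<psi>) + (const_bcontfun d - \<theta>) = const_bcontfun (c + d) - (\<psi> + \<theta>)"
    by (rule bcontfun_eqI) simp
  finally show ?thesis using assms by (auto simp: majorants_def intro: add_mono)
qed

lemma majorants_scale:
  assumes "0 \<le> c" "\<psi> \<in> majorants f"
  shows "c *\<^sub>R \<psi> \<in> majorants (c *\<^sub>R f)"
proof -
  obtain d where "const_bcontfun d - \<psi> \<in> A"
    using assms by (auto simp: majorants_def)
  then have "c *\<^sub>R (const_bcontfun d - \<psi>) \<in> A" by (rule cone_scale[OF assms(1)])
  also have "c *\<^sub>R (const_bcontfun d - \<psi>) = const_bcontfun (c * d) - c *\<^sub>R \<psi>"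
    by (rule bcontfun_eqI) (simp add: algebra_simps)
  finally show ?thesis using assms by (auto simp: majorants_def intro: mult_left_mono)
qed

lemma majorants_directed:
  assumes "\<psi> \<in> majorants f" "\<theta> \<in> majorants f"
  shows "\<exists>\<eta>\<in>majorants f. \<forall>x. apply_bcontfun \<eta> x \<le> \<psi> x \<and> \<eta> x \<le> \<theta> x"
proof -
  obtain c d where cd: "const_bcontfun c - \<psi> \<in> A" "const_bcontfun d - \<theta> \<in> A"
    using assms by (auto simp: majorants_def)
  \<comment> \<open>The two constants must agree before the maximum is taken. Raising one of them
    adds a non-negative constant, which stays in the cone, and
    \<open>m - max (m - \<psi>) (m - \<theta>) = min \<psi> \<theta>\<close>.\<close>
  define m where "m = max c d"
  have shift: "const_bcontfun m - \<phi> \<in> A" if "const_bcontfun b - \<phi> \<in> A" "b \<le> m" for b \<phi>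
  proof -
    have "const_bcontfun (m - b) + (const_bcontfun b - \<phi>) \<in> A"
      using that by (intro cone_add cone_const) auto
    also have "const_bcontfun (m - b) + (const_bcontfun b - \<phi>) = const_bcontfun m - \<phi>"
      by (rule bcontfun_eqI) simp
    finally show ?thesis .
  qed
  obtain h where h: "h \<in> A" "\<And>x. h x = max ((const_bcontfun m - \<psi>) x) ((const_bcontfun m - \<theta>) x)"
    using cone shift[OF cd(1)] shift[OF cd(2)] unfolding balayage_cone_def m_def
    by (metis max.cobounded1 max.cobounded2)
  have eq: "const_bcontfun m - (const_bcontfun m - h) = h"
    by (rule bcontfun_eqI) simp
  have min: "(const_bcontfun m - h) x = min (\<psi> x) (\<theta> x)" for x
    by (simp add: h(2))
  show ?thesis
  proof (rule bexI[of _ "const_bcontfun m - h"])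
    show "const_bcontfun m - h \<in> majorants f"
      using assms h(1) unfolding majorants_def mem_Collect_eq min by (auto intro!: exI[of _ m] simp: eq)
    show "\<forall>x. (const_bcontfun m - h) x \<le> \<psi> x \<and> (const_bcontfun m - h) x \<le> \<theta> x"
      unfolding min by simp
  qed
qed

lemma envelope_le: "\<psi> \<in> majorants g \<Longrightarrow> envelope g x \<le> apply_bcontfun \<psi> x"
  unfolding envelope_def
  by (intro cINF_lower bdd_belowI[of _ "g x"]) (auto simp: majorants_ge)

lemma envelope_ge: "(\<And>\<psi>. \<psi> \<in> majorants g \<Longrightarrow> b \<le> apply_bcontfun \<psi> x) \<Longrightarrow> b \<le> envelope g x"
  unfolding envelope_def by (intro cINF_greatest majorants_nonempty)

lemma envelope_less: "envelope g x < c \<Longrightarrow> \<exists>\<psi>\<in>majorants g. apply_bcontfun \<psi> x < c"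
  using envelope_ge[of g c x] by (meson not_le)

lemma envelope_scale_le:
  assumes "0 < c"
  shows "envelope (c *\<^sub>R f) x \<le> c * envelope f x"
proof -
  have "envelope (c *\<^sub>R f) x / c \<le> envelope f x"
  proof (rule envelope_ge)
    fix \<psi> assume "\<psi> \<in> majorants f"
    then have "envelope (c *\<^sub>R f) x \<le> (c *\<^sub>R \<psi>) x"
      using assms by (intro envelope_le majorants_scale) auto
    then show "envelope (c *\<^sub>R f) x / c \<le> \<psi> x" using assms by (simp add: field_simps)
  qed
  then show ?thesis using assms by (simp add: field_simps)
qed

lemma envelope_const: "envelope (const_bcontfun c) x = c"
  using envelope_le[OF const_majorant, of "const_bcontfun c" c x] majorants_ge[of _ "const_bcontfun c" x]
  by (intro antisym envelope_ge) auto

sublocale idempotent_envelope envelope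
proof
  show "compact (UNIV :: 'a set)" by (rule compact_space)
  show "envelope (f + g) x \<le> envelope f x + envelope g x" for f g x
  proof -
    have "envelope (f + g) x - \<psi> x \<le> envelope g x" if "\<psi> \<in> majorants f" for \<psi>
    proof (rule envelope_ge)
      fix \<theta> assume "\<theta> \<in> majorants g"
      then show "envelope (f + g) x - \<psi> x \<le> \<theta> x"
        using envelope_le[OF majorants_add[OF that], of \<theta> g x] by simp
    qed
    then have "envelope (f + g) x - envelope g x \<le> envelope f x"
      by (intro envelope_ge) (simp add: algebra_simps)
    then show ?thesis by simp
  qed
  show "envelope (c *\<^sub>R f) x = c * envelope f x" if "0 \<le> c" for c f x
  proof (cases "c = 0")
    case True
    then show ?thesis using envelope_const[of 0 x] by simp
  next
    case False
    then have c: "c > 0" using that by simp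
    have "envelope f x \<le> (1 / c) * envelope (c *\<^sub>R f) x"
      using envelope_scale_le[of "1 / c" "c *\<^sub>R f" x] c by simp
    then show ?thesis using envelope_scale_le[OF c, of f x] c by (simp add: field_simps)
  qed
  show "envelope f x \<le> envelope g x" if "\<And>x. apply_bcontfun f x \<le> apply_bcontfun g x" for f g x
  proof -
    have "majorants g \<subseteq> majorants f"
      using that by (auto simp: majorants_def intro: order.trans)
    then show ?thesis by (intro envelope_ge envelope_le) auto
  qed
  show "envelope (const_bcontfun c) x = c" for c x
    by (rule envelope_const)
  show "apply_bcontfun f x \<le> envelope f x" for f x
    by (rule envelope_ge) (rule majorants_ge)
  show "usc (envelope f)" for f
    unfolding usc_def
  proof
    fix c
    have "{x. envelope f x < c} = (\<Union>\<psi>\<in>majorants f. {x. apply_bcontfun \<psi> x < c})"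
    proof safe
      fix x assume "envelope f x < c"
      then show "x \<in> (\<Union>\<psi>\<in>majorants f. {x. apply_bcontfun \<psi> x < c})"
        using envelope_less by auto
    next
      fix x \<psi> assume "\<psi> \<in> majorants f" "apply_bcontfun \<psi> x < c"
      then show "envelope f x < c" using envelope_le[of \<psi> f x] by simp
    qed
    then show "open {x. envelope f x < c}"
      by (simp only:) (intro open_UN ballI open_Collect_less, auto)
  qed
  show "\<exists>h. (\<forall>y. envelope f y \<le> apply_bcontfun h y) \<and> envelope h x < envelope f x + e" if "0 < e" for e f x
  proof -
    obtain \<psi> where \<psi>: "\<psi> \<in> majorants f" "\<psi> x < envelope f x + e"
      using envelope_less[of f x "envelope f x + e"] \<open>0 < e\<close> by auto
    \<comment> \<open>Idempotence: a majorant of \<open>f\<close> is also a majorant of itself, so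
      the envelope fixes it.\<close>
    then have "\<psi> \<in> majorants \<psi>" by (auto simp: majorants_def)
    then show ?thesis
      using envelope_le[of \<psi> \<psi> x] envelope_le[OF \<psi>(1)] \<psi>(2) by (intro exI[of _ \<psi>]) (auto intro: le_less_trans)
  qed
qed

text \<open>Majorants are directed downwards, so single majorants approach the integral of the
  envelope. The constant in \<open>const_bcontfun c - \<psi>\<close> cancels since both measures
  have mass one.\<close>

lemma balayage_le_iff:
  assumes P: "\<mu> \<in> prob_measures" "\<nu> \<in> prob_measures"
  shows "balayage_le A \<mu> \<nu> \<longleftrightarrow> (\<forall>g. (\<integral>x. apply_bcontfun g x \<partial>\<nu>) \<le> (\<integral>x. envelope g x \<partial>\<mu>))"
proof
  assume le: "\<forall>g. (\<integral>x. apply_bcontfun g x \<partial>\<nu>) \<le> (\<integral>x. envelope g x \<partial>\<mu>)"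
  show "balayage_le A \<mu> \<nu>"
    unfolding balayage_le_def
  proof
    fix \<phi> assume \<phi>: "\<phi> \<in> A"
    then have "- \<phi> \<in> majorants (- \<phi>)"
      by (auto simp: majorants_def intro!: exI[of _ 0])
    then have "(\<integral>x. envelope (- \<phi>) x \<partial>\<mu>) \<le> (\<integral>x. (- \<phi>) x \<partial>\<mu>)"
      using P by (intro integral_mono integrable integrable_prob_bcontfun envelope_le)
    moreover have "(\<integral>x. (- \<phi>) x \<partial>\<nu>) \<le> (\<integral>x. envelope (- \<phi>) x \<partial>\<mu>)" using le by blast
    ultimately show "(\<integral>x. \<phi> x \<partial>\<mu>) \<le> (\<integral>x. \<phi> x \<partial>\<nu>)" by simp
  qed
next
  assume le: "balayage_le A \<mu> \<nu>"
  show "\<forall>g. (\<integral>x. apply_bcontfun g x \<partial>\<nu>) \<le> (\<integral>x. envelope g x \<partial>\<mu>)"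
  proof
    fix g
    show "(\<integral>x. apply_bcontfun g x \<partial>\<nu>) \<le> (\<integral>x. envelope g x \<partial>\<mu>)"
    proof (rule field_le_epsilon)
      fix e :: real assume "0 < e"
      then obtain \<psi> where \<psi>: "\<psi> \<in> majorants g" "(\<integral>x. \<psi> x \<partial>\<mu>) < (\<integral>x. envelope g x \<partial>\<mu>) + e"
        using directed_integral_approx[OF compact_space usc bound P(1) _ envelope_less majorants_directed]
        by metis
      obtain c where "const_bcontfun c - \<psi> \<in> A" using \<psi>(1) by (auto simp: majorants_def)
      then have "(\<integral>x. (const_bcontfun c - \<psi>) x \<partial>\<mu>) \<le> (\<integral>x. (const_bcontfun c - \<psi>) x \<partial>\<nu>)"
        using le unfolding balayage_le_def by blast
      moreover have "(\<integral>x. (const_bcontfun c - \<psi>) x \<partial>\<rho>) = c - (\<integral>x. \<psi> x \<partial>\<rho>)" if "\<rho> \<in> prob_measures" for \<rho>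
        using integrable_prob_bcontfun[OF that, of \<psi>] integral_prob_const[OF that]
          finite_measure.integrable_const[OF prob_measuresD(2)[OF that], of c]
        by (simp del: integral_const)
      ultimately have "(\<integral>x. \<psi> x \<partial>\<nu>) \<le> (\<integral>x. \<psi> x \<partial>\<mu>)" using P by simp
      moreover have "(\<integral>x. g x \<partial>\<nu>) \<le> (\<integral>x. \<psi> x \<partial>\<nu>)"
        using P \<psi>(1) by (intro integral_mono integrable_prob_bcontfun majorants_ge)
      ultimately show "(\<integral>x. apply_bcontfun g x \<partial>\<nu>) \<le> (\<integral>x. envelope g x \<partial>\<mu>) + e"
        using \<psi>(2) by linarith
    qed
  qed
qed

end

lemma balayage_iff_envelope:
  fixes S :: "('a::metric_space measure \<times> 'a measure) set"
  assumes compact: "compact (UNIV :: 'a set)"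
  shows "(\<exists>A. balayage_cone A \<and> S = {(\<mu>, \<nu>) \<in> prob_measures \<times> prob_measures. balayage_le A \<mu> \<nu>})
     \<longleftrightarrow> (\<exists>t. idempotent_envelope t \<and>
            S = {(\<mu>, \<nu>) \<in> prob_measures \<times> prob_measures. \<forall>g. (\<integral>x. apply_bcontfun g x \<partial>\<nu>) \<le> (\<integral>x. t g x \<partial>\<mu>)})"
    (is "?B \<longleftrightarrow> ?E")
proof
  assume ?B
  then obtain A where A: "balayage_cone A" "S = {(\<mu>, \<nu>) \<in> prob_measures \<times> prob_measures. balayage_le A \<mu> \<nu>}"
    by blast
  interpret balayage A
    using compact A(1) by unfold_locales
  show ?E
    using A(2) balayage_le_iff by (intro exI[of _ envelope] conjI idempotent_envelope_axioms) auto
next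
  assume ?E
  then obtain t where t: "idempotent_envelope t"
    "S = {(\<mu>, \<nu>) \<in> prob_measures \<times> prob_measures. \<forall>g. (\<integral>x. apply_bcontfun g x \<partial>\<nu>) \<le> (\<integral>x. t g x \<partial>\<mu>)}"
    by blast
  interpret idempotent_envelope t by fact
  show ?B
    using t(2) balayage_le_invariant_cone
    by (intro exI[of _ invariant_cone] conjI balayage_cone_invariant_cone) auto
qed

section \<open>Signed measures\<close>

lemma sigma_sets_open: "sigma_sets UNIV {U :: 'a::topological_space set. open U} = sets borel"
  by (simp add: borel_def)

text \<open>The coercion truncates negative terms, hence only an inequality.\<close>

lemma ennreal_sum_le: "ennreal (\<Sum>i<n. f i) \<le> (\<Sum>i<n. ennreal (f i))" for n :: nat
proof (induction n)
  case (Suc n)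
  have "ennreal ((\<Sum>i<n. f i) + f n) \<le> ennreal (max 0 (\<Sum>i<n. f i) + max 0 (f n))"
    by (rule ennreal_leI) auto
  also have "\<dots> = ennreal (\<Sum>i<n. f i) + ennreal (f n)"
    by (simp add: ennreal_plus max_def ennreal_neg)
  finally show ?case using Suc by (simp add: add_right_mono order.trans)
qed simp

locale signed_measure =
  fixes m :: "'a::metric_space set \<Rightarrow> real"
  assumes signed: "m \<in> signed_measures"
begin

lemma sums: "range A \<subseteq> sets borel \<Longrightarrow> disjoint_family A \<Longrightarrow> (\<lambda>n. m (A n)) sums m (\<Union>n::nat. A n)"
  using signed by (simp add: signed_measures_def)

lemma empty: "m {} = 0"
proof -
  have "(\<lambda>n::nat. m {}) sums m {}"
    using sums[of "\<lambda>_. {}"] by (simp add: disjoint_family_on_def)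
  then have "(\<lambda>n::nat. m {}) \<longlonglongrightarrow> 0"
    by (intro summable_LIMSEQ_zero sums_summable)
  then show ?thesis by (simp add: LIMSEQ_const_iff)
qed

lemma union:
  assumes "A \<in> sets borel" "B \<in> sets borel" "A \<inter> B = {}"
  shows "m (A \<union> B) = m A + m B"
proof -
  have "(\<lambda>n. m (binaryset A B n)) sums m (A \<union> B)"
  proof -
    have "range (binaryset A B) \<subseteq> sets borel"
      using assms by (auto simp: range_binaryset_eq)
    moreover have "disjoint_family (binaryset A B)"
      using assms(3) by (auto simp: disjoint_family_on_def binaryset_def)
    ultimately show ?thesis using sums[of "binaryset A B"] by (simp add: UN_binaryset_eq)
  qed
  moreover have "(\<lambda>n. m (binaryset A B n)) sums (m A + m B)"
    by (rule binaryset_sums) (rule empty)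
  ultimately show ?thesis by (rule sums_unique2)
qed

lemma diff: "A \<in> sets borel \<Longrightarrow> B \<in> sets borel \<Longrightarrow> B \<subseteq> A \<Longrightarrow> m (A - B) = m A - m B"
  using union[of B "A - B"] by (simp add: Un_absorb1)

lemma uminus: "signed_measure (\<lambda>A. - m A)"
  using signed by unfold_locales (auto simp: signed_measures_def intro: sums_minus)

definition upper :: "'a set \<Rightarrow> ennreal" where
  "upper A = (SUP B\<in>{B \<in> sets borel. B \<subseteq> A}. ennreal (m B))"

lemma upper_ge: "B \<in> sets borel \<Longrightarrow> B \<subseteq> A \<Longrightarrow> ennreal (m B) \<le> upper A"
  unfolding upper_def by (rule SUP_upper) simp

lemma upper_mono: "A \<subseteq> B \<Longrightarrow> upper A \<le> upper B"
  unfolding upper_def by (rule SUP_subset_mono) auto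

lemma upper_empty: "upper {} = 0"
  by (auto simp: upper_def empty intro!: antisym SUP_least)

lemma upper_superadditive:
  assumes "A \<inter> B = {}"
  shows "upper A + upper B \<le> upper (A \<union> B)"
proof -
  have ne: "{C \<in> sets borel. C \<subseteq> D} \<noteq> {}" for D :: "'a set" by auto
  have main: "ennreal (m C) + ennreal (m D) \<le> upper (A \<union> B)"
    if CD: "C \<in> sets borel" "C \<subseteq> A" "D \<in> sets borel" "D \<subseteq> B" for C D
  proof -
    \<comment> \<open>\<open>ennreal\<close> is additive on non-negative numbers; a set of negative
      measure is exchanged for the empty set, which has the same truncated value.\<close>
    define C' where "C' = (if 0 \<le> m C then C else {})"
    define D' where "D' = (if 0 \<le> m D then D else {})"
    have "ennreal (m C) = ennreal (m C')" "ennreal (m D) = ennreal (m D')" "0 \<le> m C'" "0 \<le> m D'"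
      by (auto simp: C'_def D'_def empty ennreal_neg)
    moreover have sub: "C' \<in> sets borel" "D' \<in> sets borel" "C' \<subseteq> A" "D' \<subseteq> B"
      using CD by (auto simp: C'_def D'_def)
    then have "m (C' \<union> D') = m C' + m D'"
      using assms by (intro union) auto
    moreover have "ennreal (m (C' \<union> D')) \<le> upper (A \<union> B)"
      using sub by (intro upper_ge) auto
    ultimately show ?thesis by (simp add: ennreal_plus)
  qed
  have "upper A + ennreal (m D) \<le> upper (A \<union> B)" if "D \<in> sets borel" "D \<subseteq> B" for D
    unfolding upper_def[of A] using main that ne by (subst ennreal_SUP_add_left[symmetric]) (auto intro!: SUP_least)
  then show ?thesis
    unfolding upper_def[of B] using ne by (subst ennreal_SUP_add_right) (auto intro!: SUP_least)
qed

text \<open>Read directly off the supremum: superadditivity on finite unions bounds the series, and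
  countable additivity of \<open>m\<close> on the pieces \<open>B \<inter> A i\<close> bounds the
  union.\<close>

lemma upper_countably_additive: "countably_additive (sets borel) upper"
  unfolding countably_additive_def
proof (intro allI impI)
  fix A :: "nat \<Rightarrow> 'a set" assume A: "range A \<subseteq> sets borel" "disjoint_family A"
  show "(\<Sum>i. upper (A i)) = upper (\<Union>i. A i)"
  proof (rule antisym)
    show "(\<Sum>i. upper (A i)) \<le> upper (\<Union>i. A i)"
    proof (rule suminf_le_const)
      fix n
      have "(\<Sum>i<n. upper (A i)) \<le> upper (\<Union>i<n. A i)"
      proof (induction n)
        case (Suc n)
        have "(\<Union>i<n. A i) \<inter> A n = {}"
        proof -
          have "A i \<inter> A n = {}" if "i < n" for i
            using that A(2) by (simp add: disjoint_family_on_def)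
          then show ?thesis by auto
        qed
        from upper_superadditive[OF this]
        have "upper (\<Union>i<n. A i) + upper (A n) \<le> upper (\<Union>i<Suc n. A i)"
          by (simp add: lessThan_Suc Un_commute)
        from order.trans[OF add_right_mono[OF Suc] this] show ?case by simp
      qed simp
      also have "\<dots> \<le> upper (\<Union>i. A i)" by (rule upper_mono) auto
      finally show "(\<Sum>i<n. upper (A i)) \<le> upper (\<Union>i. A i)" .
    qed simp
    show "upper (\<Union>i. A i) \<le> (\<Sum>i. upper (A i))"
      unfolding upper_def[of "\<Union>i. A i"]
    proof (rule SUP_least)
      fix B assume "B \<in> {B \<in> sets borel. B \<subseteq> (\<Union>i. A i)}"
      then have B: "B \<in> sets borel" "B = (\<Union>i. B \<inter> A i)" by auto
      have "(\<lambda>i. m (B \<inter> A i)) sums m (\<Union>i. B \<inter> A i)"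
        using A B(1) by (intro sums) (auto simp: disjoint_family_on_def)
      then have "(\<lambda>n. \<Sum>i<n. m (B \<inter> A i)) \<longlonglongrightarrow> m B"
        using B(2) by (simp add: sums_def)
      then have "(\<lambda>n. ennreal (\<Sum>i<n. m (B \<inter> A i))) \<longlonglongrightarrow> ennreal (m B)"
        by (rule tendsto_ennrealI)
      moreover have "ennreal (\<Sum>i<n. m (B \<inter> A i)) \<le> (\<Sum>i. upper (A i))" for n
      proof -
        have "ennreal (\<Sum>i<n. m (B \<inter> A i)) \<le> (\<Sum>i<n. ennreal (m (B \<inter> A i)))"
          by (rule ennreal_sum_le)
        also have "\<dots> \<le> (\<Sum>i<n. upper (A i))"
          using A(1) B(1) by (intro sum_mono upper_ge) auto
        also have "\<dots> \<le> (\<Sum>i. upper (A i))" by (rule sum_le_suminf) auto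
        finally show ?thesis .
      qed
      ultimately show "ennreal (m B) \<le> (\<Sum>i. upper (A i))"
        by (intro LIMSEQ_le_const2) auto
    qed
  qed
qed

lemma sets_positive_variation: "sets (positive_variation m) = sets borel"
  using sets.sigma_sets_eq[of "borel :: 'a measure"] by (simp add: positive_variation_def)

lemma emeasure_positive_variation:
  assumes "A \<in> sets borel"
  shows "emeasure (positive_variation m) A = upper A"
proof -
  have "sigma_algebra UNIV (sets (borel :: 'a measure))"
    using sets.sigma_algebra_axioms[of "borel :: 'a measure"] by simp
  moreover have "positive_variation m = measure_of UNIV (sets borel) upper"
    by (simp add: positive_variation_def upper_def[abs_def])
  ultimately show ?thesis
    using assms upper_countably_additive upper_empty
    by (simp add: emeasure_measure_of_sigma positive_def)
qed

text \<open>\<open>B\<close> is chosen with \<open>m B\<close> so large that \<open>m B\<close> and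
  \<open>m (A - B)\<close> both have absolute value above 1. One of the two parts keeps infinite
  variation and becomes \<open>E\<close>.\<close>

lemma split_infinite:
  assumes A: "A \<in> sets borel" "upper A = \<infinity>"
  obtains E where "E \<in> sets borel" "E \<subseteq> A" "upper E = \<infinity>" "1 \<le> \<bar>m (A - E)\<bar>"
proof -
  have "ennreal (\<bar>m A\<bar> + 1) < upper A" using A by simp
  then obtain B where B: "B \<in> sets borel" "B \<subseteq> A" "ennreal (\<bar>m A\<bar> + 1) < ennreal (m B)"
    unfolding upper_def less_SUP_iff by auto
  have mB: "\<bar>m A\<bar> + 1 < m B" using B(3) ennreal_less_iff[of "\<bar>m A\<bar> + 1" "m B"] by (simp del: ennreal_plus)
  have mAB: "m (A - B) = m A - m B" using A B by (intro diff)
  have "emeasure (positive_variation m) B + emeasure (positive_variation m) (A - B) = emeasure (positive_variation m) A"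
    using A B by (subst plus_emeasure) (auto simp: sets_positive_variation Un_absorb1)
  then have "upper B + upper (A - B) = \<infinity>"
    using A B by (simp add: emeasure_positive_variation)
  then consider "upper B = \<infinity>" | "upper (A - B) = \<infinity>" by (auto simp: infinity_ennreal_def)
  then show thesis
  proof cases
    case 1
    then show ?thesis using B mB mAB by (intro that[of B]) auto
  next
    case 2
    moreover have "A - (A - B) = B" using B(2) by auto
    ultimately show ?thesis using A B mB by (intro that[of "A - B"]) auto
  qed
qed

text \<open>Otherwise repeated splitting gives a decreasing sequence whose successive differences
  are disjoint and have masses of size at least 1, while the series of these masses
  converges.\<close>

lemma upper_finite: "upper UNIV < \<infinity>"
proof (rule ccontr)
  assume "\<not> upper UNIV < \<infinity>"
  then have top: "upper UNIV = \<infinity>" by (simp add: top.not_eq_extremum[symmetric])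
  have "\<exists>A. \<forall>n::nat. (A n \<in> sets borel \<and> upper (A n) = \<infinity>) \<and> (A (Suc n) \<subseteq> A n \<and> 1 \<le> \<bar>m (A n - A (Suc n))\<bar>)"
  proof (rule dependent_nat_choice)
    show "\<exists>A. A \<in> sets borel \<and> upper A = \<infinity>" using top by (intro exI[of _ UNIV]) auto
    show "\<exists>E. (E \<in> sets borel \<and> upper E = \<infinity>) \<and> E \<subseteq> A \<and> 1 \<le> \<bar>m (A - E)\<bar>"
      if "A \<in> sets borel \<and> upper A = \<infinity>" for A
      using split_infinite[of A] that by metis
  qed
  then obtain A :: "nat \<Rightarrow> 'a set" where A: "\<And>n. A n \<in> sets borel" "\<And>n. A (Suc n) \<subseteq> A n"
    "\<And>n. 1 \<le> \<bar>m (A n - A (Suc n))\<bar>"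
    by blast
  have "decseq A" using A(2) by (rule decseq_SucI)
  then have anti: "A j \<subseteq> A i" if "i \<le> j" for i j using that by (rule decseqD)
  have "disjoint_family (\<lambda>n. A n - A (Suc n))"
    unfolding disjoint_family_on_def
  proof (intro ballI impI)
    fix i j :: nat assume "i \<noteq> j"
    then consider "Suc i \<le> j" | "Suc j \<le> i" by linarith
    then show "(A i - A (Suc i)) \<inter> (A j - A (Suc j)) = {}"
      by cases (use anti[of "Suc i" j] anti[of "Suc j" i] in auto)
  qed
  then have "(\<lambda>n. m (A n - A (Suc n))) \<longlonglongrightarrow> 0"
    using A(1) by (intro summable_LIMSEQ_zero sums_summable[OF sums]) auto
  then have "\<forall>\<^sub>F n in sequentially. \<bar>m (A n - A (Suc n))\<bar> < 1"
    by (auto simp: tendsto_iff dist_real_def)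
  then show False using A(3) by (auto simp: eventually_sequentially not_le[symmetric])
qed

lemma finite_positive_variation: "finite_measure (positive_variation m)"
proof
  have "space (positive_variation m) = UNIV"
    using sets_eq_imp_space_eq[OF sets_positive_variation] by simp
  then show "emeasure (positive_variation m) (space (positive_variation m)) \<noteq> \<infinity>"
    using upper_finite by (simp add: emeasure_positive_variation less_top)
qed

lemma measure_positive_variation_ge:
  assumes "A \<in> sets borel" "B \<in> sets borel" "B \<subseteq> A"
  shows "m B \<le> measure (positive_variation m) A"
proof -
  interpret finite_measure "positive_variation m" by (rule finite_positive_variation)
  have "ennreal (m B) \<le> emeasure (positive_variation m) A"
    using assms by (simp add: emeasure_positive_variation upper_ge)
  then show ?thesis by (simp add: emeasure_eq_measure)
qed

lemma measure_positive_variation_le: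
  assumes "A \<in> sets borel" "\<And>B. B \<in> sets borel \<Longrightarrow> B \<subseteq> A \<Longrightarrow> m B \<le> c"
  shows "measure (positive_variation m) A \<le> c"
proof -
  interpret finite_measure "positive_variation m" by (rule finite_positive_variation)
  have "0 \<le> c" using assms(2)[of "{}"] empty by simp
  moreover have "emeasure (positive_variation m) A \<le> ennreal c"
    unfolding emeasure_positive_variation[OF assms(1)] upper_def
    by (rule SUP_least) (use assms(2) in \<open>auto intro: ennreal_leI\<close>)
  ultimately show ?thesis by (simp add: emeasure_eq_measure)
qed

lemma negative_variation_facts:
  "finite_measure (negative_variation m)" "sets (negative_variation m) = sets borel"
  using signed_measure.finite_positive_variation[OF uminus] signed_measure.sets_positive_variation[OF uminus]
  by (simp_all add: negative_variation_def)

text \<open>For \<open>B \<subseteq> A\<close>, \<open>m B = m A - m (A - B)\<close>, and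
  \<open>- m (A - B)\<close> is at most the negative variation of \<open>A\<close>. The supremum
  over \<open>B\<close> gives one inequality; the same argument for \<open>- m\<close> gives the
  other.\<close>

lemma Jordan:
  assumes A: "A \<in> sets borel"
  shows "m A = measure (positive_variation m) A - measure (negative_variation m) A"
proof -
  interpret minus: signed_measure "\<lambda>A. - m A" by (rule uminus)
  have "measure (positive_variation m) A \<le> m A + measure (negative_variation m) A"
  proof (rule measure_positive_variation_le[OF A])
    fix B assume B: "B \<in> sets borel" "B \<subseteq> A"
    then have "- m (A - B) \<le> measure (negative_variation m) A"
      unfolding negative_variation_def using A by (intro minus.measure_positive_variation_ge) auto
    then show "m B \<le> m A + measure (negative_variation m) A"
      using diff[OF A B] by simp
  qed
  moreover have "measure (negative_variation m) A \<le> - m A + measure (positive_variation m) A"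
    unfolding negative_variation_def
  proof (rule minus.measure_positive_variation_le[OF A])
    fix B assume B: "B \<in> sets borel" "B \<subseteq> A"
    then have "m (A - B) \<le> measure (positive_variation m) A"
      using A by (intro measure_positive_variation_ge) auto
    then show "- m B \<le> - m A + measure (positive_variation m) A"
      using diff[OF A B] by simp
  qed
  ultimately show ?thesis by simp
qed

end

section \<open>Set functions determined by integrals of continuous functions\<close>

lemma integral_tendsto_measure_open:
  fixes U :: "'a::metric_space set"
  assumes compact: "compact (UNIV :: 'a set)" and U: "open U"
  obtains f :: "nat \<Rightarrow> 'a \<Rightarrow>\<^sub>C real" where
    "\<And>M. finite_measure M \<Longrightarrow> sets M = sets borel \<Longrightarrow> (\<lambda>n. \<integral>x. f n x \<partial>M) \<longlonglongrightarrow> measure M U"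
proof -
  obtain d :: "'a \<Rightarrow> real" where d: "continuous_on UNIV d" "\<And>x. 0 \<le> d x" "\<And>x. d x > 0 \<longleftrightarrow> x \<in> U"
    using open_positivity_set[OF U] by blast
  \<comment> \<open>The functions depend on \<open>U\<close> alone, so one sequence works for all
    measures; \<open>combination_eq_measure\<close> compares three of them along it.\<close>
  define f where "f n = Bcontfun (\<lambda>x. min 1 (real n * d x))" for n
  have f: "f n x = min 1 (real n * d x)" for n x
    unfolding f_def by (subst apply_Bcontfun[OF compact]) (auto intro!: continuous_intros d(1))
  have lim: "(\<lambda>n. f n x) \<longlonglongrightarrow> indicator U x" for x
  proof (cases "x \<in> U")
    case True
    then have dx: "d x > 0" using d(3) by simp
    then obtain N where N: "1 < real N * d x" using ex_less_of_nat_mult[OF dx] by blast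
    have "f n x = 1" if "n \<ge> N" for n
    proof -
      have "real N * d x \<le> real n * d x" using that dx by (intro mult_right_mono) auto
      then show ?thesis using N by (simp add: f)
    qed
    then show ?thesis
      using True by (intro tendsto_eventually) (auto simp: eventually_sequentially)
  next
    case False
    then have "d x = 0" using d(2)[of x] d(3)[of x] by auto
    then show ?thesis using False by (simp add: f)
  qed
  show thesis
  proof (rule that)
    fix M :: "'a measure" assume M: "finite_measure M" "sets M = sets borel"
    interpret finite_measure M by fact
    have sp: "space M = UNIV" using sets_eq_imp_space_eq[OF M(2)] by simp
    have "(\<lambda>n. \<integral>x. f n x \<partial>M) \<longlonglongrightarrow> (\<integral>x. indicator U x \<partial>M)"
    proof (rule integral_dominated_convergence[where w = "\<lambda>_. 1"])
      show "apply_bcontfun (f n) \<in> borel_measurable M" for n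
        using integrable_bcontfun[OF M, of "f n"] by auto
      show "AE x in M. norm (f n x) \<le> 1" for n
        using d(2) by (auto simp: f)
      show "indicat_real U \<in> borel_measurable M"
        using M(2) U by (intro borel_measurable_indicator) simp
    qed (use lim in auto)
    also have "(\<integral>x. indicator U x \<partial>M) = measure M U"
      using U M by (simp add: sp)
    finally show "(\<lambda>n. \<integral>x. f n x \<partial>M) \<longlonglongrightarrow> measure M U" .
  qed
qed

text \<open>The combination may be signed, so uniqueness theorems for measures do not cover it and
  the induction over the open sets is run on the identity itself. The weights used are
  \<open>l\<close>, \<open>1 - l\<close> and \<open>1\<close>, \<open>-1\<close>.\<close>

lemma combination_eq_measure:
  fixes M N :: "'a::metric_space measure"
  assumes compact: "compact (UNIV :: 'a set)"
    and M: "finite_measure M" "sets M = sets borel" and N: "finite_measure N" "sets N = sets borel"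
    and \<sigma>: "\<sigma> \<in> prob_measures"
    and eq: "\<And>g. a * (\<integral>x. apply_bcontfun g x \<partial>M) + b * (\<integral>x. apply_bcontfun g x \<partial>N) = (\<integral>x. apply_bcontfun g x \<partial>\<sigma>)"
    and A: "A \<in> sets borel"
  shows "a * measure M A + b * measure N A = measure \<sigma> A"
proof -
  note \<sigma>' = prob_measuresD(2,3)[OF \<sigma>]
  have "Int_stable {U :: 'a set. open U}" by (auto simp: Int_stable_def)
  moreover have "{U :: 'a set. open U} \<subseteq> Pow UNIV" by simp
  moreover have "A \<in> sigma_sets UNIV {U. open U}" using A by (simp add: sigma_sets_open)
  ultimately show ?thesis
  proof (induction rule: sigma_sets_induct_disjoint)
    case (basic U)
    then have "open U" by simp
    then obtain f :: "nat \<Rightarrow> 'a \<Rightarrow>\<^sub>C real" where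
      f: "\<And>M. finite_measure M \<Longrightarrow> sets M = sets borel \<Longrightarrow> (\<lambda>n. \<integral>x. f n x \<partial>M) \<longlonglongrightarrow> measure M U"
      using integral_tendsto_measure_open[OF compact] by blast
    have "(\<lambda>n. a * (\<integral>x. f n x \<partial>M) + b * (\<integral>x. f n x \<partial>N)) \<longlonglongrightarrow> a * measure M U + b * measure N U"
      by (intro tendsto_intros f M N)
    then show ?case
      unfolding eq using f[OF \<sigma>'] by (rule LIMSEQ_unique)
  next
    case (compl A)
    have *: "measure Q (UNIV - A) = measure Q UNIV - measure Q A"
      if "finite_measure Q" "sets Q = sets borel" for Q :: "'a measure"
    proof -
      have "space Q = UNIV" using sets_eq_imp_space_eq[OF that(2)] by simp
      then show ?thesis
        using finite_measure.finite_measure_compl[OF that(1), of A] that(2) compl(1)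
        by (simp add: sigma_sets_open)
    qed
    obtain f :: "nat \<Rightarrow> 'a \<Rightarrow>\<^sub>C real" where
      f: "\<And>M. finite_measure M \<Longrightarrow> sets M = sets borel \<Longrightarrow> (\<lambda>n. \<integral>x. f n x \<partial>M) \<longlonglongrightarrow> measure M (UNIV :: 'a set)"
      using integral_tendsto_measure_open[OF compact open_UNIV] by blast
    have "(\<lambda>n. a * (\<integral>x. f n x \<partial>M) + b * (\<integral>x. f n x \<partial>N)) \<longlonglongrightarrow> a * measure M UNIV + b * measure N UNIV"
      by (intro tendsto_intros f M N)
    then have "a * measure M UNIV + b * measure N UNIV = measure \<sigma> UNIV"
      unfolding eq using f[OF \<sigma>'] by (rule LIMSEQ_unique)
    then show ?case
      using compl(2) by (simp add: *[OF M] *[OF N] *[OF \<sigma>'] algebra_simps)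
  next
    case (union B)
    have *: "(\<lambda>n. measure Q (B n)) sums measure Q (\<Union>n. B n)"
      if "finite_measure Q" "sets Q = sets borel" for Q :: "'a measure"
      using finite_measure.finite_measure_UNION[OF that(1), of B] that(2) union(1,2)
      by (simp add: sigma_sets_open)
    have "(\<lambda>n. a * measure M (B n) + b * measure N (B n)) sums (a * measure M (\<Union>n. B n) + b * measure N (\<Union>n. B n))"
      by (intro sums_add sums_mult * M N)
    then show ?case
      unfolding union(3) using *[OF \<sigma>'] by (rule sums_unique2)
  qed simp
qed

lemma measure_inject_prob:
  assumes "\<mu> \<in> prob_measures" "\<nu> \<in> prob_measures" "measure \<mu> = measure \<nu>"
  shows "\<mu> = \<nu>"
proof (rule measure_eqI)
  show "sets \<mu> = sets \<nu>" using assms by (simp add: prob_measuresD)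
  show "emeasure \<mu> A = emeasure \<nu> A" for A
    using finite_measure.emeasure_eq_measure[OF prob_measuresD(2)] assms by metis
qed

lemma prob_measure_convex_combination:
  fixes \<mu> \<nu> :: "'a::metric_space measure"
  assumes compact: "compact (UNIV :: 'a set)"
    and P: "\<mu> \<in> prob_measures" "\<nu> \<in> prob_measures" and l: "l \<in> {0..1}"
  obtains \<rho> where "\<rho> \<in> prob_measures" "measure \<rho> = (\<lambda>A. l * measure \<mu> A + (1 - l) * measure \<nu> A)"
    "\<And>g. (\<integral>x. apply_bcontfun g x \<partial>\<rho>) = l * (\<integral>x. g x \<partial>\<mu>) + (1 - l) * (\<integral>x. g x \<partial>\<nu>)"
proof -
  define L where "L g = l * (\<integral>x. apply_bcontfun g x \<partial>\<mu>) + (1 - l) * (\<integral>x. apply_bcontfun g x \<partial>\<nu>)" for g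
  have "linear L"
    by (rule linearI) (simp_all add: L_def integrable_prob_bcontfun P algebra_simps)
  moreover have "L g \<le> c" if "\<And>x. apply_bcontfun g x \<le> c" for g c
  proof -
    have "L g \<le> l * c + (1 - l) * c"
      unfolding L_def using l P that by (intro add_mono mult_left_mono integral_le_const) auto
    then show ?thesis by (simp add: algebra_simps)
  qed
  ultimately obtain \<rho> where \<rho>: "\<rho> \<in> prob_measures" "\<And>g. L g = (\<integral>x. apply_bcontfun g x \<partial>\<rho>)"
    using Riesz_prob_measure[OF compact, of L] by metis
  have "measure \<rho> A = l * measure \<mu> A + (1 - l) * measure \<nu> A" for A
  proof (cases "A \<in> sets borel")
    case True
    then show ?thesis
      using combination_eq_measure[OF compact prob_measuresD(2,3)[OF P(1)] prob_measuresD(2,3)[OF P(2)] \<rho>(1), of l "1 - l" A]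
        \<rho>(2) by (simp add: L_def)
  next
    case False
    then show ?thesis using P \<rho>(1) by (simp add: measure_notin_sets prob_measuresD)
  qed
  then show thesis using \<rho> by (intro that[of \<rho>]) (auto simp: L_def)
qed

text \<open>The right-hand side consists of weak-star closed conditions. When they hold, Riesz
  representation gives a probability measure with the same integrals, and the Jordan decomposition
  makes \<open>combination_eq_measure\<close> applicable to identify it with
  \<open>m\<close>.\<close>

lemma signed_measure_prob_iff:
  fixes m :: "'a::metric_space set \<Rightarrow> real"
  assumes compact: "compact (UNIV :: 'a set)" and m: "m \<in> signed_measures"
  shows "m \<in> measure ` prob_measures \<longleftrightarrow>
    (\<forall>g. (\<forall>x. 0 \<le> apply_bcontfun g x) \<longrightarrow> 0 \<le> signed_integral m g) \<and> signed_integral m (const_bcontfun 1) = 1"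
    (is "_ \<longleftrightarrow> ?R")
proof
  assume "m \<in> measure ` prob_measures"
  then obtain \<mu> where \<mu>: "\<mu> \<in> prob_measures" "m = measure \<mu>" by auto
  show ?R
    using prob_space.prob_space[OF prob_measuresD(1)[OF \<mu>(1)]]
    by (auto simp: \<mu>(2) signed_integral_measure[OF \<mu>(1)] intro!: integral_nonneg)
next
  assume R: ?R
  interpret signed_measure m by unfold_locales (rule m)
  note fin = finite_positive_variation sets_positive_variation negative_variation_facts
  define L where "L g = signed_integral m (apply_bcontfun g)" for g
  have lin: "linear L"
    by (rule linearI)
      (simp_all add: L_def signed_integral_def integrable_bcontfun fin algebra_simps)
  have "L g \<le> c" if "\<And>x. apply_bcontfun g x \<le> c" for g c
  proof -
    have "0 \<le> L (c *\<^sub>R const_bcontfun 1 - g)"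
      unfolding L_def by (rule R[THEN conjunct1, rule_format]) (use that in simp)
    then show ?thesis using R by (simp add: linear_diff[OF lin] linear_scale[OF lin]) (simp add: L_def)
  qed
  then obtain \<sigma> where \<sigma>: "\<sigma> \<in> prob_measures" "\<And>g. L g = (\<integral>x. apply_bcontfun g x \<partial>\<sigma>)"
    using Riesz_prob_measure[OF compact lin] by metis
  have "m A = measure \<sigma> A" for A
  proof (cases "A \<in> sets borel")
    case True
    then show ?thesis
      using combination_eq_measure[OF compact fin \<sigma>(1), of 1 "-1" A] \<sigma>(2) Jordan[OF True]
      by (simp add: L_def signed_integral_def)
  next
    case False
    then show ?thesis using m \<sigma>(1) by (simp add: signed_measures_def measure_notin_sets prob_measuresD)
  qed
  then show "m \<in> measure ` prob_measures" using \<sigma>(1) by auto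
qed

section \<open>Transfer sets\<close>

lemma topspace_weak_star: "topspace weak_star = signed_measures"
  by (simp add: weak_star_def topspace_pullback_topology)

lemma weak_star_neighbourhood:
  fixes U :: "('a::metric_space set \<Rightarrow> real) set"
  assumes U: "openin weak_star U" and m: "m \<in> U"
  obtains G :: "('a \<Rightarrow>\<^sub>C real) set" and e where "finite G" "e > 0"
    "\<And>n. n \<in> signed_measures \<Longrightarrow> (\<And>g. g \<in> G \<Longrightarrow> \<bar>signed_integral n (apply_bcontfun g) - signed_integral m g\<bar> < e) \<Longrightarrow> n \<in> U"
proof -
  let ?\<Phi> = "\<lambda>m (g :: 'a \<Rightarrow>\<^sub>C real). signed_integral m (apply_bcontfun g)"
  obtain V where V: "openin (powertop_real UNIV) V" "U = ?\<Phi> -` V \<inter> signed_measures"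
    using U by (auto simp: weak_star_def openin_pullback_topology)
  then have "?\<Phi> m \<in> V" using m by auto
  then obtain W where W: "finite {g. W g \<noteq> UNIV}" "\<And>g. open (W g)"
    "?\<Phi> m \<in> Pi\<^sub>E UNIV W" "Pi\<^sub>E UNIV W \<subseteq> V"
    using V(1) by (auto simp: openin_product_topology_alt)
  have "\<forall>g. \<exists>e>0. \<forall>y. \<bar>y - ?\<Phi> m g\<bar> < e \<longrightarrow> y \<in> W g"
    using W(2,3) by (auto simp: open_real PiE_iff)
  then obtain e where e: "\<And>g. e g > 0" "\<And>g y. \<bar>y - ?\<Phi> m g\<bar> < e g \<Longrightarrow> y \<in> W g"
    by metis
  \<comment> \<open>The inserted 1 keeps \<open>Min\<close> meaningful when no coordinate is
    constrained.\<close>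
  define d where "d = Min (insert 1 (e ` {g. W g \<noteq> UNIV}))"
  have d: "d > 0" "\<And>g. W g \<noteq> UNIV \<Longrightarrow> d \<le> e g"
    using W(1) e(1) by (auto simp: d_def)
  show thesis
  proof (rule that[OF W(1) d(1)])
    fix n assume n: "n \<in> signed_measures"
      "\<And>g. g \<in> {g. W g \<noteq> UNIV} \<Longrightarrow> \<bar>?\<Phi> n g - ?\<Phi> m g\<bar> < d"
    have "?\<Phi> n g \<in> W g" for g
    proof (cases "W g = UNIV")
      case False
      then show ?thesis using n(2)[of g] d(2)[of g] by (intro e(2)) auto
    qed simp
    then have "?\<Phi> n \<in> V" using W(4) by (auto simp: PiE_iff)
    then show "n \<in> U" using V(2) n(1) by simp
  qed
qed

lemma continuous_map_signed_integral:
  "continuous_map weak_star euclideanreal (\<lambda>m. signed_integral m (apply_bcontfun g))"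
proof -
  have "continuous_map weak_star euclideanreal
      ((\<lambda>f. f g) \<circ> (\<lambda>m (g :: 'a::metric_space \<Rightarrow>\<^sub>C real). signed_integral m (apply_bcontfun g)))"
    unfolding weak_star_def by (intro continuous_map_pullback continuous_map_product_projection) simp
  then show ?thesis by (simp add: o_def)
qed

text \<open>
  The functional is the difference of \<open>p\<close> and an almost nearest point of \<open>C\<close>, so that neither
  compactness nor closedness of \<open>C\<close> is required.
\<close>

lemma finite_dimensional_separation:
  fixes C :: "('i \<Rightarrow> real) set" and p B :: "'i \<Rightarrow> real"
  assumes G: "finite G" and e: "e > 0"
    and convex: "\<And>y z l. y \<in> C \<Longrightarrow> z \<in> C \<Longrightarrow> l \<in> {0..1} \<Longrightarrow> (\<lambda>i. l * y i + (1 - l) * z i) \<in> C"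
    and bound: "\<And>z i. z \<in> C \<Longrightarrow> \<bar>z i\<bar> \<le> B i"
    and far: "\<And>z. z \<in> C \<Longrightarrow> \<exists>i\<in>G. e \<le> \<bar>z i - p i\<bar>"
  obtains w c where "\<And>z. z \<in> C \<Longrightarrow> (\<Sum>i\<in>G. w i * z i) \<le> c" "c < (\<Sum>i\<in>G. w i * p i)"
proof (cases "C = {}")
  case True
  then show thesis using that[of "\<lambda>_. 0" "-1"] by simp
next
  case False
  define D where "D z = (\<Sum>i\<in>G. (z i - p i)\<^sup>2)" for z
  have D_ge: "e\<^sup>2 \<le> D z" if z: "z \<in> C" for z
  proof -
    obtain i where i: "i \<in> G" "e \<le> \<bar>z i - p i\<bar>" using far[OF z] by auto
    then have "e\<^sup>2 \<le> (z i - p i)\<^sup>2" using e by (metis abs_le_square_iff abs_of_pos)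
    also have "\<dots> \<le> D z" unfolding D_def using i(1) G by (intro member_le_sum) auto
    finally show ?thesis .
  qed
  define d where "d = (INF z\<in>C. D z)"
  have d_le: "d \<le> D z" if "z \<in> C" for z
    unfolding d_def using D_ge that by (intro cINF_lower bdd_belowI[of _ "e\<^sup>2"]) auto
  have "e\<^sup>2 \<le> d" unfolding d_def using D_ge False by (intro cINF_greatest)
  then have d: "d > 0" using e by (smt (verit) zero_less_power)
  \<comment> \<open>The sum bounds the squared distance between any two points of \<open>C\<close>;
    adding \<open>d\<close> makes \<open>R\<close> positive and at least \<open>d\<close>.\<close>
  define R where "R = (\<Sum>i\<in>G. (2 * B i)\<^sup>2) + d"
  have R: "R > 0" "d \<le> R" using d by (auto simp: R_def intro!: add_nonneg_pos sum_nonneg)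
  \<comment> \<open>With this step size the quadratic term \<open>t * R\<close> and the
    near-minimality of \<open>y\<close> contribute \<open>d / 2\<close> each to twice the linear
    term, which is thus at most \<open>d / 2\<close>. The value at \<open>p\<close> exceeds that at
    \<open>y\<close> by \<open>D y \<ge> d\<close>.\<close>
  define t where "t = d / (2 * R)"
  have t: "0 < t" "t \<le> 1" "t * R = d / 2" using R d by (auto simp: t_def field_simps)
  have "(INF z\<in>C. D z) < d + t * d / 2" using t d by (simp add: d_def[symmetric])
  then obtain y where y: "y \<in> C" "D y < d + t * d / 2"
    using False D_ge by (subst (asm) cINF_less_iff) (auto intro: bdd_belowI[of _ "e\<^sup>2"])
  define w where "w i = p i - y i" for i
  have inner: "(\<Sum>i\<in>G. w i * (z i - y i)) \<le> d / 2" if z: "z \<in> C" for z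
  proof -
    define q where "q = (\<lambda>i. t * z i + (1 - t) * y i)"
    have "q \<in> C" unfolding q_def using t by (intro convex z y(1)) auto
    then have "d \<le> D q" by (rule d_le)
    also have "D q = (\<Sum>i\<in>G. (y i - p i)\<^sup>2 - 2 * t * (w i * (z i - y i)) + t\<^sup>2 * (z i - y i)\<^sup>2)"
      unfolding D_def by (intro sum.cong) (auto simp: q_def w_def power2_eq_square algebra_simps)
    also have "\<dots> = D y - 2 * t * (\<Sum>i\<in>G. w i * (z i - y i)) + t\<^sup>2 * (\<Sum>i\<in>G. (z i - y i)\<^sup>2)"
      by (simp add: D_def sum.distrib sum_subtractf sum_distrib_left)
    finally have *: "2 * t * (\<Sum>i\<in>G. w i * (z i - y i)) \<le> t * d / 2 + t\<^sup>2 * (\<Sum>i\<in>G. (z i - y i)\<^sup>2)"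
      using y(2) by simp
    have "(\<Sum>i\<in>G. (z i - y i)\<^sup>2) \<le> R"
    proof -
      have "(z i - y i)\<^sup>2 \<le> (2 * B i)\<^sup>2" for i
        using bound[OF z, of i] bound[OF y(1), of i] by (intro abs_le_square_iff[THEN iffD1]) auto
      then show ?thesis unfolding R_def using d by (intro add_increasing2 sum_mono) auto
    qed
    then have "t\<^sup>2 * (\<Sum>i\<in>G. (z i - y i)\<^sup>2) \<le> t\<^sup>2 * R"
      by (intro mult_left_mono) auto
    also have "\<dots> = t * (d / 2)" using t(3) by (simp add: power2_eq_square)
    finally have "t * (2 * (\<Sum>i\<in>G. w i * (z i - y i))) \<le> t * d"
      using * by (simp add: algebra_simps)
    then show ?thesis using t(1) by simp
  qed
  show thesis
  proof (rule that)
    show "(\<Sum>i\<in>G. w i * z i) \<le> (\<Sum>i\<in>G. w i * y i) + d / 2" if "z \<in> C" for z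
      using inner[OF that] by (simp add: right_diff_distrib sum_subtractf)
    have "(\<Sum>i\<in>G. w i * p i) = (\<Sum>i\<in>G. w i * y i) + D y"
      unfolding D_def sum.distrib[symmetric]
      by (intro sum.cong) (auto simp: w_def power2_eq_square algebra_simps)
    then show "(\<Sum>i\<in>G. w i * y i) + d / 2 < (\<Sum>i\<in>G. w i * p i)"
      using d_le[OF y(1)] d by simp
  qed
qed

lemma abs_convex_combination_less:
  fixes a b e l :: real
  assumes "\<bar>a\<bar> < e" "\<bar>b\<bar> < e" "l \<in> {0..1}"
  shows "\<bar>l * a + (1 - l) * b\<bar> < e"
  using convex_bound_lt[of a e b l "1 - l"] convex_bound_lt[of "- a" e "- b" l "1 - l"] assms
  by (auto simp: abs_less_iff)

text \<open>Dirac measures turn the integral formula of a transfer into pointwise information about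
  its map.\<close>

lemma ext_integral_return:
  fixes f :: "'a::metric_space \<Rightarrow> ereal"
  assumes "f \<in> borel_measurable borel"
  shows "ext_integral (return borel x) f = f x"
proof -
  have [measurable]: "f \<in> borel_measurable borel" by fact
  have "ext_integral (return borel x) f = enn2ereal (e2ennreal (f x)) - enn2ereal (e2ennreal (- f x))"
    by (simp add: ext_integral_def nn_integral_return)
  also have "\<dots> = f x"
  proof (cases "f x")
    case (real r)
    then show ?thesis
      by (cases "0 \<le> r") (auto simp: e2ennreal_ereal enn2ereal_ennreal ennreal_neg zero_ennreal.rep_eq)
  qed (simp_all add: e2ennreal_neg zero_ennreal.rep_eq)
  finally show ?thesis .
qed

lemma return_prob: "return borel x \<in> prob_measures"
  by (simp add: prob_measures_def prob_space_return)

lemma integral_return_bcontfun: "(\<integral>y. apply_bcontfun g y \<partial>return borel x) = g x"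
  for g :: "'a::metric_space \<Rightarrow>\<^sub>C real"
  by (rule integral_return) (auto intro: borel_measurable_continuous_onI)

lemma transfer_indicator_prob:
  assumes subset: "S \<subseteq> prob_measures \<times> prob_measures" and "\<mu> \<in> prob_measures" "\<nu> \<in> prob_measures"
  shows "transfer_indicator S (measure \<mu>, measure \<nu>) = (if (\<mu>, \<nu>) \<in> S then 0 else \<infinity>)"
proof -
  have "(measure \<mu>, measure \<nu>) \<in> map_prod measure measure ` S \<longleftrightarrow> (\<mu>, \<nu>) \<in> S"
  proof
    assume "(measure \<mu>, measure \<nu>) \<in> map_prod measure measure ` S"
    then obtain \<mu>' \<nu>' where *: "(\<mu>', \<nu>') \<in> S" "measure \<mu> = measure \<mu>'" "measure \<nu> = measure \<nu>'"
      by auto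
    then have "\<mu>' \<in> prob_measures" "\<nu>' \<in> prob_measures" using subset by auto
    then have "\<mu> = \<mu>'" "\<nu> = \<nu>'"
      using * assms by (auto intro: measure_inject_prob)
    then show "(\<mu>, \<nu>) \<in> S" using *(1) by simp
  qed (auto intro: rev_image_eqI)
  then show ?thesis by (simp add: transfer_indicator_def)
qed

lemma transfer_SUP_upper:
  assumes subset: "S \<subseteq> prob_measures \<times> prob_measures" and \<mu>: "(\<mu>, \<sigma>) \<in> S"
  shows "ereal (\<integral>x. g x \<partial>\<sigma>)
    \<le> (SUP \<sigma>\<in>prob_measures. ereal (\<integral>x. g x \<partial>\<sigma>) - transfer_indicator S (measure \<mu>, measure \<sigma>))"
proof (rule SUP_upper2)
  show "\<sigma> \<in> prob_measures" using assms by auto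
  then show "ereal (\<integral>x. g x \<partial>\<sigma>) \<le> ereal (\<integral>x. g x \<partial>\<sigma>) - transfer_indicator S (measure \<mu>, measure \<sigma>)"
    using assms by (subst transfer_indicator_prob[OF subset]) auto
qed

lemma transfer_SUP_least:
  assumes subset: "S \<subseteq> prob_measures \<times> prob_measures" and \<mu>: "\<mu> \<in> prob_measures"
    and le: "\<And>\<sigma>. (\<mu>, \<sigma>) \<in> S \<Longrightarrow> (\<integral>x. g x \<partial>\<sigma>) \<le> b"
  shows "(SUP \<sigma>\<in>prob_measures. ereal (\<integral>x. g x \<partial>\<sigma>) - transfer_indicator S (measure \<mu>, measure \<sigma>)) \<le> ereal b"
  using le by (intro SUP_least) (simp add: transfer_indicator_prob[OF subset \<mu>])

section \<open>From transfer sets to idempotent envelopes\<close>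

locale transfer_set =
  fixes S :: "('a::metric_space measure \<times> 'a measure) set"
  assumes compact_space: "compact (UNIV :: 'a set)"
    and subset: "S \<subseteq> prob_measures \<times> prob_measures"
    and transfer: "backward_transfer_set S"
    and trans: "trans S"
    and diagonal: "Id_on prob_measures \<subseteq> S"
begin

lemmas transfer_indicator_measure = transfer_indicator_prob[OF subset]

lemma S_convex:
  assumes S: "(\<mu>, \<nu>) \<in> S" "(\<mu>', \<nu>') \<in> S" and l: "l \<in> {0..1 :: real}"
  obtains \<rho> \<tau> where "(\<rho>, \<tau>) \<in> S"
    "\<And>g. (\<integral>x. apply_bcontfun g x \<partial>\<rho>) = l * (\<integral>x. apply_bcontfun g x \<partial>\<mu>) + (1 - l) * (\<integral>x. apply_bcontfun g x \<partial>\<mu>')"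
    "\<And>g. (\<integral>x. apply_bcontfun g x \<partial>\<tau>) = l * (\<integral>x. apply_bcontfun g x \<partial>\<nu>) + (1 - l) * (\<integral>x. apply_bcontfun g x \<partial>\<nu>')"
proof -
  have P: "\<mu> \<in> prob_measures" "\<nu> \<in> prob_measures" "\<mu>' \<in> prob_measures" "\<nu>' \<in> prob_measures"
    using S subset by auto
  obtain \<rho> where \<rho>: "\<rho> \<in> prob_measures" "measure \<rho> = (\<lambda>A. l * measure \<mu> A + (1 - l) * measure \<mu>' A)"
    "\<And>g. (\<integral>x. apply_bcontfun g x \<partial>\<rho>) = l * (\<integral>x. apply_bcontfun g x \<partial>\<mu>) + (1 - l) * (\<integral>x. apply_bcontfun g x \<partial>\<mu>')"
    using prob_measure_convex_combination[OF compact_space P(1,3) l] by blast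
  obtain \<tau> where \<tau>: "\<tau> \<in> prob_measures" "measure \<tau> = (\<lambda>A. l * measure \<nu> A + (1 - l) * measure \<nu>' A)"
    "\<And>g. (\<integral>x. apply_bcontfun g x \<partial>\<tau>) = l * (\<integral>x. apply_bcontfun g x \<partial>\<nu>) + (1 - l) * (\<integral>x. apply_bcontfun g x \<partial>\<nu>')"
    using prob_measure_convex_combination[OF compact_space P(2,4) l] by blast
  have "convex_functional (transfer_indicator S)"
    using transfer by (simp add: backward_transfer_set_def backward_linear_transfer_def)
  then have "transfer_indicator S (measure \<rho>, measure \<tau>)
      \<le> ereal l * transfer_indicator S (measure \<mu>, measure \<nu>) + ereal (1 - l) * transfer_indicator S (measure \<mu>', measure \<nu>')"
    unfolding convex_functional_def \<rho>(2) \<tau>(2) using P l by (blast intro: measure_in_signed_measures)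
  then have "(\<rho>, \<tau>) \<in> S"
    using S P \<rho>(1) \<tau>(1) by (simp add: transfer_indicator_measure split: if_splits)
  then show thesis using that \<rho>(3) \<tau>(3) by blast
qed

text \<open>Only the second marginal is separated linearly; the first is merely kept near
  \<open>\<mu>\<close> on finitely many functions. So \<open>S_iff\<close> can fix it at
  \<open>\<mu>\<close>, and \<open>usc_upper\<close> can vary it over Dirac measures at nearby
  points.\<close>

lemma separation:
  assumes P: "\<mu> \<in> prob_measures" "\<nu> \<in> prob_measures" and nS: "(\<mu>, \<nu>) \<notin> S"
  obtains E :: "('a \<Rightarrow>\<^sub>C real) set" and e c and g :: "'a \<Rightarrow>\<^sub>C real" where "finite E" "e > 0" "c < (\<integral>x. g x \<partial>\<nu>)"
    "\<And>\<mu>' \<nu>'. (\<mu>', \<nu>') \<in> S \<Longrightarrow> (\<And>f. f \<in> E \<Longrightarrow> \<bar>(\<integral>x. apply_bcontfun f x \<partial>\<mu>') - (\<integral>x. f x \<partial>\<mu>)\<bar> < e) \<Longrightarrow>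
       (\<integral>x. g x \<partial>\<nu>') \<le> c"
proof -
  define K where "K = {p \<in> signed_measures \<times> signed_measures. transfer_indicator S p \<le> ereal 0}"
  have "closedin (prod_topology weak_star weak_star) K"
    using transfer unfolding K_def backward_transfer_set_def backward_linear_transfer_def weak_star_lsc_def by blast
  then have "openin (prod_topology weak_star weak_star) (signed_measures \<times> signed_measures - K)"
    by (simp add: closedin_def topspace_weak_star)
  moreover have "(measure \<mu>, measure \<nu>) \<in> signed_measures \<times> signed_measures - K"
    using P nS by (simp add: K_def transfer_indicator_measure measure_in_signed_measures)
  ultimately have "\<exists>U V. openin weak_star U \<and> openin weak_star V \<and> measure \<mu> \<in> U \<and> measure \<nu> \<in> V \<and>
      U \<times> V \<subseteq> signed_measures \<times> signed_measures - K"
    unfolding openin_prod_topology_alt by (elim allE impE)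
  then obtain U V where UV: "openin weak_star U" "openin weak_star V" "measure \<mu> \<in> U" "measure \<nu> \<in> V"
    "U \<times> V \<subseteq> signed_measures \<times> signed_measures - K"
    by (elim exE conjE)
  obtain E :: "('a \<Rightarrow>\<^sub>C real) set" and e where E: "finite E" "e > 0"
    "\<And>n. n \<in> signed_measures \<Longrightarrow> (\<And>g. g \<in> E \<Longrightarrow> \<bar>signed_integral n (apply_bcontfun g) - signed_integral (measure \<mu>) g\<bar> < e) \<Longrightarrow> n \<in> U"
    using weak_star_neighbourhood[OF UV(1,3)] by blast
  obtain G :: "('a \<Rightarrow>\<^sub>C real) set" and d where G: "finite G" "d > 0"
    "\<And>n. n \<in> signed_measures \<Longrightarrow> (\<And>g. g \<in> G \<Longrightarrow> \<bar>signed_integral n (apply_bcontfun g) - signed_integral (measure \<nu>) g\<bar> < d) \<Longrightarrow> n \<in> V"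
    using weak_star_neighbourhood[OF UV(2,4)] by blast
  define near where "near \<mu>' \<longleftrightarrow> (\<forall>f\<in>E. \<bar>(\<integral>x. apply_bcontfun f x \<partial>\<mu>') - (\<integral>x. f x \<partial>\<mu>)\<bar> < e)" for \<mu>'
  define I where "I \<nu>' = (\<lambda>g :: 'a \<Rightarrow>\<^sub>C real. \<integral>x. apply_bcontfun g x \<partial>\<nu>')" for \<nu>' :: "'a measure"
  \<comment> \<open>Nearness to \<open>\<mu>\<close> is a convex condition, so \<open>C\<close> is
    convex. It stays away from \<open>I \<nu>\<close> on \<open>G\<close> because
    \<open>U \<times> V\<close> misses \<open>K\<close>.\<close>
  define C where "C = {I \<nu>' |\<mu>' \<nu>'. (\<mu>', \<nu>') \<in> S \<and> near \<mu>'}"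
  have abs_bound: "\<bar>I \<nu>' g\<bar> \<le> norm g" if "\<nu>' \<in> prob_measures" for \<nu>' g
  proof -
    have *: "g x \<le> norm g" "(- g) x \<le> norm g" for x
      using norm_bounded[of g x] by (auto simp: abs_le_iff)
    show ?thesis
      using integral_le_const[OF that *(1)] integral_le_const[OF that *(2)] by (simp add: I_def)
  qed
  obtain w c where wc: "\<And>z. z \<in> C \<Longrightarrow> (\<Sum>g\<in>G. w g * z g) \<le> c" "c < (\<Sum>g\<in>G. w g * I \<nu> g)"
  proof (rule finite_dimensional_separation[OF G(1,2), of C norm "I \<nu>"])
    show "(\<lambda>i. l * y i + (1 - l) * z i) \<in> C" if yz: "y \<in> C" "z \<in> C" "l \<in> {0..1}" for y z l
    proof -
      obtain \<mu>1 \<nu>1 \<mu>2 \<nu>2 where *: "(\<mu>1, \<nu>1) \<in> S" "near \<mu>1" "y = I \<nu>1" "(\<mu>2, \<nu>2) \<in> S" "near \<mu>2" "z = I \<nu>2"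
        using yz by (auto simp: C_def)
      obtain \<rho> \<tau> where \<rho>: "(\<rho>, \<tau>) \<in> S"
        "\<And>g. (\<integral>x. apply_bcontfun g x \<partial>\<rho>) = l * (\<integral>x. apply_bcontfun g x \<partial>\<mu>1) + (1 - l) * (\<integral>x. apply_bcontfun g x \<partial>\<mu>2)"
        "\<And>g. (\<integral>x. apply_bcontfun g x \<partial>\<tau>) = l * (\<integral>x. apply_bcontfun g x \<partial>\<nu>1) + (1 - l) * (\<integral>x. apply_bcontfun g x \<partial>\<nu>2)"
        using S_convex[OF *(1,4) yz(3)] by blast
      have "near \<rho>"
        unfolding near_def
      proof
        fix f assume f: "f \<in> E"
        have "(\<integral>x. f x \<partial>\<rho>) - (\<integral>x. f x \<partial>\<mu>)
            = l * ((\<integral>x. f x \<partial>\<mu>1) - (\<integral>x. f x \<partial>\<mu>)) + (1 - l) * ((\<integral>x. f x \<partial>\<mu>2) - (\<integral>x. f x \<partial>\<mu>))"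
          by (simp add: \<rho>(2) algebra_simps)
        also have "\<bar>\<dots>\<bar> < e"
          using *(2,5) f yz(3) unfolding near_def by (intro abs_convex_combination_less) auto
        finally show "\<bar>(\<integral>x. f x \<partial>\<rho>) - (\<integral>x. f x \<partial>\<mu>)\<bar> < e" .
      qed
      moreover have "(\<lambda>i. l * y i + (1 - l) * z i) = I \<tau>"
        by (simp add: *(3,6) I_def \<rho>(3))
      ultimately show ?thesis using \<rho>(1) by (auto simp: C_def)
    qed
    show "\<bar>z g\<bar> \<le> norm g" if "z \<in> C" for z g
      using that subset abs_bound by (auto simp: C_def)
    show "\<exists>g\<in>G. d \<le> \<bar>z g - I \<nu> g\<bar>" if z: "z \<in> C" for z
    proof (rule ccontr)
      assume far: "\<not> ?thesis"
      obtain \<mu>' \<nu>' where *: "(\<mu>', \<nu>') \<in> S" "near \<mu>'" "z = I \<nu>'"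
        using z by (auto simp: C_def)
      have P': "\<mu>' \<in> prob_measures" "\<nu>' \<in> prob_measures" using *(1) subset by auto
      have "measure \<mu>' \<in> U"
        using *(2) P P' by (intro E(3)) (auto simp: near_def signed_integral_measure measure_in_signed_measures)
      moreover have "measure \<nu>' \<in> V"
        using far P P' by (intro G(3)) (auto simp: *(3) I_def signed_integral_measure measure_in_signed_measures not_le)
      ultimately have "(measure \<mu>', measure \<nu>') \<notin> K" using UV(5) by auto
      moreover have "(measure \<mu>', measure \<nu>') \<in> K"
        using *(1) P' by (simp add: K_def transfer_indicator_measure measure_in_signed_measures)
      ultimately show False by blast
    qed
  qed blast
  define g where "g = (\<Sum>h\<in>G. w h *\<^sub>R h)"
  have g: "(\<integral>x. g x \<partial>\<sigma>) = (\<Sum>h\<in>G. w h * I \<sigma> h)" if "\<sigma> \<in> prob_measures" for \<sigma>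
  proof -
    have "apply_bcontfun (\<Sum>h\<in>F. w h *\<^sub>R h) x = (\<Sum>h\<in>F. w h * h x)" if "finite F" for F :: "('a \<Rightarrow>\<^sub>C real) set" and x
      using that by induction auto
    then have "(\<integral>x. g x \<partial>\<sigma>) = (\<integral>x. (\<Sum>h\<in>G. w h * h x) \<partial>\<sigma>)" using G(1) by (simp add: g_def)
    also have "\<dots> = (\<Sum>h\<in>G. w h * I \<sigma> h)"
      using integrable_prob_bcontfun[OF that] by (subst Bochner_Integration.integral_sum) (auto simp: I_def)
    finally show ?thesis .
  qed
  show thesis
  proof (rule that[OF E(1,2), of c g])
    show "c < (\<integral>x. g x \<partial>\<nu>)" using wc(2) g[OF P(2)] by simp
    show "(\<integral>x. g x \<partial>\<nu>') \<le> c"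
      if "(\<mu>', \<nu>') \<in> S" "\<And>f. f \<in> E \<Longrightarrow> \<bar>(\<integral>x. apply_bcontfun f x \<partial>\<mu>') - (\<integral>x. f x \<partial>\<mu>)\<bar> < e" for \<mu>' \<nu>'
    proof -
      have "I \<nu>' \<in> C" using that by (auto simp: C_def near_def)
      then show ?thesis using wc(1) g[of \<nu>'] that(1) subset by auto
    qed
  qed
qed

end

context transfer_set
begin

lemma diagonal_in: "\<mu> \<in> prob_measures \<Longrightarrow> (\<mu>, \<mu>) \<in> S"
  using diagonal by (auto simp: Id_on_def)

definition upper :: "('a \<Rightarrow>\<^sub>C real) \<Rightarrow> 'a \<Rightarrow> real" where
  "upper g x = (SUP \<sigma>\<in>{\<sigma>. (return borel x, \<sigma>) \<in> S}. \<integral>y. g y \<partial>\<sigma>)"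

lemma upper_ge:
  assumes "(return borel x, \<sigma>) \<in> S"
  shows "(\<integral>y. apply_bcontfun g y \<partial>\<sigma>) \<le> upper g x"
  unfolding upper_def
proof (rule cSUP_upper)
  show "bdd_above ((\<lambda>\<sigma>. \<integral>y. g y \<partial>\<sigma>) ` {\<sigma>. (return borel x, \<sigma>) \<in> S})"
  proof (rule bdd_aboveI[of _ "norm g"])
    fix r assume "r \<in> (\<lambda>\<sigma>. \<integral>y. g y \<partial>\<sigma>) ` {\<sigma>. (return borel x, \<sigma>) \<in> S}"
    then obtain \<tau> where "\<tau> \<in> prob_measures" "r = (\<integral>y. g y \<partial>\<tau>)" using subset by auto
    moreover have "g y \<le> norm g" for y using norm_bounded[of g y] by simp
    ultimately show "r \<le> norm g" using integral_le_const by auto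
  qed
qed (use assms in simp)

lemma upper_le: "(\<And>\<sigma>. (return borel x, \<sigma>) \<in> S \<Longrightarrow> (\<integral>y. apply_bcontfun g y \<partial>\<sigma>) \<le> b) \<Longrightarrow> upper g x \<le> b"
  unfolding upper_def using diagonal_in[OF return_prob] by (intro cSUP_least) auto

lemma upper_extensive: "apply_bcontfun g x \<le> upper g x"
  using upper_ge[OF diagonal_in[OF return_prob], of x g] by (simp add: integral_return_bcontfun)

lemma upper_le_const: "(\<And>x. apply_bcontfun g x \<le> c) \<Longrightarrow> upper g x \<le> c"
  using subset by (intro upper_le integral_le_const) auto

lemma upper_bound: "\<bar>upper g x\<bar> \<le> norm g"
proof -
  have g: "\<bar>g x\<bar> \<le> norm g" for x using norm_bounded[of g x] by simp
  then have "upper g x \<le> norm g" by (intro upper_le_const) (simp add: abs_le_iff)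
  then show ?thesis using g[of x] upper_extensive[of g x] by linarith
qed

text \<open>Dirac measures force the map of the transfer to be \<open>upper\<close>. The transfer
  formula then says, for every \<open>\<mu>\<close>, that the integral of \<open>upper g\<close> is
  the supremum of \<open>\<integral>g d\<sigma>\<close> over the section of \<open>S\<close> at
  \<open>\<mu>\<close>. Measurability is inherited from the map, before semicontinuity is
  known.\<close>

lemma upper_integral:
  obtains "upper g \<in> borel_measurable borel"
    and "\<And>\<mu> \<sigma>. (\<mu>, \<sigma>) \<in> S \<Longrightarrow> (\<integral>x. g x \<partial>\<sigma>) \<le> (\<integral>x. upper g x \<partial>\<mu>)"
    and "\<And>\<mu> b. \<mu> \<in> prob_measures \<Longrightarrow> (\<And>\<sigma>. (\<mu>, \<sigma>) \<in> S \<Longrightarrow> (\<integral>x. g x \<partial>\<sigma>) \<le> b) \<Longrightarrow> (\<integral>x. upper g x \<partial>\<mu>) \<le> b"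
proof -
  obtain U :: "('a \<Rightarrow>\<^sub>C real) \<Rightarrow> 'a \<Rightarrow> ereal" where
    U: "\<And>g. U g \<in> borel_measurable borel"
      "\<And>\<mu> g. \<mu> \<in> prob_measures \<Longrightarrow>
         (SUP \<sigma>\<in>prob_measures. ereal (\<integral>x. apply_bcontfun g x \<partial>\<sigma>) - transfer_indicator S (measure \<mu>, measure \<sigma>))
           = ext_integral \<mu> (U g)"
    using transfer unfolding backward_transfer_set_def backward_linear_transfer_def by blast
  have ge: "ereal (\<integral>x. g x \<partial>\<sigma>) \<le> ext_integral \<mu> (U g)" if "(\<mu>, \<sigma>) \<in> S" for \<mu> \<sigma>
  proof -
    have "\<mu> \<in> prob_measures" using that subset by auto
    then show ?thesis
      unfolding U(2)[OF \<open>\<mu> \<in> prob_measures\<close>, symmetric] by (intro transfer_SUP_upper[OF subset that])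
  qed
  have le: "ext_integral \<mu> (U g) \<le> ereal b"
    if "\<mu> \<in> prob_measures" "\<And>\<sigma>. (\<mu>, \<sigma>) \<in> S \<Longrightarrow> (\<integral>x. g x \<partial>\<sigma>) \<le> b" for \<mu> b
    unfolding U(2)[OF that(1), symmetric] by (rule transfer_SUP_least[OF subset that])
  have Ug: "U g x = ereal (upper g x)" for x
  proof -
    have eq: "ext_integral (return borel x) (U g) = U g x"
      by (rule ext_integral_return[OF U(1)])
    have "U g x \<le> ereal (upper g x)"
      unfolding eq[symmetric] using upper_ge by (intro le return_prob)
    moreover have "ereal (upper g x) \<le> U g x"
    proof (cases "U g x")
      case (real r)
      then have "upper g x \<le> r"
        using ge[of "return borel x"] by (intro upper_le) (simp add: eq)
      then show ?thesis using real by simp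
    next
      \<comment> \<open>Excluded because the diagonal makes the section of \<open>S\<close> at the
        Dirac measure nonempty.\<close>
      case MInf
      then show ?thesis using ge[OF diagonal_in[OF return_prob], of x] by (simp add: eq)
    qed simp
    ultimately show ?thesis by (rule antisym)
  qed
  have "upper g = (\<lambda>x. real_of_ereal (U g x))" by (simp add: Ug)
  then have meas: "upper g \<in> borel_measurable borel"
    using borel_measurable_real_of_ereal[OF U(1)] by simp
  have ext: "ext_integral \<mu> (U g) = ereal (\<integral>x. upper g x \<partial>\<mu>)" if "\<mu> \<in> prob_measures" for \<mu>
  proof -
    interpret prob_space \<mu> by (rule prob_measuresD[OF that])
    have "upper g \<in> borel_measurable \<mu>"
      using meas measurable_cong_sets[OF prob_measuresD(3)[OF that] refl, of borel] by auto
    then have "integrable \<mu> (upper g)"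
      by (intro integrable_const_bound[of _ "norm g"]) (auto simp: upper_bound)
    then show ?thesis
      using ext_integral_ereal[of \<mu> "upper g"] Ug by (simp add: fun_eq_iff[symmetric]) (metis ext)
  qed
  show thesis
  proof (rule that[OF meas])
    show "(\<integral>x. g x \<partial>\<sigma>) \<le> (\<integral>x. upper g x \<partial>\<mu>)" if "(\<mu>, \<sigma>) \<in> S" for \<mu> \<sigma>
      using ge[OF that] ext[of \<mu>] that subset by auto
    show "(\<integral>x. upper g x \<partial>\<mu>) \<le> b"
      if "\<mu> \<in> prob_measures" "\<And>\<sigma>. (\<mu>, \<sigma>) \<in> S \<Longrightarrow> (\<integral>x. g x \<partial>\<sigma>) \<le> b" for \<mu> b
      using le[OF that] ext[OF that(1)] by simp
  qed
qed

text \<open>For a pair outside \<open>S\<close>, separation bounds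
  \<open>\<integral>g d\<sigma>\<close> over the section at \<open>\<mu>\<close> by some
  \<open>c < \<integral>g d\<nu>\<close>, and \<open>upper_integral\<close> transfers this bound to
  \<open>upper g\<close>.\<close>

lemma S_iff:
  assumes P: "\<mu> \<in> prob_measures" "\<nu> \<in> prob_measures"
  shows "(\<mu>, \<nu>) \<in> S \<longleftrightarrow> (\<forall>g. (\<integral>x. apply_bcontfun g x \<partial>\<nu>) \<le> (\<integral>x. upper g x \<partial>\<mu>))"
proof
  assume "(\<mu>, \<nu>) \<in> S"
  then show "\<forall>g. (\<integral>x. apply_bcontfun g x \<partial>\<nu>) \<le> (\<integral>x. upper g x \<partial>\<mu>)"
    using upper_integral by metis
next
  assume le: "\<forall>g. (\<integral>x. apply_bcontfun g x \<partial>\<nu>) \<le> (\<integral>x. upper g x \<partial>\<mu>)"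
  show "(\<mu>, \<nu>) \<in> S"
  proof (rule ccontr)
    assume "(\<mu>, \<nu>) \<notin> S"
    then obtain E :: "('a \<Rightarrow>\<^sub>C real) set" and e c and g :: "'a \<Rightarrow>\<^sub>C real" where
      *: "e > 0" "c < (\<integral>x. g x \<partial>\<nu>)"
      "\<And>\<mu>' \<nu>'. (\<mu>', \<nu>') \<in> S \<Longrightarrow> (\<And>f. f \<in> E \<Longrightarrow> \<bar>(\<integral>x. apply_bcontfun f x \<partial>\<mu>') - (\<integral>x. f x \<partial>\<mu>)\<bar> < e) \<Longrightarrow>
         (\<integral>x. g x \<partial>\<nu>') \<le> c"
      using separation[OF P] by metis
    have "(\<integral>x. upper g x \<partial>\<mu>) \<le> c"
      by (rule upper_integral[of g]) (use P *(1,3) in auto)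
    then show False using le *(2) by (meson leD order.trans)
  qed
qed

lemma upper_add_le: "upper (f + g) x \<le> upper f x + upper g x"
proof (rule upper_le)
  fix \<sigma> assume S: "(return borel x, \<sigma>) \<in> S"
  then have "\<sigma> \<in> prob_measures" using subset by auto
  then show "(\<integral>y. (f + g) y \<partial>\<sigma>) \<le> upper f x + upper g x"
    using upper_ge[OF S, of f] upper_ge[OF S, of g] by (simp add: integrable_prob_bcontfun)
qed

lemma upper_scale:
  assumes "0 \<le> c"
  shows "upper (c *\<^sub>R f) x = c * upper f x"
proof -
  have le: "upper (c *\<^sub>R f) x \<le> c * upper f x" if "0 \<le> c" for c f
    by (rule upper_le) (use upper_ge that in \<open>auto intro: mult_left_mono\<close>)
  show ?thesis
  proof (cases "c = 0")
    case True
    then show ?thesis using upper_bound[of 0 x] by simp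
  next
    case False
    then have "upper f x \<le> (1 / c) * upper (c *\<^sub>R f) x"
      using le[of "1 / c" "c *\<^sub>R f"] assms by simp
    then show ?thesis using le[OF assms, of f] False assms by (simp add: field_simps)
  qed
qed

lemma upper_mono: "(\<And>x. apply_bcontfun f x \<le> apply_bcontfun g x) \<Longrightarrow> upper f x \<le> upper g x"
proof (rule upper_le)
  fix \<sigma> assume fg: "\<And>x. apply_bcontfun f x \<le> apply_bcontfun g x" and S: "(return borel x, \<sigma>) \<in> S"
  then have "(\<integral>y. f y \<partial>\<sigma>) \<le> (\<integral>y. g y \<partial>\<sigma>)"
    using subset by (intro integral_mono integrable_prob_bcontfun) auto
  then show "(\<integral>y. f y \<partial>\<sigma>) \<le> upper g x" using upper_ge[OF S, of g] by simp
qed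

lemma upper_const: "upper (const_bcontfun c) x = c"
  using upper_le_const[of "const_bcontfun c" c x] upper_extensive[of "const_bcontfun c" x] by simp

text \<open>A limit of maximizers at nearby points would be natural here. Its role is played by a
  measure \<open>\<sigma>\<close> below the upper-limit functional \<open>p\<close>; separation
  shows that \<open>\<sigma>\<close> belongs to the section of \<open>S\<close> at \<open>x\<close>,
  which contradicts the small value of \<open>upper g x\<close>.\<close>

lemma usc_upper: "usc (upper g)"
  unfolding usc_def open_dist
proof (intro allI ballI)
  fix a x assume "x \<in> {x. upper g x < a}"
  then have less: "upper g x < a" by simp
  show "\<exists>d>0. \<forall>y. dist y x < d \<longrightarrow> y \<in> {x. upper g x < a}"
  proof (rule ccontr)
    assume "\<not> ?thesis"
    have far: "\<exists>y. dist y x < d \<and> a \<le> upper g y" if "d > 0" for d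
      using \<open>\<not> _\<close> that by (simp add: not_less) (metis not_le)
    define s where "s f d = (SUP y\<in>ball x d. upper f y)" for f and d :: real
    have s_ge: "upper f y \<le> s f d" if "dist y x < d" for f d y
      unfolding s_def using that upper_bound[of f]
      by (intro cSUP_upper bdd_aboveI[of _ "norm f"]) (auto simp: abs_le_iff dist_commute)
    have s_le: "s f d \<le> c" if "d > 0" "\<And>y. dist y x < d \<Longrightarrow> upper f y \<le> c" for f d c
      unfolding s_def using that by (intro cSUP_least) (auto simp: dist_commute)
    \<comment> \<open>The upper limit of \<open>upper f\<close> at \<open>x\<close>, with
      \<open>x\<close> itself included in the balls.\<close>
    define p where "p f = (INF d\<in>{0<..}. s f d)" for f
    have bdd: "bdd_below (s f ` {0<..})" for f
    proof (rule bdd_belowI[of _ "upper f x"])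
      fix r assume "r \<in> s f ` {0<..}"
      then show "upper f x \<le> r" using s_ge[of x] by auto
    qed
    have p_le: "p f \<le> s f d" if "d > 0" for f d
      unfolding p_def using that by (intro cINF_lower bdd) auto
    have p_ge: "c \<le> p f" if "\<And>d. d > 0 \<Longrightarrow> c \<le> s f d" for f c
      unfolding p_def using that by (intro cINF_greatest) auto
    have p_const: "p f \<le> c" if "\<And>x. apply_bcontfun f x \<le> c" for f c
      using p_le[of 1 f] s_le[of 1 f c] upper_le_const[OF that] by simp
    have p_sub: "sublinear p"
    proof (rule sublinearI)
      fix f h
      have *: "p (f + h) \<le> s f d + s h d'" if "d > 0" "d' > 0" for d d'
      proof -
        have "s (f + h) (min d d') \<le> s f d + s h d'"
          using that s_ge by (intro s_le) (auto intro!: order.trans[OF upper_add_le] add_mono)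
        then show ?thesis using p_le[of "min d d'" "f + h"] that by simp
      qed
      have "p (f + h) - s f d \<le> p h" if "d > 0" for d
        by (rule p_ge) (use *[OF that] in \<open>simp add: algebra_simps\<close>)
      then have "p (f + h) - p h \<le> p f"
        by (intro p_ge) (simp add: algebra_simps)
      then show "p (f + h) \<le> p f + p h" by simp
    next
      fix c :: real and f assume c: "0 \<le> c"
      show "p (c *\<^sub>R f) \<le> c * p f"
      proof (cases "c = 0")
        case True
        then show ?thesis using p_const[of 0 0] by simp
      next
        case False
        then have c0: "c > 0" using c by simp
        have "p (c *\<^sub>R f) / c \<le> p f"
        proof (rule p_ge)
          fix d :: real assume d: "d > 0"
          have "s (c *\<^sub>R f) d \<le> c * s f d"
            using d c s_ge by (intro s_le) (auto simp: upper_scale intro: mult_left_mono)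
          then show "p (c *\<^sub>R f) / c \<le> s f d"
            using p_le[OF d, of "c *\<^sub>R f"] c0 by (simp add: field_simps)
        qed
        then show ?thesis using c0 by (simp add: field_simps)
      qed
    qed
    have "a \<le> p g"
    proof (rule p_ge)
      fix d :: real assume "d > 0"
      then obtain y where "dist y x < d" "a \<le> upper g y" using far by blast
      then show "a \<le> s g d" using s_ge[of y d g] by simp
    qed
    then obtain \<sigma> where \<sigma>: "\<sigma> \<in> prob_measures" "\<And>f. (\<integral>x. apply_bcontfun f x \<partial>\<sigma>) \<le> p f" "a \<le> (\<integral>x. g x \<partial>\<sigma>)"
      using prob_measure_between[OF compact_space p_sub p_const, of "{g}" a] by auto
    \<comment> \<open>Dirac measures at points near \<open>x\<close> agree on \<open>E\<close> up to
      \<open>e\<close> with the one at \<open>x\<close>. A separating \<open>f\<close> would thus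
      satisfy \<open>upper f \<le> c\<close> on a ball, hence
      \<open>p f \<le> c < \<integral>f d\<sigma>\<close>.\<close>
    have "(return borel x, \<sigma>) \<in> S"
    proof (rule ccontr)
      assume "(return borel x, \<sigma>) \<notin> S"
      then obtain E :: "('a \<Rightarrow>\<^sub>C real) set" and e c and f :: "'a \<Rightarrow>\<^sub>C real" where
        E: "finite E" "e > 0" "c < (\<integral>x. f x \<partial>\<sigma>)"
        "\<And>\<mu>' \<nu>'. (\<mu>', \<nu>') \<in> S \<Longrightarrow>
           (\<And>h. h \<in> E \<Longrightarrow> \<bar>(\<integral>x. apply_bcontfun h x \<partial>\<mu>') - (\<integral>y. h y \<partial>return borel x)\<bar> < e) \<Longrightarrow>
           (\<integral>x. f x \<partial>\<nu>') \<le> c"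
        using separation[OF return_prob \<sigma>(1)] by metis
      have "open (\<Inter>h\<in>E. {y. \<bar>apply_bcontfun h y - h x\<bar> < e})"
        using E(1) by (intro open_INT ballI open_Collect_less continuous_intros) auto
      moreover have "x \<in> (\<Inter>h\<in>E. {y. \<bar>apply_bcontfun h y - h x\<bar> < e})" using E(2) by auto
      ultimately obtain d where d: "d > 0" "\<And>y. dist y x < d \<Longrightarrow> y \<in> (\<Inter>h\<in>E. {y. \<bar>apply_bcontfun h y - h x\<bar> < e})"
        unfolding open_dist by meson
      have "upper f y \<le> c" if "dist y x < d" for y
        using d(2)[OF that] by (intro upper_le E(4)) (auto simp: integral_return_bcontfun)
      then have "p f \<le> c" using s_le[OF d(1)] p_le[OF d(1), of f] by force
      then show False using \<sigma>(2)[of f] E(3) by simp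
    qed
    then show False using upper_ge[of x \<sigma> g] \<sigma>(3) less by simp
  qed
qed

sublocale envelope_operator upper
  by (rule envelope_operator.intro[OF compact_space upper_add_le upper_scale upper_mono upper_const
        upper_extensive usc_upper])

text \<open>A failure by \<open>e\<close> at \<open>x\<close> concerns all continuous majorants of
  \<open>upper f\<close> at once, and these form a convex set. One \<open>\<sigma>\<close> in the
  section at \<open>x\<close> then gives each of them an integral of at least
  \<open>upper f x + e\<close>. Transitivity bounds the integral of \<open>upper f\<close> by
  \<open>upper f x\<close>, and a majorant with nearly this integral contradicts the first
  bound.\<close>

sublocale idempotent_envelope upper
proof
  fix e :: real and f x assume e: "0 < e"
  show "\<exists>h. (\<forall>y. upper f y \<le> apply_bcontfun h y) \<and> upper h x < upper f x + e"
  proof (rule ccontr)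
    assume no: "\<not> ?thesis"
    define H where "H = {h. \<forall>y. upper f y \<le> apply_bcontfun h y}"
    have p: "sublinear (\<lambda>f. upper f x)"
      by (rule sublinearI) (simp_all add: add_le scale)
    have H: "convex H"
      unfolding convex_def
    proof (intro ballI allI impI)
      fix h k and a b :: real assume *: "h \<in> H" "k \<in> H" "0 \<le> a" "0 \<le> b" "a + b = 1"
      have "upper f y \<le> a * h y + b * k y" for y
      proof -
        have "upper f y = a * upper f y + b * upper f y" using *(5) by (simp flip: distrib_right)
        also have "\<dots> \<le> a * h y + b * k y"
          using * by (intro add_mono mult_left_mono) (auto simp: H_def)
        finally show ?thesis .
      qed
      then show "a *\<^sub>R h + b *\<^sub>R k \<in> H" by (simp add: H_def)
    qed
    have "const_bcontfun (norm f) \<in> H"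
      using bound[of f] by (auto simp: H_def abs_le_iff)
    then have ne: "H \<noteq> {}" by auto
    have ge: "upper f x + e \<le> upper h x" if "h \<in> H" for h
      using no that by (auto simp: H_def not_less)
    obtain \<sigma> where \<sigma>: "\<sigma> \<in> prob_measures" "\<And>k. (\<integral>y. apply_bcontfun k y \<partial>\<sigma>) \<le> upper k x"
      "\<And>h. h \<in> H \<Longrightarrow> upper f x + e \<le> (\<integral>y. apply_bcontfun h y \<partial>\<sigma>)"
      using prob_measure_between[OF compact_space p le_const H ne ge] by blast
    have "(\<integral>y. upper k y \<partial>return borel x) = upper k x" for k
      using usc_measurable[OF usc_upper] by (intro integral_return) auto
    then have S: "(return borel x, \<sigma>) \<in> S"
      using \<sigma>(2) by (subst S_iff[OF return_prob \<sigma>(1)]) simp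
    \<comment> \<open>By transitivity every measure in the section at \<open>\<sigma>\<close> lies
      in the section at \<open>x\<close>, so its integral of \<open>f\<close> is at most
      \<open>upper f x\<close>.\<close>
    have "(\<integral>y. upper f y \<partial>\<sigma>) \<le> upper f x"
    proof (rule upper_integral[of f])
      assume "\<And>\<mu> b. \<mu> \<in> prob_measures \<Longrightarrow> (\<And>\<sigma>. (\<mu>, \<sigma>) \<in> S \<Longrightarrow> (\<integral>x. f x \<partial>\<sigma>) \<le> b) \<Longrightarrow> (\<integral>x. upper f x \<partial>\<mu>) \<le> b"
      then show ?thesis
        using \<sigma>(1) upper_ge transD[OF trans S] by blast
    qed
    moreover obtain h :: "'a \<Rightarrow>\<^sub>C real" where h: "\<And>y. upper f y < h y" "(\<integral>y. h y \<partial>\<sigma>) < (\<integral>y. upper f y \<partial>\<sigma>) + e"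
      using usc_integral_approx[OF compact_space usc bound \<sigma>(1) e] by blast
    moreover have "upper f x + e \<le> (\<integral>y. h y \<partial>\<sigma>)"
      using h(1) by (intro \<sigma>(3)) (simp add: H_def less_imp_le)
    ultimately show False by linarith
  qed
qed

lemma S_eq: "S = {(\<mu>, \<nu>) \<in> prob_measures \<times> prob_measures. \<forall>g. (\<integral>x. apply_bcontfun g x \<partial>\<nu>) \<le> (\<integral>x. upper g x \<partial>\<mu>)}"
  using subset S_iff by auto

end

section \<open>From balayage cones to transfer sets\<close>

lemma closedin_nonneg:
  assumes "\<And>f. f \<in> F \<Longrightarrow> continuous_map X euclideanreal f"
  shows "closedin X {p \<in> topspace X. \<forall>f\<in>F. 0 \<le> f p}"
proof -
  \<comment> \<open>Inserting \<open>topspace X\<close> gives the right intersection when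
    \<open>F\<close> is empty.\<close>
  have "closedin X (\<Inter> (insert (topspace X) ((\<lambda>f. {p \<in> topspace X. f p \<in> {0..}}) ` F)))"
    using assms closedin_continuous_map_preimage[of X euclideanreal _ "{0..}"] by (intro closedin_Inter) auto
  also have "\<Inter> (insert (topspace X) ((\<lambda>f. {p \<in> topspace X. f p \<in> {0..}}) ` F)) = {p \<in> topspace X. \<forall>f\<in>F. 0 \<le> f p}"
    by auto
  finally show ?thesis .
qed

context balayage
begin

definition order_set :: "('a measure \<times> 'a measure) set" where
  "order_set = {(\<mu>, \<nu>) \<in> prob_measures \<times> prob_measures. balayage_le A \<mu> \<nu>}"

lemma order_set_subset: "order_set \<subseteq> prob_measures \<times> prob_measures"
  by (auto simp: order_set_def)

lemma order_set_diagonal: "Id_on prob_measures \<subseteq> order_set"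
  by (auto simp: order_set_def balayage_le_def)

lemma order_set_trans: "trans order_set"
  by (rule transI) (auto simp: order_set_def balayage_le_def intro: order.trans)

lemma image_order_set_iff:
  assumes "m \<in> signed_measures" "n \<in> signed_measures"
  shows "(m, n) \<in> map_prod measure measure ` order_set \<longleftrightarrow>
    m \<in> measure ` prob_measures \<and> n \<in> measure ` prob_measures \<and>
    (\<forall>\<phi>\<in>A. signed_integral m (apply_bcontfun \<phi>) \<le> signed_integral n (apply_bcontfun \<phi>))"
  by (auto simp: order_set_def balayage_le_def signed_integral_measure image_iff)
    (metis signed_integral_measure)

lemma closedin_image_order_set:
  "closedin (prod_topology weak_star weak_star)
     {p \<in> signed_measures \<times> signed_measures. p \<in> map_prod measure measure ` order_set}"
proof -
  let ?I = "\<lambda>m (g :: 'a \<Rightarrow>\<^sub>C real). signed_integral m (apply_bcontfun g)"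
  let ?N = "{g :: 'a \<Rightarrow>\<^sub>C real. \<forall>x. 0 \<le> g x}" and ?one = "const_bcontfun 1 :: 'a \<Rightarrow>\<^sub>C real"
  \<comment> \<open>Every condition takes the form \<open>0 \<le> f p\<close>; each normalization
    becomes two opposite inequalities.\<close>
  define F where "F =
    (\<lambda>g p. ?I (fst p) g) ` ?N \<union> (\<lambda>g p. ?I (snd p) g) ` ?N \<union> (\<lambda>\<phi> p. ?I (snd p) \<phi> - ?I (fst p) \<phi>) ` A \<union>
    {\<lambda>p. ?I (fst p) ?one - 1, \<lambda>p. 1 - ?I (fst p) ?one, \<lambda>p. ?I (snd p) ?one - 1, \<lambda>p. 1 - ?I (snd p) ?one}"
  have "continuous_map (prod_topology weak_star weak_star) euclideanreal (\<lambda>p. ?I (fst p) g)"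
    "continuous_map (prod_topology weak_star weak_star) euclideanreal (\<lambda>p. ?I (snd p) g)" for g
    using continuous_map_compose[OF continuous_map_fst continuous_map_signed_integral]
      continuous_map_compose[OF continuous_map_snd continuous_map_signed_integral]
    by (auto simp: o_def)
  then have "continuous_map (prod_topology weak_star weak_star) euclideanreal f" if "f \<in> F" for f
    using that unfolding F_def by (auto simp del: const_bcontfun.rep_eq intro!: continuous_map_diff)
  then have "closedin (prod_topology weak_star weak_star)
      {p \<in> topspace (prod_topology weak_star weak_star). \<forall>f\<in>F. 0 \<le> f p}"
    by (rule closedin_nonneg)
  also have "{p \<in> topspace (prod_topology weak_star weak_star). \<forall>f\<in>F. 0 \<le> f p} =
      {p \<in> signed_measures \<times> signed_measures. p \<in> map_prod measure measure ` order_set}"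
  proof -
    have F: "(\<forall>f\<in>F. 0 \<le> f (m, n)) \<longleftrightarrow>
        (\<forall>g\<in>?N. 0 \<le> ?I m g) \<and> (\<forall>g\<in>?N. 0 \<le> ?I n g) \<and> (\<forall>\<phi>\<in>A. ?I m \<phi> \<le> ?I n \<phi>) \<and>
        ?I m ?one = 1 \<and> ?I n ?one = 1" for m n
      by (auto simp add: F_def ball_Un order_eq_iff[of _ "1 :: real"] simp del: const_bcontfun.rep_eq)
    have "(\<forall>f\<in>F. 0 \<le> f (m, n)) \<longleftrightarrow> (m, n) \<in> map_prod measure measure ` order_set"
      if "m \<in> signed_measures" "n \<in> signed_measures" for m n
      unfolding F image_order_set_iff[OF that] signed_measure_prob_iff[OF compact_space that(1)]
        signed_measure_prob_iff[OF compact_space that(2)]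
      by blast
    then show ?thesis by (auto simp: topspace_weak_star)
  qed
  finally show ?thesis .
qed

lemma backward_transfer_set_order_set: "backward_transfer_set order_set"
  unfolding backward_transfer_set_def backward_linear_transfer_def
proof (intro conjI)
  note indicator = transfer_indicator_prob[OF order_set_subset]
  have diag: "(\<mu>, \<mu>) \<in> order_set" if "\<mu> \<in> prob_measures" for \<mu>
    using that order_set_diagonal by auto
  show "proper_functional (transfer_indicator order_set)"
    unfolding proper_functional_def
  proof
    \<comment> \<open>Types are inhabited, so \<open>undefined\<close> is a point of
      \<open>X\<close> and its Dirac measure witnesses properness.\<close>
    show "transfer_indicator order_set (measure (return borel undefined), measure (return borel undefined)) < \<infinity>"
      by (simp add: indicator return_prob diag)
  qed (simp add: measure_in_signed_measures return_prob)
  show "bounded_below_functional (transfer_indicator order_set)"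
    unfolding bounded_below_functional_def by (rule exI[of _ 0]) (auto simp: transfer_indicator_def)
  show "{p \<in> signed_measures \<times> signed_measures. transfer_indicator order_set p < \<infinity>}
      \<subseteq> measure ` prob_measures \<times> measure ` prob_measures"
    using order_set_subset by (auto simp: transfer_indicator_def split: if_splits)
  show "weak_star_lsc (transfer_indicator order_set)"
    unfolding weak_star_lsc_def
  proof
    fix c :: real
    show "closedin (prod_topology weak_star weak_star)
        {p \<in> signed_measures \<times> signed_measures. transfer_indicator order_set p \<le> ereal c}"
    proof (cases "0 \<le> c")
      case True
      then have "{p \<in> signed_measures \<times> signed_measures. transfer_indicator order_set p \<le> ereal c} =
          {p \<in> signed_measures \<times> signed_measures. p \<in> map_prod measure measure ` order_set}"
        by (auto simp: transfer_indicator_def)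
      then show ?thesis using closedin_image_order_set by simp
    next
      case False
      then have "{p \<in> signed_measures \<times> signed_measures. transfer_indicator order_set p \<le> ereal c} = {}"
        by (auto simp: transfer_indicator_def)
      then show ?thesis by (simp only: closedin_empty)
    qed
  qed
  show "convex_functional (transfer_indicator order_set)"
    unfolding convex_functional_def
  proof (intro ballI)
    fix m n m' n' :: "'a set \<Rightarrow> real" and l :: real assume l: "l \<in> {0..1}"
    let ?F = "transfer_indicator order_set"
    let ?c = "(\<lambda>A. l * m A + (1 - l) * m' A, \<lambda>A. l * n A + (1 - l) * n' A)"
    \<comment> \<open>Since \<open>0 * \<infinity> = 0\<close> in \<open>ereal\<close>, an infinite
      value makes the right-hand side infinite only for \<open>l\<close> strictly between 0 and 1;
      at the endpoints a single term remains.\<close>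
    consider "l = 0" | "l = 1" | "0 < l" "l < 1" using l by fastforce
    then show "?F ?c \<le> ereal l * ?F (m, n) + ereal (1 - l) * ?F (m', n')"
    proof cases
      case 3
      show ?thesis
      proof (cases "(m, n) \<in> map_prod measure measure ` order_set \<and> (m', n') \<in> map_prod measure measure ` order_set")
        case True
        then obtain \<mu> \<nu> \<mu>' \<nu>' where *: "(\<mu>, \<nu>) \<in> order_set" "m = measure \<mu>" "n = measure \<nu>"
          "(\<mu>', \<nu>') \<in> order_set" "m' = measure \<mu>'" "n' = measure \<nu>'"
          by auto
        have P: "\<mu> \<in> prob_measures" "\<nu> \<in> prob_measures" "\<mu>' \<in> prob_measures" "\<nu>' \<in> prob_measures"
          using * order_set_subset by auto
        obtain \<rho> where \<rho>: "\<rho> \<in> prob_measures" "measure \<rho> = (\<lambda>A. l * measure \<mu> A + (1 - l) * measure \<mu>' A)"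
          "\<And>g. (\<integral>x. apply_bcontfun g x \<partial>\<rho>) = l * (\<integral>x. g x \<partial>\<mu>) + (1 - l) * (\<integral>x. g x \<partial>\<mu>')"
          using prob_measure_convex_combination[OF compact_space P(1,3) l] by blast
        obtain \<tau> where \<tau>: "\<tau> \<in> prob_measures" "measure \<tau> = (\<lambda>A. l * measure \<nu> A + (1 - l) * measure \<nu>' A)"
          "\<And>g. (\<integral>x. apply_bcontfun g x \<partial>\<tau>) = l * (\<integral>x. g x \<partial>\<nu>) + (1 - l) * (\<integral>x. g x \<partial>\<nu>')"
          using prob_measure_convex_combination[OF compact_space P(2,4) l] by blast
        have "(\<rho>, \<tau>) \<in> order_set"
          using * \<rho>(1) \<tau>(1) l
          by (auto simp: order_set_def balayage_le_def \<rho>(3) \<tau>(3) intro!: add_mono mult_left_mono)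
        then have "?F ?c = 0"
          using indicator[OF \<rho>(1) \<tau>(1)] by (simp add: *(2,3,5,6) \<rho>(2) \<tau>(2))
        then show ?thesis using l by (auto simp: transfer_indicator_def)
      next
        case False
        then show ?thesis using 3 by (auto simp: transfer_indicator_def)
      qed
    qed (simp_all add: zero_ereal_def[symmetric] one_ereal_def[symmetric])
  qed
  show "\<exists>U. (\<forall>g. U g \<in> borel_measurable borel \<and> bounded_above (U g)) \<and>
      (\<forall>\<mu>\<in>prob_measures. \<forall>g.
         (SUP \<sigma>\<in>prob_measures. ereal (\<integral>x. apply_bcontfun g x \<partial>\<sigma>) - transfer_indicator order_set (measure \<mu>, measure \<sigma>))
           = ext_integral \<mu> (U g))"
  proof (intro exI[of _ "\<lambda>g x. ereal (envelope g x)"] conjI allI ballI)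
    fix g
    show "(\<lambda>x. ereal (envelope g x)) \<in> borel_measurable borel"
      using usc_measurable[OF usc, of borel g] by simp
    show "bounded_above (\<lambda>x. ereal (envelope g x))"
      using bound[of g] by (auto simp: bounded_above_def abs_le_iff)
  next
    fix \<mu> :: "'a measure" and g assume \<mu>: "\<mu> \<in> prob_measures"
    let ?s = "SUP \<sigma>\<in>prob_measures. ereal (\<integral>x. apply_bcontfun g x \<partial>\<sigma>) - transfer_indicator order_set (measure \<mu>, measure \<sigma>)"
    have "?s \<le> ereal (\<integral>x. envelope g x \<partial>\<mu>)"
      by (rule transfer_SUP_least[OF order_set_subset \<mu>])
        (use balayage_le_iff in \<open>auto simp: order_set_def\<close>)
    \<comment> \<open>A maximizer for \<open>g\<close>; being dominated on all test functions, it
      belongs to the section at \<open>\<mu>\<close>.\<close>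
    moreover obtain \<sigma> where \<sigma>: "\<sigma> \<in> prob_measures" "\<And>f. (\<integral>x. apply_bcontfun f x \<partial>\<sigma>) \<le> (\<integral>x. envelope f x \<partial>\<mu>)"
      "(\<integral>x. envelope g x \<partial>\<mu>) \<le> (\<integral>x. g x \<partial>\<sigma>)"
      using attained[OF \<mu>] by blast
    then have "(\<mu>, \<sigma>) \<in> order_set"
      using \<mu> balayage_le_iff by (simp add: order_set_def)
    then have "ereal (\<integral>x. g x \<partial>\<sigma>) \<le> ?s"
      by (rule transfer_SUP_upper[OF order_set_subset])
    then have "ereal (\<integral>x. envelope g x \<partial>\<mu>) \<le> ?s"
      using \<sigma>(3) by (meson ereal_less_eq(3) order.trans)
    ultimately show "?s = ext_integral \<mu> (\<lambda>x. ereal (envelope g x))"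
      by (simp add: ext_integral_ereal[OF integrable[OF \<mu>]])
  qed
qed

end

theorem theorem1p8:
  fixes S :: "('a::metric_space measure \<times> 'a measure) set"
  assumes "compact (UNIV :: 'a set)"
    and "S \<subseteq> prob_measures \<times> prob_measures"
  shows "((backward_transfer_set S \<and> trans S \<and> Id_on prob_measures \<subseteq> S)
            \<longleftrightarrow> (\<exists>A. balayage_cone A \<and>
                  S = {(\<mu>, \<nu>) \<in> prob_measures \<times> prob_measures. balayage_le A \<mu> \<nu>}))
       \<and> ((\<exists>A. balayage_cone A \<and>
                  S = {(\<mu>, \<nu>) \<in> prob_measures \<times> prob_measures. balayage_le A \<mu> \<nu>})
            \<longleftrightarrow> (\<exists>T. backward_Kantorovich T \<and> idempotent_operator T \<and> positively_homogeneous T \<and>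
                  (\<forall>f x. ereal (apply_bcontfun f x) \<le> T f x) \<and>
                  S = {(\<mu>, \<nu>) \<in> prob_measures \<times> prob_measures. pushforward_le T \<mu> \<nu>}))"
    (is "(?one \<longleftrightarrow> ?two) \<and> (?two \<longleftrightarrow> ?three)")
proof (intro conjI)
  show "?two \<longleftrightarrow> ?three"
    by (rule trans[OF balayage_iff_envelope[OF assms(1)] Kantorovich_iff_envelope[OF assms(1), symmetric]])
  show "?one \<longleftrightarrow> ?two"
  proof (intro iffI conjI)
    assume one: ?one
    interpret transfer_set S
      using assms one by unfold_locales auto
    show ?two
      unfolding balayage_iff_envelope[OF assms(1)]
      using S_eq idempotent_envelope_axioms by blast
  next
    assume ?two
    then obtain A where A: "balayage_cone A" "S = {(\<mu>, \<nu>) \<in> prob_measures \<times> prob_measures. balayage_le A \<mu> \<nu>}"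
      by blast
    interpret balayage A using assms(1) A(1) by unfold_locales
    show "backward_transfer_set S" "trans S" "Id_on prob_measures \<subseteq> S"
      unfolding A(2) order_set_def[symmetric]
      by (rule backward_transfer_set_order_set order_set_trans order_set_diagonal)+
  qed
qed

end
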